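(* Over $\Sigma=\{0,1,\#\}$, let $L_{\mathrm{INTS}}(n)=\{x\#^ny: x,y\in\{0,1\}^n,\ \exists i\ x_i=y_i=1\}$ and $L_{\mathrm{RNE}}(n)=\{x\#^ny: x,y\in\{0,1\}^n,\ \mathrm{NE}_n(x_1\wedge y_1,\dots,x_n\wedge y_n)=1\}$ for $n=3^d$. Then (i) $\mathrm{TS}_{2PFA}(L_{\mathrm{INTS}}(n))=\Omega(n^2)$ and $\mathrm{TS}_{2QCFA}(L_{\mathrm{INTS}}(n))=O(n^{3/2}\log n)$; (ii) $\mathrm{TS}_{2PFA}(L_{\mathrm{RNE}}(n))=\Omega(n^2)$ and $\mathrm{TS}_{2QCFA,exact}(L_{\mathrm{RNE}}(n))=O(n^{1.87}\log n)$.
   Context: $\mathrm{NE}^1:\{0,1\}^3\to\{0,1\}$ is $0$ if $x_1=x_2=x_3$ and $1$ otherwise; for $n=3^d$, $\mathrm{NE}_n=\mathrm{NE}^d$ where $\mathrm{NE}^d(x)=\mathrm{NE}^1(\mathrm{NE}^{d-1}(x_1,\dots,x_{3^{d-1}}),\mathrm{NE}^{d-1}(x_{3^{d-1}+1},\dots,x_{2\cdot3^{d-1}}),\mathrm{NE}^{d-1}(x_{2\cdot3^{d-1}+1},\dots,x_{3^d}))$. Two-way automata read $\vdash w\$$ with a head moving left/stay/right per step and halt upon entering accepting/rejecting states. A 2PFA has probabilistic transitions; a 2QCFA is a two-way deterministic automaton with a finite-dimensional quantum register (basis set $Q$) on which, depending on the classical state and symbol, it applies a unitary or an orthogonal measurement,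 the classical transition depending on the outcome. Recognition with error $\epsilon$: members accepted with probability $\ge1-\epsilon$, non-members with probability $\le\epsilon$. $\mathrm{time}(M)$ = maximal number of steps before halting; $\mathrm{space}(M)=\log_2$ of the number of states (for a 2QCFA, $\log_2|Q|$ plus $\log_2$ of the number of classical states); $\mathrm{TS}(M)=\mathrm{time}(M)\mathrm{space}(M)$. $\mathrm{TS}_{2PFA}(L)$, $\mathrm{TS}_{2QCFA}(L)$, $\mathrm{TS}_{2QCFA,exact}(L)$ are the infima of $\mathrm{TS}(M)$ over 2PFAs recognizing $L$ with error $\le1/3$, 2QCFAs recognizing $L$ with error $\le1/3$, and 2QCFAs recognizing $L$ with error $0$, respectively. *)

theory Defs
  imports "HOL-Probability.Probability_Mass_Function" "Jordan_Normal_Form.Schur_Decomposition"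
begin

unbundle no vec_syntax

datatype 'a cell = LeftEnd | Letter 'a | RightEnd

definition tape :: "'a list \<Rightarrow> nat \<Rightarrow> 'a cell" where
  "tape w i = (if i = 0 then LeftEnd else if i \<le> length w then Letter (w ! (i - 1)) else RightEnd)"

datatype move = MoveL | Stay | MoveR

fun shift :: "move \<Rightarrow> nat \<Rightarrow> nat" where
  "shift MoveL i = i - 1"
| "shift Stay i = i"
| "shift MoveR i = Suc i"

text \<open>The head must not leave the tape: no left move on the left end marker and no right move on
  the right end marker.\<close>

definition legal_move :: "'a cell \<Rightarrow> move \<Rightarrow> bool" where
  "legal_move \<sigma> d \<longleftrightarrow> (\<sigma> = LeftEnd \<longrightarrow> d \<noteq> MoveL) \<and> (\<sigma> = RightEnd \<longrightarrow> d \<noteq> MoveR)"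

text \<open>Classical states are natural numbers. Up to renaming this covers every finite state set, so
  the infima below range over all automata.\<close>

record control =
  states :: "nat set"
  start :: nat
  accepting :: "nat set"
  rejecting :: "nat set"

definition halting :: "'z control_scheme \<Rightarrow> nat set" where
  "halting M = accepting M \<union> rejecting M"

definition wf_control :: "'z control_scheme \<Rightarrow> bool" where
  "wf_control M \<longleftrightarrow> finite (states M) \<and> start M \<in> states M \<and>
     accepting M \<subseteq> states M \<and> rejecting M \<subseteq> states M \<and> accepting M \<inter> rejecting M = {}"

text \<open>Both models are Markov chains, given by a kernel \<open>K\<close> on configurations whose first component is
  the classical state. Halting configurations are fixed points of \<open>K\<close>, so the probability of
  being in an accepting configuration after \<open>t\<close> steps is nondecreasing in \<open>t\<close>.\<close>

primrec run :: "('c \<Rightarrow> 'c pmf) \<Rightarrow> 'c \<Rightarrow> nat \<Rightarrow> 'c pmf" where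
  "run K c 0 = return_pmf c"
| "run K c (Suc t) = bind_pmf (run K c t) K"

definition accept_prob ::
  "'z control_scheme \<Rightarrow> (nat \<times> 'c \<Rightarrow> (nat \<times> 'c) pmf) \<Rightarrow> nat \<times> 'c \<Rightarrow> real" where
  "accept_prob M K c = (SUP t. measure_pmf.prob (run K c t) {c'. fst c' \<in> accepting M})"

text \<open>The number of steps of the longest computation of positive probability; \<open>\<infinity>\<close> if the length
  is unbounded. A computation still running after \<open>t\<close> steps makes at least \<open>Suc t\<close> steps.\<close>

definition steps_before_halting ::
  "'z control_scheme \<Rightarrow> (nat \<times> 'c \<Rightarrow> (nat \<times> 'c) pmf) \<Rightarrow> nat \<times> 'c \<Rightarrow> enat" where
  "steps_before_halting M K c =
     (SUP t \<in> {t. \<exists>c' \<in> set_pmf (run K c t). fst c' \<notin> halting M}. enat (Suc t))"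

definition recognizes_with_error :: "('a list \<Rightarrow> real) \<Rightarrow> 'a list set \<Rightarrow> real \<Rightarrow> bool" where
  "recognizes_with_error p L \<epsilon> \<longleftrightarrow> (\<forall>w. (w \<in> L \<longrightarrow> p w \<ge> 1 - \<epsilon>) \<and> (w \<notin> L \<longrightarrow> p w \<le> \<epsilon>))"

record 'a pfa = control +
  pfa_trans :: "nat \<Rightarrow> 'a cell \<Rightarrow> (nat \<times> move) pmf"

definition wf_pfa :: "'a pfa \<Rightarrow> bool" where
  "wf_pfa M \<longleftrightarrow> wf_control M \<and>
     (\<forall>s \<in> states M - halting M. \<forall>\<sigma>. \<forall>(s', d) \<in> set_pmf (pfa_trans M s \<sigma>).
        s' \<in> states M \<and> legal_move \<sigma> d)"

definition pfa_step :: "'a pfa \<Rightarrow> 'a list \<Rightarrow> nat \<times> nat \<Rightarrow> (nat \<times> nat) pmf" where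
  "pfa_step M w = (\<lambda>(s, i).
     if s \<in> halting M then return_pmf (s, i)
     else map_pmf (\<lambda>(s', d). (s', shift d i)) (pfa_trans M s (tape w i)))"

definition pfa_accept_prob :: "'a pfa \<Rightarrow> 'a list \<Rightarrow> real" where
  "pfa_accept_prob M w = accept_prob M (pfa_step M w) (start M, 0)"

definition pfa_time :: "'a pfa \<Rightarrow> enat" where
  "pfa_time M = (SUP w. steps_before_halting M (pfa_step M w) (start M, 0))"

definition pfa_space :: "'a pfa \<Rightarrow> real" where
  "pfa_space M = log 2 (card (states M))"

definition pfa_TS :: "'a pfa \<Rightarrow> ennreal" where
  "pfa_TS M = ennreal_of_enat (pfa_time M) * ennreal (pfa_space M)"

text \<open>Recognition with some error at most \<open>1/3\<close> is the same as recognition with error \<open>1/3\<close>.\<close>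

definition TS_2PFA :: "'a list set \<Rightarrow> ennreal" where
  "TS_2PFA L = (INF M \<in> {M. wf_pfa M \<and> recognizes_with_error (pfa_accept_prob M) L (1/3)}. pfa_TS M)"

definition unitary_mat :: "nat \<Rightarrow> complex mat \<Rightarrow> bool" where
  "unitary_mat m U \<longleftrightarrow> U \<in> carrier_mat m m \<and> mat_adjoint U * U = 1\<^sub>m m"

definition orthogonal_measurement :: "nat \<Rightarrow> complex mat list \<Rightarrow> bool" where
  "orthogonal_measurement m Ps \<longleftrightarrow>
     (\<forall>P \<in> set Ps. P \<in> carrier_mat m m \<and> mat_adjoint P = P \<and> P * P = P) \<and>
     (\<forall>j < length Ps. \<forall>k < length Ps. j \<noteq> k \<longrightarrow> Ps ! j * Ps ! k = 0\<^sub>m m m) \<and>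
     foldr (+) Ps (0\<^sub>m m m) = 1\<^sub>m m"

datatype qop = Unitary "complex mat" | Measure "complex mat list"

text \<open>The quantum basis set has \<open>qdim\<close> elements, and the register starts in the basis state
  \<open>qstart\<close>. The last argument of \<open>qtrans\<close> is the measurement outcome, an index into the list of
  projectors; a unitary operation has the single outcome 0.\<close>

record 'a qcfa = control +
  qdim :: nat
  qstart :: nat
  qoper :: "nat \<Rightarrow> 'a cell \<Rightarrow> qop"
  qtrans :: "nat \<Rightarrow> 'a cell \<Rightarrow> nat \<Rightarrow> nat \<times> move"

fun wf_qop :: "nat \<Rightarrow> qop \<Rightarrow> bool" where
  "wf_qop m (Unitary U) = unitary_mat m U"
| "wf_qop m (Measure Ps) = orthogonal_measurement m Ps"

fun outcomes :: "qop \<Rightarrow> nat set" where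
  "outcomes (Unitary U) = {0}"
| "outcomes (Measure Ps) = {..<length Ps}"

definition wf_qcfa :: "'a qcfa \<Rightarrow> bool" where
  "wf_qcfa M \<longleftrightarrow> wf_control M \<and> qstart M < qdim M \<and>
     (\<forall>s \<in> states M - halting M. \<forall>\<sigma>.
        wf_qop (qdim M) (qoper M s \<sigma>) \<and>
        (\<forall>j \<in> outcomes (qoper M s \<sigma>).
           fst (qtrans M s \<sigma> j) \<in> states M \<and> legal_move \<sigma> (snd (qtrans M s \<sigma> j))))"

definition norm2 :: "complex Matrix.vec \<Rightarrow> real" where
  "norm2 v = (\<Sum>i < dim_vec v. (cmod (vec_index v i))\<^sup>2)"

text \<open>Born rule: on a unit vector \<open>\<psi>\<close>, outcome \<open>j\<close> has probability \<open>norm2 (Ps ! j *\<^sub>v \<psi>)\<close>, and the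
  register collapses to the normalized projection.\<close>

fun apply_qop :: "qop \<Rightarrow> complex Matrix.vec \<Rightarrow> (nat \<times> complex Matrix.vec) pmf" where
  "apply_qop (Unitary U) \<psi> = return_pmf (0, U *\<^sub>v \<psi>)"
| "apply_qop (Measure Ps) \<psi> =
     map_pmf (\<lambda>j. (j, complex_of_real (1 / sqrt (norm2 (Ps ! j *\<^sub>v \<psi>))) \<cdot>\<^sub>v (Ps ! j *\<^sub>v \<psi>)))
       (embed_pmf (\<lambda>j. if j < length Ps then norm2 (Ps ! j *\<^sub>v \<psi>) else 0))"

type_synonym qconfig = "nat \<times> nat \<times> complex Matrix.vec"

definition qcfa_step :: "'a qcfa \<Rightarrow> 'a list \<Rightarrow> qconfig \<Rightarrow> qconfig pmf" where
  "qcfa_step M w = (\<lambda>(s, i, \<psi>).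
     if s \<in> halting M then return_pmf (s, i, \<psi>)
     else map_pmf (\<lambda>(j, \<psi>'). let (s', d) = qtrans M s (tape w i) j in (s', shift d i, \<psi>'))
            (apply_qop (qoper M s (tape w i)) \<psi>))"

definition qcfa_init :: "'a qcfa \<Rightarrow> qconfig" where
  "qcfa_init M = (start M, 0, unit_vec (qdim M) (qstart M))"

definition qcfa_accept_prob :: "'a qcfa \<Rightarrow> 'a list \<Rightarrow> real" where
  "qcfa_accept_prob M w = accept_prob M (qcfa_step M w) (qcfa_init M)"

definition qcfa_time :: "'a qcfa \<Rightarrow> enat" where
  "qcfa_time M = (SUP w. steps_before_halting M (qcfa_step M w) (qcfa_init M))"

definition qcfa_space :: "'a qcfa \<Rightarrow> real" where
  "qcfa_space M = log 2 (qdim M) + log 2 (card (states M))"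

definition qcfa_TS :: "'a qcfa \<Rightarrow> ennreal" where
  "qcfa_TS M = ennreal_of_enat (qcfa_time M) * ennreal (qcfa_space M)"

definition TS_2QCFA :: "'a list set \<Rightarrow> ennreal" where
  "TS_2QCFA L = (INF M \<in> {M. wf_qcfa M \<and> recognizes_with_error (qcfa_accept_prob M) L (1/3)}. qcfa_TS M)"

definition TS_2QCFA_exact :: "'a list set \<Rightarrow> ennreal" where
  "TS_2QCFA_exact L = (INF M \<in> {M. wf_qcfa M \<and> recognizes_with_error (qcfa_accept_prob M) L 0}. qcfa_TS M)"

datatype letter = Bit bool | Hash

definition padded :: "bool list \<Rightarrow> nat \<Rightarrow> bool list \<Rightarrow> letter list" where
  "padded x n y = map Bit x @ replicate n Hash @ map Bit y"

definition L_INTS :: "nat \<Rightarrow> letter list set" where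
  "L_INTS n = {padded x n y | x y. length x = n \<and> length y = n \<and> (\<exists>i < n. x ! i \<and> y ! i)}"

definition NE1 :: "bool \<Rightarrow> bool \<Rightarrow> bool \<Rightarrow> bool" where
  "NE1 a b c \<longleftrightarrow> \<not> (a = b \<and> b = c)"

text \<open>The recursion starts from the identity on one bit, so that \<open>NE (Suc 0)\<close> is \<open>NE1\<close>. The value
  \<open>NE d x\<close> is meaningful for \<open>length x = 3 ^ d\<close>.\<close>

fun NE :: "nat \<Rightarrow> bool list \<Rightarrow> bool" where
  "NE 0 x = hd x"
| "NE (Suc d) x =
     NE1 (NE d (take (3 ^ d) x))
         (NE d (take (3 ^ d) (drop (3 ^ d) x)))
         (NE d (take (3 ^ d) (drop (2 * 3 ^ d) x)))"

text \<open>Indexed by the exponent \<open>d\<close>; the length parameter is \<open>n = 3 ^ d\<close>.\<close>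

definition L_RNE :: "nat \<Rightarrow> letter list set" where
  "L_RNE d = {padded x (3 ^ d) y | x y.
     length x = 3 ^ d \<and> length y = 3 ^ d \<and> NE d (map2 (\<and>) x y)}"

definition bigomega_ennreal :: "(nat \<Rightarrow> ennreal) \<Rightarrow> (nat \<Rightarrow> real) \<Rightarrow> bool" where
  "bigomega_ennreal f g \<longleftrightarrow> (\<exists>c::real > 0. \<forall>\<^sub>F n in sequentially. ennreal (c * g n) \<le> f n)"

definition bigo_ennreal :: "(nat \<Rightarrow> ennreal) \<Rightarrow> (nat \<Rightarrow> real) \<Rightarrow> bool" where
  "bigo_ennreal f g \<longleftrightarrow> (\<exists>c::real > 0. \<forall>\<^sub>F n in sequentially. f n \<le> ennreal (c * g n))"

end

theory Submission
  imports Defs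
begin

text \<open>Lower bounds. At the all-zero input \<open>NE d\<close> is sensitive to each of its \<open>3 ^ d\<close> bits, so both languages
  contain unique disjointness. A 2PFA that runs for at most \<open>T\<close> steps crosses the block of separators at
  most \<open>T / n\<close> times, and its acceptance probability is a sum over the lists \<open>\<tau>\<close> of the states at the
  crossings of products \<open>a \<tau> x * b \<tau> y\<close>. The times of the crossings are not recorded; this is what
  saves a logarithmic factor. Such a decomposition needs \<open>exp (\<Omega>(n))\<close> lists by the information
  complexity argument: Hellinger distances per coordinate, with the level-one inequality in the place of
  the chain rule for mutual information.

  Upper bounds. A query to the bits \<open>x i \<and> y i\<close> costs one round trip of the head. For intersection,
  amplitude amplification is run for \<open>1, 2, 4, \<dots>\<close> iterations, with a measurement after each stage that
  accepts unless the register is back in its initial state. The survival amplitude is a product of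
  cosines of successively doubled angles, which telescopes. For \<open>NE\<close>, following Ambainis, an
  algorithm fixes its start vector \<open>s\<close> on inputs with value \<open>0\<close> and maps it to a vector with inner product
  \<open>p\<close> with \<open>s\<close> on inputs with value \<open>1\<close>. Twice the number of queries buys either one more level, with
  \<open>1 - p\<close> replaced by \<open>4 * (1 - p)\<^sup>2 / 9\<close>, or amplification from \<open>p\<close> to \<open>2 * p\<^sup>2 - 1\<close>. Three
  amplifications in eight levels return from \<open>p = -1\<close> to \<open>p = -1\<close>.\<close>

section \<open>Unique disjointness\<close>

text \<open>The lower bound has no room for a logarithm other than that of the number of states:
  \<open>T / n\<close> announcements out of \<open>s\<close> states carry about
  \<open>(T / n) * ln s\<close> nats, which matches TS divided by n, whereas naming the times of the
  crossings would add \<open>ln T\<close> for each. The price is that a leg of a history does not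
  know how much time is left, so the probability of a history is not visibly a product. Each leg is
  therefore granted the whole time budget. This gives only an upper bound by products; but the
  products sum to at most 1 and the true probabilities sum to exactly 1, so the bound is an
  equality.

  In the upper bounds the clock sits in the classical states; its logarithm and that of the quantum
  dimension are the factor \<open>log n\<close> of the theorem. Amplification and the step to the
  next level of NE both have the form A R A, with one reflection R between two runs of the same
  algorithm A. If A is its own inverse then so is A R A, hence no inverse algorithm has to be
  constructed.\<close>

lemma cosh_le_exp_half_square: "cosh (x::real) \<le> exp (x\<^sup>2 / 2)"
proof -
  \<comment> \<open>The two power series are compared term by term, \<open>x^(2n) / (2n)!\<close>
    against \<open>(x^2 / 2)^n / n!\<close>.\<close>
  have fact_bound: "2 ^ n * fact n \<le> (fact (2*n) :: real)" for n
  proof (induction n)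
    case (Suc n)
    have "2 ^ Suc n * fact (Suc n) = (2 * real (Suc n)) * (2 ^ n * fact n)" by (simp add: algebra_simps)
    also have "\<dots> \<le> (2 * real (Suc n)) * fact (2*n)"
      by (rule mult_left_mono[OF Suc.IH]) auto
    also have "\<dots> \<le> (real (2*n+2) * real (2*n+1)) * fact (2*n)"
      by (rule mult_right_mono) (auto simp: algebra_simps)
    also have "\<dots> = fact (2 * Suc n)" by (simp add: algebra_simps)
    finally show ?case .
  qed simp
  have e: "(\<lambda>n. if even n then x ^ n /\<^sub>R fact n else 0) sums cosh x"
    using cosh_converges[of x] by simp
  have c: "(\<lambda>n. x ^ (2*n) / fact (2*n)) sums cosh x"
  proof -
    have "strict_mono (\<lambda>n::nat. 2*n)" by (auto simp: strict_mono_def)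
    moreover have "(if even n then x ^ n /\<^sub>R fact n else 0) = 0" if "n \<notin> range (\<lambda>n. 2*n)" for n
      using that by (auto elim!: evenE)
    ultimately show ?thesis
      using sums_mono_reindex[of "\<lambda>n::nat. 2*n" "\<lambda>n. if even n then x ^ n /\<^sub>R fact n else 0" "cosh x"] e
      by (simp add: scaleR_conv_of_real field_simps)
  qed
  have g: "(\<lambda>n. (x\<^sup>2/2) ^ n /\<^sub>R fact n) sums exp (x\<^sup>2/2)" by (rule exp_converges)
  show ?thesis
  proof (rule sums_le[OF _ c g])
    fix n
    have "x ^ (2*n) / fact (2*n) \<le> x ^ (2*n) / (2 ^ n * fact n)"
      by (rule divide_left_mono[OF fact_bound]) (auto simp: power_mult)
    also have "\<dots> = (x\<^sup>2/2) ^ n /\<^sub>R fact n"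
    proof -
      have "(x\<^sup>2/2) ^ n = x ^ (2*n) / 2 ^ n" by (simp only: power_divide power_mult)
      moreover have "u / (v * w) = (u / v) /\<^sub>R w" for u v w :: real by (simp add: divide_inverse)
      ultimately show ?thesis by (simp only:)
    qed
    finally show "x ^ (2*n) / fact (2*n) \<le> (x\<^sup>2/2) ^ n /\<^sub>R fact n" .
  qed
qed

text \<open>A set \<open>z\<close> is read as a point of the Boolean cube with coordinates 1 and -1,
  so the averages of \<open>f z * chi i z\<close> are, up to sign, the Fourier coefficients of
  \<open>f\<close> of degree one.\<close>

definition chi :: "nat \<Rightarrow> nat set \<Rightarrow> real" where
  "chi i z = (if i \<in> z then 1 else - 1)"

text \<open>The coordinates of a uniformly random subset are independent, so the moment factors into
  the numbers \<open>2 * cosh (w i)\<close>; this is the sub-Gaussian bound for a weighted sum of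
  random signs.\<close>

lemma exp_moment_characters:
  assumes "finite I"
  shows "(\<Sum>z\<in>Pow I. exp (\<Sum>i\<in>I. w i * chi i z)) \<le> 2 ^ card I * exp ((\<Sum>i\<in>I. (w i)\<^sup>2) / 2)"
proof -
  have "(\<Sum>z\<in>Pow I. exp (\<Sum>i\<in>I. w i * chi i z))
      = (\<Sum>z\<in>Pow I. (\<Prod>i\<in>z. exp (w i)) * (\<Prod>i\<in>I-z. exp (- w i)))"
  proof (rule sum.cong)
    fix z assume z: "z \<in> Pow I"
    have "(\<Sum>i\<in>I. w i * chi i z) = (\<Sum>i\<in>z. w i * chi i z) + (\<Sum>i\<in>I-z. w i * chi i z)"
      using sum.subset_diff[of z I "\<lambda>i. w i * chi i z"] z assms by auto
    also have "\<dots> = (\<Sum>i\<in>z. w i) + (\<Sum>i\<in>I-z. - w i)"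
      by (intro arg_cong2[where f="(+)"] sum.cong) (auto simp: chi_def)
    finally show "exp (\<Sum>i\<in>I. w i * chi i z) = (\<Prod>i\<in>z. exp (w i)) * (\<Prod>i\<in>I-z. exp (- w i))"
      using z assms finite_subset[of z I] by (simp add: exp_add exp_sum)
  qed simp
  also have "\<dots> = (\<Prod>i\<in>I. exp (w i) + exp (- w i))"
    using prod_add[OF assms, of "\<lambda>i. exp (w i)" "\<lambda>i. exp (- w i)"] by simp
  also have "\<dots> \<le> (\<Prod>i\<in>I. 2 * exp ((w i)\<^sup>2/2))"
  proof (rule prod_mono)
    fix i assume "i \<in> I"
    show "0 \<le> exp (w i) + exp (- w i) \<and> exp (w i) + exp (- w i) \<le> 2 * exp ((w i)\<^sup>2/2)"
      using cosh_le_exp_half_square[of "w i"] by (auto simp: cosh_def add_nonneg_nonneg)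
  qed
  also have "\<dots> = 2 ^ card I * exp ((\<Sum>i\<in>I. (w i)\<^sup>2) / 2)"
    using assms by (simp add: prod.distrib exp_sum sum_divide_distrib)
  finally show ?thesis .
qed

text \<open>Comparison of the exponential moment of the linear form \<open>\<Sum>i. w i * chi i\<close> under \<open>f\<close>
  (bounded below by convexity) and under the uniform distribution.\<close>

lemma level_one_inequality:
  fixes f :: "nat set \<Rightarrow> real"
  assumes fin: "finite I" and f: "\<And>z. z \<subseteq> I \<Longrightarrow> 0 \<le> f z \<and> f z \<le> 1"
    and p_def: "p = (\<Sum>z\<in>Pow I. f z) / 2 ^ card I" and p: "p > 0"
    and w_def: "\<And>i. i \<in> I \<Longrightarrow> w i = (\<Sum>z\<in>Pow I. f z * chi i z) / 2 ^ card I"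
  shows "(\<Sum>i\<in>I. (w i)\<^sup>2) \<le> 2 * p\<^sup>2 * ln (1 / p)"
proof -
  define W where "W = (\<Sum>i\<in>I. (w i)\<^sup>2)"
  define N :: real where "N = 2 ^ card I"
  have N: "N > 0" by (simp add: N_def)
  define g where "g z = (\<Sum>i\<in>I. w i / p * chi i z)" for z
  \<comment> \<open>\<open>c\<close> is the mean of \<open>g\<close> under the density proportional
    to \<open>f\<close>, and with the weights \<open>w i / p\<close> it is also the sum of their
    squares. The tangent of exp at \<open>c\<close> therefore averages to \<open>exp c\<close> under
    \<open>f\<close>, while the uniform moment is at most \<open>exp (c / 2)\<close>.\<close>
  define c where "c = W / p\<^sup>2"
  have sf: "(\<Sum>z\<in>Pow I. f z) = N * p" using p_def N by (simp add: N_def)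
  have sg: "(\<Sum>z\<in>Pow I. f z * g z) = N * p * c"
  proof -
    have "(\<Sum>z\<in>Pow I. f z * g z) = (\<Sum>i\<in>I. w i / p * (\<Sum>z\<in>Pow I. f z * chi i z))"
      unfolding g_def sum_distrib_left by (subst sum.swap) (simp add: mult_ac)
    also have "\<dots> = (\<Sum>i\<in>I. w i / p * (N * w i))"
      using w_def N by (intro sum.cong) (auto simp: N_def)
    also have "\<dots> = N * W / p"
      unfolding W_def by (simp add: sum_distrib_left sum_divide_distrib power2_eq_square mult_ac)
    finally show ?thesis using p by (simp add: c_def power2_eq_square)
  qed
  have "exp c * (N * p) = (\<Sum>z\<in>Pow I. f z * (exp c * (1 + g z - c)))"
  proof -
    have "(\<Sum>z\<in>Pow I. f z * (exp c * (1 + g z - c)))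
       = exp c * ((\<Sum>z\<in>Pow I. f z) + (\<Sum>z\<in>Pow I. f z * g z) - c * (\<Sum>z\<in>Pow I. f z))"
    proof -
      have "(\<Sum>z\<in>Pow I. f z * (exp c * (1 + g z - c)))
          = (\<Sum>z\<in>Pow I. exp c * ((f z + f z * g z) - c * f z))"
        by (intro sum.cong refl) (simp add: algebra_simps)
      thus ?thesis
        by (simp only: sum_distrib_left[of "exp c", symmetric] sum.distrib sum_subtractf sum_distrib_left[of c, symmetric])
    qed
    also have "\<dots> = exp c * (N * p)" unfolding sf sg by (simp add: algebra_simps)
    finally show ?thesis by simp
  qed
  also have "\<dots> \<le> (\<Sum>z\<in>Pow I. 1 * exp (g z))"
  proof (rule sum_mono)
    fix z assume z: "z \<in> Pow I"
    have "exp c * (1 + (g z - c)) \<le> exp c * exp (g z - c)"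
      by (intro mult_left_mono exp_ge_add_one_self) auto
    hence *: "exp c * (1 + g z - c) \<le> exp (g z)" by (simp add: exp_diff algebra_simps)
    have "f z * (exp c * (1 + g z - c)) \<le> f z * exp (g z)"
      using f[of z] z * by (intro mult_left_mono) auto
    also have "\<dots> \<le> 1 * exp (g z)" using f[of z] z by (intro mult_right_mono) auto
    finally show "f z * (exp c * (1 + g z - c)) \<le> 1 * exp (g z)" .
  qed
  also have "\<dots> \<le> N * exp ((\<Sum>i\<in>I. (w i / p)\<^sup>2) / 2)"
    unfolding g_def N_def using exp_moment_characters[OF fin, of "\<lambda>i. w i / p"] by simp
  also have "(\<Sum>i\<in>I. (w i / p)\<^sup>2) = c"
    by (simp add: c_def W_def power_divide sum_divide_distrib)
  finally have "exp c * p \<le> exp (c/2)" using N by (simp add: mult.left_commute)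
  hence "ln (exp c * p) \<le> ln (exp (c/2))" using p by (subst ln_le_cancel_iff) auto
  hence "c + ln p \<le> c / 2" using p by (simp add: ln_mult)
  hence "c \<le> 2 * ln (1/p)" using p by (simp add: ln_div)
  hence "W \<le> 2 * ln (1/p) * p\<^sup>2" using p by (simp add: c_def field_simps)
  thus ?thesis by (simp add: W_def mult_ac)
qed

text \<open>The difference of the roots is \<open>2 * w\<close> divided by their sum, and the square
  of the sum is at least \<open>2 * p\<close>.\<close>

lemma sqrt_diff_square_le:
  fixes p w :: real
  assumes "p > 0" "\<bar>w\<bar> \<le> p"
  shows "(sqrt (p + w) - sqrt (p - w))\<^sup>2 \<le> 2 * w\<^sup>2 / p"
proof -
  let ?u = "sqrt (p + w)" and ?v = "sqrt (p - w)"
  have uv: "?u\<^sup>2 = p + w" "?v\<^sup>2 = p - w" "?u \<ge> 0" "?v \<ge> 0" using assms by auto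
  have "(?u - ?v)\<^sup>2 * p \<le> (?u - ?v)\<^sup>2 * ((?u + ?v)\<^sup>2 / 2)"
  proof (rule mult_left_mono)
    have "(?u + ?v)\<^sup>2 = 2 * p + 2 * (?u * ?v)" using uv by (simp add: power2_sum)
    moreover have "?u * ?v \<ge> 0" using uv by simp
    ultimately show "p \<le> (?u + ?v)\<^sup>2 / 2" by linarith
  qed simp
  also have "\<dots> = (?u\<^sup>2 - ?v\<^sup>2)\<^sup>2 / 2" by (simp add: power2_eq_square algebra_simps)
  also have "\<dots> = 2 * w\<^sup>2" unfolding uv by (simp add: power2_eq_square algebra_simps)
  finally show ?thesis using assms by (simp add: field_simps)
qed

text \<open>For \<open>i\<close> in \<open>I\<close>, the conditional mean of \<open>f z\<close>
  over uniform \<open>z\<close>, given whether \<open>i\<close> lies in \<open>z\<close>.\<close>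

definition half_avg :: "nat set \<Rightarrow> (nat set \<Rightarrow> real) \<Rightarrow> nat \<Rightarrow> bool \<Rightarrow> real" where
  "half_avg I f i b = (\<Sum>z\<in>Pow (I - {i}). f (if b then insert i z else z)) / 2 ^ (card I - 1)"

lemma sum_Pow_split:
  assumes "finite I" "i \<in> I"
  shows "(\<Sum>z\<in>Pow I. f z) = (\<Sum>z\<in>Pow (I - {i}). f z) + (\<Sum>z\<in>Pow (I - {i}). f (insert i z) :: real)"
proof -
  have I: "I = insert i (I - {i})" using assms by auto
  have "(\<Sum>z\<in>Pow I. f z) = (\<Sum>z\<in>Pow (I - {i}). f z) + (\<Sum>z\<in>insert i ` Pow (I - {i}). f z)"
    by (subst I, subst Pow_insert, subst sum.union_disjoint) (use assms in auto)
  also have "(\<Sum>z\<in>insert i ` Pow (I - {i}). f z) = (\<Sum>z\<in>Pow (I - {i}). f (insert i z))"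
    by (subst sum.reindex) (auto simp: inj_on_def)
  finally show ?thesis .
qed

text \<open>The two conditional means are \<open>p + w i\<close> and \<open>p - w i\<close> with the
  degree-one coefficient \<open>w i\<close>. The level-one inequality then bounds the sum by an
  entropy term, and such terms can be added over all transcripts.\<close>

lemma sum_sqrt_influences_le:
  fixes f :: "nat set \<Rightarrow> real"
  assumes fin: "finite I" and f: "\<And>z. z \<subseteq> I \<Longrightarrow> 0 \<le> f z \<and> f z \<le> 1"
    and p_def: "p = (\<Sum>z\<in>Pow I. f z) / 2 ^ card I"
  shows "(\<Sum>i\<in>I. (sqrt (half_avg I f i True) - sqrt (half_avg I f i False))\<^sup>2) \<le> 4 * (p * ln (1 / p))"
proof -
  define w where "w i = (\<Sum>z\<in>Pow I. f z * chi i z) / 2 ^ card I" for i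
  have pw: "half_avg I f i True = p + w i" "half_avg I f i False = p - w i" if "i \<in> I" for i
  proof -
    have c: "card I = Suc (card I - 1)" using that fin by (metis card_gt_0_iff Suc_pred' empty_iff)
    define A where "A = (\<Sum>z\<in>Pow (I - {i}). f (insert i z))"
    define B where "B = (\<Sum>z\<in>Pow (I - {i}). f z)"
    have "(\<Sum>z\<in>Pow I. f z) = B + A"
      unfolding A_def B_def by (rule sum_Pow_split[OF fin that])
    moreover have "(\<Sum>z\<in>Pow I. f z * chi i z) = A - B"
    proof -
      have "(\<Sum>z\<in>Pow (I - {i}). f z * chi i z) = (\<Sum>z\<in>Pow (I - {i}). - f z)"
        by (intro sum.cong) (auto simp: chi_def)
      moreover have "(\<Sum>z\<in>Pow (I - {i}). f (insert i z) * chi i (insert i z)) = A"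
        by (simp add: chi_def A_def)
      ultimately show ?thesis
        by (subst sum_Pow_split[OF fin that]) (simp add: A_def B_def sum_negf)
    qed
    moreover have "half_avg I f i True = A / 2 ^ (card I - 1)" "half_avg I f i False = B / 2 ^ (card I - 1)"
      by (simp_all add: half_avg_def A_def B_def)
    moreover have "(2::real) ^ card I = 2 * 2 ^ (card I - 1)" by (subst c) simp
    moreover have "A / m = (B + A) / (2 * m) + (A - B) / (2 * m)"
      "B / m = (B + A) / (2 * m) - (A - B) / (2 * m)" if "m > 0" for m :: real
      using that by (simp_all add: field_simps)
    ultimately show "half_avg I f i True = p + w i" "half_avg I f i False = p - w i"
      unfolding p_def w_def by simp_all
  qed
  have nn: "half_avg I f i b \<ge> 0" if "i \<in> I" for i b
  proof -
    have "0 \<le> f (if b then insert i z else z)" if "z \<in> Pow (I - {i})" for z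
      by (rule conjunct1[OF f]) (use that \<open>i \<in> I\<close> in auto)
    thus ?thesis unfolding half_avg_def by (intro divide_nonneg_nonneg sum_nonneg) auto
  qed
  have p0: "p \<ge> 0" unfolding p_def using f by (intro divide_nonneg_nonneg sum_nonneg) auto
  have absw: "\<bar>w i\<bar> \<le> p" if "i \<in> I" for i
    using nn[OF that, of True] nn[OF that, of False] pw[OF that] by auto
  show ?thesis
  proof (cases "p = 0")
    case True
    hence "half_avg I f i True = half_avg I f i False" if "i \<in> I" for i
      using absw[OF that] pw[OF that] by simp
    thus ?thesis using True by simp
  next
    case False
    hence p: "p > 0" using p0 by simp
    have "(\<Sum>i\<in>I. (sqrt (half_avg I f i True) - sqrt (half_avg I f i False))\<^sup>2) \<le> (\<Sum>i\<in>I. 2 * (w i)\<^sup>2 / p)"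
      using sqrt_diff_square_le[OF p absw] pw by (intro sum_mono) auto
    also have "\<dots> = 2 / p * (\<Sum>i\<in>I. (w i)\<^sup>2)" by (simp add: sum_distrib_left)
    also have "\<dots> \<le> 2 / p * (2 * p\<^sup>2 * ln (1/p))"
      using level_one_inequality[OF fin f p_def p, of w] p by (intro mult_left_mono) (auto simp: w_def)
    also have "\<dots> = 4 * (p * ln (1/p))" using p by (simp add: power2_eq_square field_simps)
    finally show ?thesis .
  qed
qed

lemma entropy_le_ln_card:
  fixes p :: "'t \<Rightarrow> real"
  assumes fin: "finite T" and p: "\<And>t. t \<in> T \<Longrightarrow> p t \<ge> 0" and s: "(\<Sum>t\<in>T. p t) = 1"
  shows "(\<Sum>t\<in>T. p t * ln (1 / p t)) \<le> ln (card T)"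
proof -
  have N: "real (card T) > 0" using s fin by (cases "T = {}") (auto simp: card_gt_0_iff)
  \<comment> \<open>Gibbs' inequality against the uniform distribution, in pointwise form:
    \<open>ln x \<le> x - 1\<close> at \<open>x = 1 / (p t * card T)\<close>.\<close>
  have "p t * ln (1 / p t) \<le> p t * ln (card T) + (1 / card T - p t)" if "t \<in> T" for t
  proof (cases "p t = 0")
    case False
    hence pt: "p t > 0" using p[OF that] by simp
    have "ln (1 / (p t * card T)) \<le> 1 / (p t * card T) - 1"
      using pt N by (intro ln_le_minus_one) auto
    hence "p t * ln (1 / (p t * card T)) \<le> p t * (1 / (p t * card T) - 1)"
      using pt by (intro mult_left_mono) auto
    also have "\<dots> = 1 / card T - p t" using pt by (simp add: field_simps)
    finally show ?thesis using pt N by (simp add: ln_div ln_mult algebra_simps)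
  qed simp
  hence "(\<Sum>t\<in>T. p t * ln (1 / p t)) \<le> (\<Sum>t\<in>T. p t * ln (card T) + (1 / card T - p t))"
    by (rule sum_mono)
  also have "\<dots> = ln (card T)"
    using s N by (simp add: sum.distrib sum_subtractf sum_distrib_right[symmetric])
  finally show ?thesis .
qed

text \<open>The product structure makes the Hellinger affinity of the inputs \<open>00, 11\<close> equal to that
  of \<open>01, 10\<close>, while the outputs on \<open>00\<close> and \<open>11\<close> differ noticeably.\<close>

lemma cut_and_paste:
  fixes a b :: "bool \<Rightarrow> 't \<Rightarrow> real"
  assumes fin: "finite T" and A: "A \<subseteq> T"
    and nn: "\<And>u t. t \<in> T \<Longrightarrow> a u t \<ge> 0" "\<And>u t. t \<in> T \<Longrightarrow> b u t \<ge> 0"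
    and one: "\<And>u v. (\<Sum>t\<in>T. a u t * b v t) = 1"
    and rej: "(\<Sum>t\<in>A. a False t * b False t) \<le> 1/3"
    and acc: "(\<Sum>t\<in>A. a True t * b True t) \<ge> 2/3"
  shows "1 / 72 \<le> (\<Sum>t\<in>T. (sqrt (a False t * b True t) - sqrt (a False t * b False t))\<^sup>2)
     + (\<Sum>t\<in>T. (sqrt (a True t * b False t) - sqrt (a False t * b False t))\<^sup>2)"
proof -
  define q where "q u v t = sqrt (a u t * b v t)" for u v t
  have q2: "(q u v t)\<^sup>2 = a u t * b v t" "q u v t \<ge> 0" if "t \<in> T" for u v t
    using nn that by (auto simp: q_def)
  have sq2: "(\<Sum>t\<in>T. (q u v t)\<^sup>2) = 1" for u v using one q2 by simp
  have finA: "finite A" using A fin finite_subset by auto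
  define H where "H = (\<Sum>t\<in>T. (q True True t - q False False t)\<^sup>2)"
  have H0: "H \<ge> 0" unfolding H_def by (intro sum_nonneg) auto
  \<comment> \<open>The gap 1/3 between the acceptance probabilities and Cauchy-Schwarz give
    \<open>(1/3)^2 \<le> 4 * H\<close>, so \<open>H\<close> is at least 1/36. Going from 01 to 10
    through 00 then loses the factor 2 that leads to 1/72.\<close>
  have "1/3 \<le> (\<Sum>t\<in>A. (q True True t)\<^sup>2 - (q False False t)\<^sup>2)"
  proof -
    have "(\<Sum>t\<in>A. (q True True t)\<^sup>2 - (q False False t)\<^sup>2) = (\<Sum>t\<in>A. a True t * b True t) - (\<Sum>t\<in>A. a False t * b False t)"
      unfolding sum_subtractf using A q2 by (intro arg_cong2[where f="(-)"] sum.cong) auto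
    thus ?thesis using rej acc by linarith
  qed
  also have "\<dots> = (\<Sum>t\<in>A. (q True True t - q False False t) * (q True True t + q False False t))"
    by (simp add: power2_eq_square algebra_simps)
  finally have "(1/3)\<^sup>2 \<le> (\<Sum>t\<in>A. (q True True t - q False False t) * (q True True t + q False False t))\<^sup>2"
    by (intro power_mono) auto
  also have "\<dots> \<le> (\<Sum>t\<in>A. (q True True t - q False False t)\<^sup>2) * (\<Sum>t\<in>A. (q True True t + q False False t)\<^sup>2)"
    by (rule Cauchy_Schwarz_ineq_sum)
  also have "\<dots> \<le> H * 4"
  proof (rule mult_mono)
    show "(\<Sum>t\<in>A. (q True True t - q False False t)\<^sup>2) \<le> H"
      unfolding H_def using A fin by (intro sum_mono2) auto
    have "(\<Sum>t\<in>A. (q True True t + q False False t)\<^sup>2) \<le> (\<Sum>t\<in>T. (q True True t + q False False t)\<^sup>2)"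
      using A fin by (intro sum_mono2) auto
    also have "\<dots> \<le> (\<Sum>t\<in>T. 2 * (q True True t)\<^sup>2 + 2 * (q False False t)\<^sup>2)"
    proof (rule sum_mono)
      fix t
      have "0 \<le> (q True True t - q False False t)\<^sup>2" by simp
      thus "(q True True t + q False False t)\<^sup>2 \<le> 2 * (q True True t)\<^sup>2 + 2 * (q False False t)\<^sup>2"
        by (simp add: power2_eq_square algebra_simps)
    qed
    also have "\<dots> = 4" by (simp add: sum.distrib sum_distrib_left[symmetric] sq2)
    finally show "(\<Sum>t\<in>A. (q True True t + q False False t)\<^sup>2) \<le> 4" .
  qed (auto intro!: sum_nonneg simp: H0)
  finally have H: "H \<ge> 1/36" by (simp add: power2_eq_square)
  have expand: "(\<Sum>t\<in>T. (q u v t - q u' v' t)\<^sup>2) = 2 - 2 * (\<Sum>t\<in>T. q u v t * q u' v' t)" for u v u' v'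
  proof -
    have "(\<Sum>t\<in>T. (q u v t - q u' v' t)\<^sup>2) = (\<Sum>t\<in>T. (q u v t)\<^sup>2) + (\<Sum>t\<in>T. (q u' v' t)\<^sup>2) - 2 * (\<Sum>t\<in>T. q u v t * q u' v' t)"
      by (simp add: power2_diff sum.distrib sum_subtractf sum_distrib_left mult.assoc)
    thus ?thesis by (simp add: sq2)
  qed
  have "H = (\<Sum>t\<in>T. (q False True t - q True False t)\<^sup>2)"
    unfolding H_def expand by (simp add: q_def real_sqrt_mult[symmetric] mult_ac)
  also have "\<dots> \<le> (\<Sum>t\<in>T. 2 * (q False True t - q False False t)\<^sup>2 + 2 * (q True False t - q False False t)\<^sup>2)"
  proof (rule sum_mono)
    fix t
    have "0 \<le> ((q False True t - q False False t) + (q True False t - q False False t))\<^sup>2" by simp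
    thus "(q False True t - q True False t)\<^sup>2 \<le> 2 * (q False True t - q False False t)\<^sup>2 + 2 * (q True False t - q False False t)\<^sup>2"
      by (simp add: power2_eq_square algebra_simps)
  qed
  also have "\<dots> = 2 * ((\<Sum>t\<in>T. (q False True t - q False False t)\<^sup>2) + (\<Sum>t\<in>T. (q True False t - q False False t)\<^sup>2))"
    by (simp add: sum.distrib sum_distrib_left)
  finally have "H / 2 \<le> (\<Sum>t\<in>T. (q False True t - q False False t)\<^sup>2) + (\<Sum>t\<in>T. (q True False t - q False False t)\<^sup>2)"
    by simp
  moreover have "1/72 \<le> H / 2" using H by simp
  ultimately show ?thesis unfolding q_def by (rule order.trans[rotated])
qed

lemma sum_Pow_disjoint_union:
  assumes "finite D" "finite E" "D \<inter> E = {}"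
  shows "(\<Sum>z\<in>Pow (D \<union> E). g (z \<inter> D) * h (z \<inter> E)) = (\<Sum>X\<in>Pow D. g X) * (\<Sum>Y\<in>Pow E. h Y :: real)"
proof -
  have "(\<Sum>z\<in>Pow (D \<union> E). g (z \<inter> D) * h (z \<inter> E)) = (\<Sum>(X, Y)\<in>Pow D \<times> Pow E. g X * h Y)"
    by (rule sum.reindex_bij_witness[of _ "\<lambda>(X, Y). X \<union> Y" "\<lambda>z. (z \<inter> D, z \<inter> E)"])
       (use assms in \<open>auto simp: Int_Un_distrib2 disjoint_iff intro!: arg_cong2[where f="(*)"] arg_cong[where f=g] arg_cong[where f=h]\<close>)
  thus ?thesis by (simp add: sum_product sum.cartesian_product)
qed

text \<open>Averaging over the set \<open>D\<close> of coordinates on which the first player holds the free bit: for each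
  fixed \<open>D\<close> the influences of the free bits on the transcript add up to at most \<open>4 ln N\<close>, while for
  each coordinate \<open>i\<close> the sets \<open>D\<close> and \<open>insert i D\<close> together contribute a constant.\<close>

theorem unique_disjointness_bound:
  fixes a b :: "'t \<Rightarrow> nat set \<Rightarrow> real"
  assumes finI: "finite I" and finT: "finite T" and A: "A \<subseteq> T"
    and nn: "\<And>t X. t \<in> T \<Longrightarrow> X \<subseteq> I \<Longrightarrow> a t X \<ge> 0" "\<And>t X. t \<in> T \<Longrightarrow> X \<subseteq> I \<Longrightarrow> b t X \<ge> 0"
    and one: "\<And>X Y. X \<subseteq> I \<Longrightarrow> Y \<subseteq> I \<Longrightarrow> (\<Sum>t\<in>T. a t X * b t Y) = 1"
    and rej: "\<And>X Y. X \<subseteq> I \<Longrightarrow> Y \<subseteq> I \<Longrightarrow> X \<inter> Y = {} \<Longrightarrow> (\<Sum>t\<in>A. a t X * b t Y) \<le> 1/3"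
    and acc: "\<And>X Y i. X \<subseteq> I \<Longrightarrow> Y \<subseteq> I \<Longrightarrow> X \<inter> Y = {i} \<Longrightarrow> (\<Sum>t\<in>A. a t X * b t Y) \<ge> 2/3"
  shows "card I / 576 \<le> ln (card T)"
proof -
  \<comment> \<open>\<open>D\<close> assigns every coordinate of \<open>z\<close> to one player, who
    holds the bit there while the other holds 0. All pairs of inputs averaged here are thus
    disjoint; intersecting pairs enter only through \<open>cut_and_paste\<close>.\<close>
  define f where "f D t z = a t (z \<inter> D) * b t (z \<inter> (I - D))" for D t z
  define h where "h D i = (\<Sum>t\<in>T. (sqrt (half_avg I (f D t) i True) - sqrt (half_avg I (f D t) i False))\<^sup>2)" for D i
  have f01: "0 \<le> f D t z \<and> f D t z \<le> 1" if D: "D \<subseteq> I" and t: "t \<in> T" and z: "z \<subseteq> I" for D t z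
  proof -
    have s: "z \<inter> D \<subseteq> I" "z \<inter> (I - D) \<subseteq> I" using z by auto
    have "f D t z \<le> (\<Sum>t\<in>T. a t (z \<inter> D) * b t (z \<inter> (I - D)))"
      unfolding f_def using nn s finT t by (intro member_le_sum) auto
    thus ?thesis using one[OF s] nn s t by (auto simp: f_def)
  qed
  have upper: "(\<Sum>i\<in>I. h D i) \<le> 4 * ln (card T)" if D: "D \<subseteq> I" for D
  proof -
    define p where "p t = (\<Sum>z\<in>Pow I. f D t z) / 2 ^ card I" for t
    have "(\<Sum>i\<in>I. h D i) = (\<Sum>t\<in>T. \<Sum>i\<in>I. (sqrt (half_avg I (f D t) i True) - sqrt (half_avg I (f D t) i False))\<^sup>2)"
      unfolding h_def by (rule sum.swap)
    also have "\<dots> \<le> (\<Sum>t\<in>T. 4 * (p t * ln (1 / p t)))"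
      using f01[OF D] by (intro sum_mono sum_sqrt_influences_le[OF finI]) (auto simp: p_def)
    also have "\<dots> = 4 * (\<Sum>t\<in>T. p t * ln (1 / p t))" by (simp add: sum_distrib_left)
    also have "\<dots> \<le> 4 * ln (card T)"
    proof (rule mult_left_mono[OF entropy_le_ln_card[OF finT]])
      show "p t \<ge> 0" if "t \<in> T" for t
        unfolding p_def using f01[OF D that] by (intro divide_nonneg_nonneg sum_nonneg) auto
      have "(\<Sum>t\<in>T. p t) = (\<Sum>z\<in>Pow I. \<Sum>t\<in>T. f D t z) / 2 ^ card I"
        unfolding p_def sum_divide_distrib[symmetric] by (subst sum.swap) simp
      also have "(\<Sum>z\<in>Pow I. \<Sum>t\<in>T. f D t z) = (\<Sum>z\<in>Pow I. 1)"
        unfolding f_def by (intro sum.cong one refl) auto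
      finally show "(\<Sum>t\<in>T. p t) = 1" using finI by (simp add: card_Pow)
    qed simp
    finally show ?thesis .
  qed
  have lower: "1/72 \<le> h D i + h (insert i D) i" if i: "i \<in> I" and D: "D \<subseteq> I - {i}" for D i
  proof -
    define E where "E = I - {i} - D"
    define ins where "ins u X = (if u then insert i X else X)" for u X
    have finDE: "finite D" "finite E" using finI D by (auto simp: E_def intro: finite_subset)
    have DE: "D \<inter> E = {}" "D \<union> E = I - {i}" using D by (auto simp: E_def)
    have cDE: "card D + card E = card I - 1"
      using card_Un_disjoint[OF finDE DE(1)] DE(2) i finI by (simp add: card_Diff_singleton)
    \<comment> \<open>Averaging over the coordinates other than \<open>i\<close> keeps the product
      form, because those in \<open>D\<close> concern only \<open>a\<close> and those in
      \<open>E\<close> only \<open>b\<close>. The free bit \<open>i\<close> belongs to the second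
      player under \<open>D\<close> and to the first under \<open>insert i D\<close>, which yields
      the two terms of \<open>cut_and_paste\<close>.\<close>
    define al where "al u t = (\<Sum>X\<in>Pow D. a t (ins u X)) / 2 ^ card D" for u t
    define be where "be v t = (\<Sum>Y\<in>Pow E. b t (ins v Y)) / 2 ^ card E" for v t
    have sub: "X \<in> Pow D \<Longrightarrow> ins u X \<subseteq> I" "X \<in> Pow E \<Longrightarrow> ins u X \<subseteq> I" for u X
      using D i by (auto simp: ins_def E_def)
    have alb: "(\<Sum>t\<in>B. al u t * be v t) = (\<Sum>X\<in>Pow D. \<Sum>Y\<in>Pow E. (\<Sum>t\<in>B. a t (ins u X) * b t (ins v Y))) / (2 ^ card D * 2 ^ card E)" for u v B
    proof -
      have "(\<Sum>t\<in>B. al u t * be v t) = (\<Sum>t\<in>B. (\<Sum>X\<in>Pow D. \<Sum>Y\<in>Pow E. a t (ins u X) * b t (ins v Y))) / (2 ^ card D * 2 ^ card E)"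
        unfolding al_def be_def by (simp add: sum_product sum_divide_distrib)
      also have "(\<Sum>t\<in>B. (\<Sum>X\<in>Pow D. \<Sum>Y\<in>Pow E. a t (ins u X) * b t (ins v Y))) = (\<Sum>X\<in>Pow D. \<Sum>Y\<in>Pow E. (\<Sum>t\<in>B. a t (ins u X) * b t (ins v Y)))"
        by (subst sum.swap, intro sum.cong refl, rule sum.swap)
      finally show ?thesis .
    qed
    have const: "(\<Sum>X\<in>Pow D. \<Sum>Y\<in>Pow E. c) / (2 ^ card D * 2 ^ card E) = (c::real)" for c
      using finDE by (simp add: card_Pow)
    have half: "half_avg I (f D t) i v = al False t * be v t"
      "half_avg I (f (insert i D) t) i v = al v t * be False t" for t v
    proof -
      have e: "(2::real) ^ (card I - 1) = 2 ^ card D * 2 ^ card E" unfolding cDE[symmetric] by (simp add: power_add)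
      have "(\<Sum>z\<in>Pow (I - {i}). f D t (if v then insert i z else z))
          = (\<Sum>z\<in>Pow (D \<union> E). a t (ins False (z \<inter> D)) * b t (ins v (z \<inter> E)))"
        unfolding DE f_def ins_def
        by (intro sum.cong refl arg_cong2[where f="(*)"] arg_cong2[where f=a] arg_cong2[where f=b])
           (use D i in \<open>auto simp: E_def\<close>)
      also have "\<dots> = (\<Sum>X\<in>Pow D. a t (ins False X)) * (\<Sum>Y\<in>Pow E. b t (ins v Y))"
        by (rule sum_Pow_disjoint_union[OF finDE DE(1)])
      finally show "half_avg I (f D t) i v = al False t * be v t"
        unfolding half_avg_def e al_def be_def by simp
      have "(\<Sum>z\<in>Pow (I - {i}). f (insert i D) t (if v then insert i z else z))
          = (\<Sum>z\<in>Pow (D \<union> E). a t (ins v (z \<inter> D)) * b t (ins False (z \<inter> E)))"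
        unfolding DE f_def ins_def
        by (intro sum.cong refl arg_cong2[where f="(*)"] arg_cong2[where f=a] arg_cong2[where f=b])
           (use D i in \<open>auto simp: E_def\<close>)
      also have "\<dots> = (\<Sum>X\<in>Pow D. a t (ins v X)) * (\<Sum>Y\<in>Pow E. b t (ins False Y))"
        by (rule sum_Pow_disjoint_union[OF finDE DE(1)])
      finally show "half_avg I (f (insert i D) t) i v = al v t * be False t"
        unfolding half_avg_def e al_def be_def by simp
    qed
    have "1 / 72 \<le> (\<Sum>t\<in>T. (sqrt (al False t * be True t) - sqrt (al False t * be False t))\<^sup>2)
     + (\<Sum>t\<in>T. (sqrt (al True t * be False t) - sqrt (al False t * be False t))\<^sup>2)"
    proof (rule cut_and_paste[OF finT A])
      show "al u t \<ge> 0" "be u t \<ge> 0" if "t \<in> T" for u t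
        unfolding al_def be_def by (intro divide_nonneg_nonneg sum_nonneg nn that sub; simp)+
      have "(\<Sum>X\<in>Pow D. \<Sum>Y\<in>Pow E. (\<Sum>t\<in>T. a t (ins u X) * b t (ins v Y))) = (\<Sum>X\<in>Pow D. \<Sum>Y\<in>Pow E. 1)" for u v
        using sub by (intro sum.cong refl one) auto
      thus "(\<Sum>t\<in>T. al u t * be v t) = 1" for u v unfolding alb by (simp only: const)
      have "(\<Sum>X\<in>Pow D. \<Sum>Y\<in>Pow E. (\<Sum>t\<in>A. a t (ins False X) * b t (ins False Y))) \<le> (\<Sum>X\<in>Pow D. \<Sum>Y\<in>Pow E. 1/3)"
      proof (intro sum_mono rej)
        fix X Y assume XY: "X \<in> Pow D" "Y \<in> Pow E"
        show "ins False X \<inter> ins False Y = {}" using XY DE by (auto simp: ins_def)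
      qed (use sub in auto)
      hence "(\<Sum>t\<in>A. al False t * be False t) \<le> (\<Sum>X\<in>Pow D. \<Sum>Y\<in>Pow E. 1/3) / (2 ^ card D * 2 ^ card E)"
        unfolding alb by (rule divide_right_mono) auto
      thus "(\<Sum>t\<in>A. al False t * be False t) \<le> 1/3" unfolding const .
      have "(\<Sum>X\<in>Pow D. \<Sum>Y\<in>Pow E. 2/3) \<le> (\<Sum>X\<in>Pow D. \<Sum>Y\<in>Pow E. (\<Sum>t\<in>A. a t (ins True X) * b t (ins True Y)))"
      proof (intro sum_mono acc)
        fix X Y assume XY: "X \<in> Pow D" "Y \<in> Pow E"
        show "ins True X \<inter> ins True Y = {i}" using XY DE by (auto simp: ins_def)
      qed (use sub in auto)
      hence "(\<Sum>X\<in>Pow D. \<Sum>Y\<in>Pow E. 2/3) / (2 ^ card D * 2 ^ card E) \<le> (\<Sum>t\<in>A. al True t * be True t)"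
        unfolding alb by (rule divide_right_mono) auto
      thus "2/3 \<le> (\<Sum>t\<in>A. al True t * be True t)" unfolding const .
    qed
    thus ?thesis unfolding h_def half .
  qed
  have "2 ^ card I * (card I / 144) \<le> (\<Sum>D\<in>Pow I. \<Sum>i\<in>I. h D i)"
  proof -
    have "(\<Sum>i\<in>I. 2 ^ card I / (144::real)) \<le> (\<Sum>i\<in>I. \<Sum>D\<in>Pow I. h D i)"
    proof (rule sum_mono)
      fix i assume i: "i \<in> I"
      have c: "card I = Suc (card (I - {i}))" by (rule card.remove[OF finI i])
      have "2 ^ card I / (144::real) = (\<Sum>D\<in>Pow (I - {i}). 1/72)"
        using finI by (subst c) (simp add: card_Pow)
      also have "\<dots> \<le> (\<Sum>D\<in>Pow (I - {i}). h D i + h (insert i D) i)"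
        using lower[OF i] by (intro sum_mono) auto
      also have "\<dots> = (\<Sum>D\<in>Pow I. h D i)"
        unfolding sum.distrib by (rule sum_Pow_split[OF finI i, symmetric])
      finally show "2 ^ card I / (144::real) \<le> (\<Sum>D\<in>Pow I. h D i)" .
    qed
    also have "\<dots> = (\<Sum>D\<in>Pow I. \<Sum>i\<in>I. h D i)" by (rule sum.swap)
    finally show ?thesis by (simp add: mult.commute)
  qed
  also have "\<dots> \<le> (\<Sum>D\<in>Pow I. 4 * ln (card T))" using upper by (intro sum_mono) auto
  also have "\<dots> = 2 ^ card I * (4 * ln (card T))" using finI by (simp add: card_Pow)
  finally have "card I / 144 \<le> 4 * ln (card T)" by simp
  thus ?thesis by simp
qed

section \<open>Histories of two-way probabilistic automata\<close>

lemma prob_bind_pmf: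
  "measure_pmf.prob (bind_pmf M K) A = measure_pmf.expectation M (\<lambda>x. measure_pmf.prob (K x) A)"
proof -
  have *: "measure_pmf.prob N A = pmf (map_pmf (\<lambda>x. x \<in> A) N) True" for N :: "'a pmf"
    by (simp add: pmf_map vimage_def)
  show ?thesis unfolding * map_bind_pmf by (simp add: pmf_bind)
qed

lemma run_Suc_left: "run K c (Suc t) = bind_pmf (K c) (\<lambda>c'. run K c' t)"
proof (induction t)
  case 0
  show ?case by (simp add: bind_return_pmf bind_return_pmf')
next
  case (Suc t)
  have "run K c (Suc (Suc t)) = bind_pmf (bind_pmf (K c) (\<lambda>c'. run K c' t)) K"
    by (subst run.simps(2)) (simp only: Suc.IH)
  also have "\<dots> = bind_pmf (K c) (\<lambda>c'. run K c' (Suc t))" by (simp add: bind_assoc_pmf)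
  finally show ?case .
qed

lemma run_fixed: "K c = return_pmf c \<Longrightarrow> run K c t = return_pmf c"
  by (induction t) (simp_all add: bind_return_pmf)

lemma run_halted:
  assumes "\<And>c'. c' \<in> set_pmf (run K c T) \<Longrightarrow> K c' = return_pmf c'"
  shows "run K c (T + j) = run K c T"
proof (induction j)
  case (Suc j)
  have "run K c (T + Suc j) = bind_pmf (run K c T) K" by (simp add: Suc)
  also have "\<dots> = bind_pmf (run K c T) return_pmf" by (rule bind_pmf_cong) (use assms in auto)
  finally show ?case by (simp add: bind_return_pmf')
qed simp

lemma prob_run_mono:
  assumes "\<And>c'. c' \<in> A \<Longrightarrow> K c' = return_pmf c'" "t \<le> u"
  shows "measure_pmf.prob (run K c t) A \<le> measure_pmf.prob (run K c u) A"
  using assms(2)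
proof (induction u rule: dec_induct)
  case (step u)
  have "measure_pmf.prob (run K c u) A = measure_pmf.expectation (run K c u) (indicator A)" by simp
  also have "\<dots> \<le> measure_pmf.expectation (run K c u) (\<lambda>x. measure_pmf.prob (K x) A)"
    by (intro integral_mono measure_pmf.integrable_const_bound[where B=1])
       (auto simp: assms(1) indicator_def)
  also have "\<dots> = measure_pmf.prob (run K c (Suc u)) A" by (simp add: prob_bind_pmf)
  finally show ?case using step.IH by simp
qed simp

text \<open>The probabilities increase up to time \<open>T\<close>, when every branch has halted,
  and stay constant afterwards; so the supremum is attained at \<open>T\<close>.\<close>

lemma accept_prob_eq:
  assumes absorbing: "\<And>c'. fst c' \<in> halting M \<Longrightarrow> K c' = return_pmf c'"
    and halted: "\<And>c'. c' \<in> set_pmf (run K c T) \<Longrightarrow> fst c' \<in> halting M"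
  shows "accept_prob M K c = measure_pmf.prob (run K c T) {c'. fst c' \<in> accepting M}"
proof -
  let ?P = "\<lambda>t. measure_pmf.prob (run K c t) {c'. fst c' \<in> accepting M}"
  have "?P t \<le> ?P T" for t
  proof (cases "t \<le> T")
    case True
    thus ?thesis by (intro prob_run_mono) (auto intro!: absorbing simp: halting_def)
  next
    case False
    then obtain j where "t = T + j" by (metis le_iff_add nat_le_linear)
    thus ?thesis using run_halted[of K c T j] absorbing halted by simp
  qed
  thus ?thesis unfolding accept_prob_def
    by (intro antisym cSUP_least cSUP_upper bdd_aboveI[where M=1]) auto
qed

lemma halted_if_steps_le:
  assumes "steps_before_halting M K c \<le> enat T" "c' \<in> set_pmf (run K c T)"
  shows "fst c' \<in> halting M"
proof (rule ccontr)
  assume "fst c' \<notin> halting M"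
  hence "enat (Suc T) \<le> steps_before_halting M K c"
    unfolding steps_before_halting_def using assms(2) by (intro SUP_upper) auto
  thus False using assms(1) by (auto dest: order.trans)
qed

definition moves :: "move set" where "moves = {MoveL, Stay, MoveR}"

lemma moves [simp]: "d \<in> moves" "finite moves"
  by (cases d) (auto simp: moves_def)

text \<open>The tape is cut into two overlapping zones, both containing the block of \<open>n\<close> separators: a
  player simulates the automaton until the head leaves the zone of that player, and then announces the
  state. Every leg but the first thus takes more than \<open>n\<close> steps.\<close>

definition zone :: "nat \<Rightarrow> bool \<Rightarrow> nat set" where
  "zone n o1 = (if o1 then {..2*n} else {n<..})"

text \<open>The head can leave a zone at one cell only, so an announcement need not contain the
  position.\<close>

definition entry :: "nat \<Rightarrow> bool \<Rightarrow> nat" where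
  "entry n o1 = (if o1 then n else 2*n+1)"

definition exit_dist :: "nat \<Rightarrow> bool \<Rightarrow> nat \<Rightarrow> nat" where
  "exit_dist n o1 i = (if o1 then 2*n+1 - i else i - n)"

lemma zone_exit:
  assumes "i \<in> zone n o1" "shift d i \<notin> zone n o1"
  shows "shift d i = entry n (\<not> o1)" "exit_dist n o1 i = 1"
  using assms by (cases d; auto simp: zone_def entry_def exit_dist_def split: if_splits)+

lemma entry_zone: "entry n o1 \<in> zone n o1" "exit_dist n o1 (entry n o1) = n + 1"
  by (auto simp: zone_def entry_def exit_dist_def)

lemma exit_dist_shift: "i \<in> zone n o1 \<Longrightarrow> exit_dist n o1 i \<le> Suc (exit_dist n o1 (shift d i))"
  by (cases d) (auto simp: zone_def exit_dist_def)

definition succs :: "'a pfa \<Rightarrow> (nat \<times> move) set" where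
  "succs M = states M \<times> moves"

text \<open>A leg ends by halting or by leaving \<open>Z\<close>, and \<open>r\<close> is the state
  at that moment. A step that halts and leaves \<open>Z\<close> at once counts as halting, so it
  causes no change of player.\<close>

primrec leg :: "'a pfa \<Rightarrow> (nat \<Rightarrow> 'a cell) \<Rightarrow> nat set \<Rightarrow> nat \<Rightarrow> nat \<Rightarrow> nat \<Rightarrow> nat \<Rightarrow> real" where
  "leg M c Z 0 s i r = of_bool (s \<in> halting M \<and> s = r)"
| "leg M c Z (Suc t) s i r =
    (if s \<in> halting M then of_bool (s = r)
     else \<Sum>x\<in>succs M. pmf (pfa_trans M s (c i)) x *
       (if fst x \<notin> halting M \<and> shift (snd x) i \<notin> Z then of_bool (fst x = r)
        else leg M c Z t (fst x) (shift (snd x) i) r))"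

text \<open>\<open>hist M n c t o1 s i \<tau>\<close> is the probability that a run of at most \<open>t\<close> steps from state \<open>s\<close> and
  position \<open>i\<close>, with player \<open>o1\<close> in charge, halts and that \<open>\<tau>\<close> lists the states announced at the
  changes of zone, followed by the halting state.\<close>

primrec hist :: "'a pfa \<Rightarrow> nat \<Rightarrow> (nat \<Rightarrow> 'a cell) \<Rightarrow> nat \<Rightarrow> bool \<Rightarrow> nat \<Rightarrow> nat \<Rightarrow> nat list \<Rightarrow> real" where
  "hist M n c 0 o1 s i \<tau> = of_bool (s \<in> halting M \<and> \<tau> = [s])"
| "hist M n c (Suc t) o1 s i \<tau> =
    (if s \<in> halting M then of_bool (\<tau> = [s])
     else \<Sum>x\<in>succs M. pmf (pfa_trans M s (c i)) x *
       (if fst x \<notin> halting M \<and> shift (snd x) i \<notin> zone n o1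
        then (case \<tau> of [] \<Rightarrow> 0 | r # \<tau>' \<Rightarrow> of_bool (fst x = r) * hist M n c t (\<not> o1) (fst x) (shift (snd x) i) \<tau>')
        else hist M n c t o1 (fst x) (shift (snd x) i) \<tau>))"

text \<open>The product of the leg probabilities along a list of announcements. There is no clock
  common to the legs, and only lists that end at their first halting state get a nonzero
  weight.\<close>

fun wgt :: "nat set \<Rightarrow> nat \<Rightarrow> (nat \<Rightarrow> nat \<Rightarrow> nat \<Rightarrow> real) \<Rightarrow> (nat \<Rightarrow> nat \<Rightarrow> nat \<Rightarrow> real) \<Rightarrow>
    bool \<Rightarrow> nat \<Rightarrow> nat \<Rightarrow> nat list \<Rightarrow> real" where
  "wgt H n lA lB o1 s i [] = 0"
| "wgt H n lA lB o1 s i (r # \<tau>) = (if o1 then lA s i r else lB s i r) *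
     (if r \<in> H then of_bool (\<tau> = []) else wgt H n lA lB (\<not> o1) r (entry n (\<not> o1)) \<tau>)"

text \<open>Setting the legs of one player to 1 leaves the factor of the other. The condition on
  halting states goes into both factors, which is harmless since its value is 0 or 1.\<close>

lemma wgt_factor:
  "wgt H n lA lB o1 s i \<tau> = wgt H n lA (\<lambda>_ _ _. 1) o1 s i \<tau> * wgt H n (\<lambda>_ _ _. 1) lB o1 s i \<tau>"
  by (induction \<tau> arbitrary: o1 s i) auto

lemma wgt_nonneg:
  assumes "\<And>s i r. lA s i r \<ge> 0" "\<And>s i r. lB s i r \<ge> 0"
  shows "wgt H n lA lB o1 s i \<tau> \<ge> 0"
  using assms by (induction \<tau> arbitrary: o1 s i) auto

lemma leg_nonneg: "leg M c Z t s i r \<ge> 0"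
  by (induction t arbitrary: s i) (auto intro!: sum_nonneg mult_nonneg_nonneg)

lemma leg_mono: "leg M c Z t s i r \<le> leg M c Z (Suc t) s i r"
proof (induction t arbitrary: s i)
  case 0
  show ?case by (auto intro!: sum_nonneg mult_nonneg_nonneg)
next
  case (Suc t)
  show ?case
    unfolding leg.simps(2)[of M c Z t s] leg.simps(2)[of M c Z "Suc t" s]
    by (auto intro!: sum_mono mult_left_mono Suc.IH simp del: leg.simps)
qed

lemma hist_nonneg: "hist M n c t o1 s i \<tau> \<ge> 0"
  by (induction t arbitrary: o1 s i \<tau>)
     (auto intro!: sum_nonneg mult_nonneg_nonneg split: list.split)

lemma hist_Nil [simp]: "hist M n c t o1 s i [] = 0"
  by (induction t arbitrary: s i) (auto intro!: sum.neutral)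

lemma hist_mono: "hist M n c t o1 s i \<tau> \<le> hist M n c (Suc t) o1 s i \<tau>"
proof (induction t arbitrary: o1 s i \<tau>)
  case 0
  show ?case
    by (auto intro!: sum_nonneg mult_nonneg_nonneg split: list.split)
next
  case (Suc t)
  show ?case
    unfolding hist.simps(2)[of M n c t o1 s] hist.simps(2)[of M n c "Suc t" o1 s]
    by (auto intro!: sum_mono mult_left_mono Suc.IH simp del: hist.simps split: list.split)
qed

lemma leg_cong:
  assumes "\<And>j. j \<in> Z \<Longrightarrow> c j = c' j" "i \<in> Z"
  shows "leg M c Z t s i r = leg M c' Z t s i r"
  using assms(2)
proof (induction t arbitrary: s i)
  case (Suc t)
  \<comment> \<open>Outside \<open>Z\<close> a leg goes on only in a halting state, where the tape
    is not read.\<close>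
  have "leg M c Z t s' i' r = leg M c' Z t s' i' r" if "s' \<in> halting M \<or> i' \<in> Z" for s' i'
    using that Suc.IH[of i' s'] by (cases "i' \<in> Z"; cases t) auto
  thus ?case using assms(1)[OF Suc.prems] by (auto intro!: sum.cong)
qed simp

text \<open>Only an inequality, because on the left the leg and the rest of the history share
  \<open>t\<close> steps, while on the right each of them gets \<open>t\<close> steps. Monotonicity
  in the number of steps makes up for the difference.\<close>

lemma hist_le_leg:
  assumes "i \<in> zone n o1"
  shows "hist M n c t o1 s i (r # \<tau>) \<le> leg M c (zone n o1) t s i r *
     (if r \<in> halting M then of_bool (\<tau> = []) else hist M n c t (\<not> o1) r (entry n (\<not> o1)) \<tau>)"
  using assms
proof (induction t arbitrary: s i)
  case (Suc t)
  define R where "R t = (if r \<in> halting M then of_bool (\<tau> = []) else hist M n c t (\<not> o1) r (entry n (\<not> o1)) \<tau>)" for t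
  have R0: "R t \<ge> 0" for t by (auto simp: R_def hist_nonneg)
  have RS: "R t \<le> R (Suc t)" unfolding R_def by (simp add: hist_mono del: hist.simps)
  show ?case
  proof (cases "s \<in> halting M")
    case True
    thus ?thesis by auto
  next
    case False
    have term_le: "(if fst x \<notin> halting M \<and> shift (snd x) i \<notin> zone n o1
           then of_bool (fst x = r) * hist M n c t (\<not> o1) (fst x) (shift (snd x) i) \<tau>
           else hist M n c t o1 (fst x) (shift (snd x) i) (r # \<tau>))
       \<le> (if fst x \<notin> halting M \<and> shift (snd x) i \<notin> zone n o1 then of_bool (fst x = r)
          else leg M c (zone n o1) t (fst x) (shift (snd x) i) r) * R (Suc t)" (is "?L \<le> ?R") for x
    proof (cases "shift (snd x) i \<in> zone n o1")
      case True
      have "?L \<le> leg M c (zone n o1) t (fst x) (shift (snd x) i) r * R t"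
        using Suc.IH[OF True, of "fst x"] True by (simp add: R_def)
      also have "\<dots> \<le> leg M c (zone n o1) t (fst x) (shift (snd x) i) r * R (Suc t)"
        by (intro mult_left_mono RS leg_nonneg)
      finally show ?thesis using True by simp
    next
      case out: False
      have e: "shift (snd x) i = entry n (\<not> o1)" using zone_exit(1)[OF Suc.prems out] .
      show ?thesis
      proof (cases "fst x \<in> halting M")
        case True
        hence "hist M n c t o1 (fst x) (shift (snd x) i) (r # \<tau>) = of_bool (r = fst x \<and> \<tau> = [])"
          "leg M c (zone n o1) t (fst x) (shift (snd x) i) r = of_bool (fst x = r)"
          by (cases t; auto)+
        thus ?thesis using True by (auto simp: R_def)
      next
        case False
        have "of_bool (fst x = r) * hist M n c t (\<not> o1) (fst x) (entry n (\<not> o1)) \<tau> \<le> of_bool (fst x = r) * R t"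
          using False by (auto simp: R_def)
        also have "\<dots> \<le> of_bool (fst x = r) * R (Suc t)" by (intro mult_left_mono RS) auto
        finally show ?thesis using False out e by simp
      qed
    qed
    have "hist M n c (Suc t) o1 s i (r # \<tau>) = (\<Sum>x\<in>succs M. pmf (pfa_trans M s (c i)) x *
       (if fst x \<notin> halting M \<and> shift (snd x) i \<notin> zone n o1
           then of_bool (fst x = r) * hist M n c t (\<not> o1) (fst x) (shift (snd x) i) \<tau>
           else hist M n c t o1 (fst x) (shift (snd x) i) (r # \<tau>)))"
      using False by (simp cong: if_cong)
    also have "\<dots> \<le> (\<Sum>x\<in>succs M. pmf (pfa_trans M s (c i)) x *
       ((if fst x \<notin> halting M \<and> shift (snd x) i \<notin> zone n o1 then of_bool (fst x = r)
          else leg M c (zone n o1) t (fst x) (shift (snd x) i) r) * R (Suc t)))"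
      by (intro sum_mono mult_left_mono term_le) simp
    also have "\<dots> = leg M c (zone n o1) (Suc t) s i r * R (Suc t)"
      using False by (simp add: sum_distrib_right mult.assoc)
    finally show ?thesis unfolding R_def .
  qed
qed auto

lemma hist_le_wgt:
  assumes "i \<in> zone n o1" "t \<le> T"
  shows "hist M n c t o1 s i \<tau> \<le>
    wgt (halting M) n (leg M c (zone n True) T) (leg M c (zone n False) T) o1 s i \<tau>"
  using assms
proof (induction \<tau> arbitrary: o1 s i)
  case (Cons r \<tau>)
  have legT: "leg M c Z t s i r \<le> leg M c Z T s i r" for Z
    using assms(2) by (rule lift_Suc_mono_le[of "\<lambda>t. leg M c Z t s i r", rotated]) (rule leg_mono)
  have "hist M n c t o1 s i (r # \<tau>) \<le> leg M c (zone n o1) t s i r *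
     (if r \<in> halting M then of_bool (\<tau> = []) else hist M n c t (\<not> o1) r (entry n (\<not> o1)) \<tau>)"
    by (rule hist_le_leg[OF Cons.prems(1)])
  also have "\<dots> \<le> leg M c (zone n o1) T s i r *
     (if r \<in> halting M then of_bool (\<tau> = []) else
       wgt (halting M) n (leg M c (zone n True) T) (leg M c (zone n False) T) (\<not> o1) r (entry n (\<not> o1)) \<tau>)"
    using Cons.IH[OF entry_zone(1) assms(2)] by (intro mult_mono legT) (auto simp: leg_nonneg hist_nonneg)
  finally show ?case by (cases o1) auto
qed simp

definition words :: "nat set \<Rightarrow> nat \<Rightarrow> nat list set" where
  "words S m = {\<tau>. set \<tau> \<subseteq> S \<and> length \<tau> \<le> m}"

lemma finite_words: "finite S \<Longrightarrow> finite (words S m)"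
  unfolding words_def by (rule finite_lists_length_le)

lemma sum_words_Suc:
  assumes "finite S"
  shows "(\<Sum>\<tau>\<in>words S (Suc m). f \<tau>) = f [] + (\<Sum>r\<in>S. \<Sum>\<tau>\<in>words S m. f (r # \<tau>) :: real)"
proof -
  have e: "words S (Suc m) = insert [] ((\<lambda>(r, \<tau>). r # \<tau>) ` (S \<times> words S m))"
  proof (rule Set.set_eqI)
    fix \<tau> show "\<tau> \<in> words S (Suc m) \<longleftrightarrow> \<tau> \<in> insert [] ((\<lambda>(r, \<tau>). r # \<tau>) ` (S \<times> words S m))"
      by (cases \<tau>) (auto simp: words_def)
  qed
  have "(\<Sum>\<tau>\<in>words S (Suc m). f \<tau>) = f [] + (\<Sum>\<tau>\<in>(\<lambda>(r, \<tau>). r # \<tau>) ` (S \<times> words S m). f \<tau>)"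
    unfolding e by (rule sum.insert) (use assms finite_words in auto)
  also have "(\<Sum>\<tau>\<in>(\<lambda>(r, \<tau>). r # \<tau>) ` (S \<times> words S m). f \<tau>) = (\<Sum>(r, \<tau>)\<in>S \<times> words S m. f (r # \<tau>))"
    by (subst sum.reindex) (auto simp: inj_on_def case_prod_beta)
  also have "\<dots> = (\<Sum>r\<in>S. \<Sum>\<tau>\<in>words S m. f (r # \<tau>))" by (simp add: sum.cartesian_product)
  finally show ?thesis .
qed

lemma sum_pmf_le_1: "finite A \<Longrightarrow> (\<Sum>x\<in>A. pmf p x) \<le> 1"
  by (metis measure_measure_pmf_finite measure_pmf.prob_le_1)

lemma sum_leg_le_1:
  assumes "finite (states M)"
  shows "(\<Sum>r\<in>states M. leg M c Z t s i r) \<le> 1"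
proof -
  have delta: "(\<Sum>r\<in>states M. of_bool (s = r)) \<le> (1::real)" for s
    using assms by (simp add: of_bool_def)
  show ?thesis
  proof (induction t arbitrary: s i)
    case 0
    show ?case using delta by (cases "s \<in> halting M") auto
  next
    case (Suc t)
    show ?case
    proof (cases "s \<in> halting M")
      case False
      have "(\<Sum>r\<in>states M. leg M c Z (Suc t) s i r) = (\<Sum>x\<in>succs M. pmf (pfa_trans M s (c i)) x *
          (\<Sum>r\<in>states M. if fst x \<notin> halting M \<and> shift (snd x) i \<notin> Z then of_bool (fst x = r)
             else leg M c Z t (fst x) (shift (snd x) i) r))"
        using False by (simp add: sum_distrib_left) (rule sum.swap)
      also have "\<dots> \<le> (\<Sum>x\<in>succs M. pmf (pfa_trans M s (c i)) x * 1)"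
      proof (intro sum_mono mult_left_mono)
        fix x
        show "(\<Sum>r\<in>states M. if fst x \<notin> halting M \<and> shift (snd x) i \<notin> Z then of_bool (fst x = r)
             else leg M c Z t (fst x) (shift (snd x) i) r) \<le> 1"
          using Suc.IH delta by (cases "fst x \<notin> halting M \<and> shift (snd x) i \<notin> Z") (simp_all only: if_True if_False simp_thms)
      qed auto
      also have "\<dots> \<le> 1" using sum_pmf_le_1[of "succs M"] assms by (simp add: succs_def)
      finally show ?thesis .
    qed (use delta in auto)
  qed
qed

text \<open>Each leg is a subprobability on the announced state, whatever its time budget, so the
  tree of announcements has total weight at most 1.\<close>

lemma sum_wgt_le_1:
  assumes fin: "finite S"
    and nn: "\<And>s i r. lA s i r \<ge> 0" "\<And>s i r. lB s i r \<ge> 0"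
    and le: "\<And>s i. (\<Sum>r\<in>S. lA s i r) \<le> 1" "\<And>s i. (\<Sum>r\<in>S. lB s i r) \<le> 1"
  shows "(\<Sum>\<tau>\<in>words S m. wgt H n lA lB o1 s i \<tau>) \<le> 1"
proof (induction m arbitrary: o1 s i)
  case 0
  have "words S 0 = {[]}" by (auto simp: words_def)
  thus ?case by simp
next
  case (Suc m)
  define l where "l r = (if o1 then lA s i r else lB s i r)" for r
  have "(\<Sum>\<tau>\<in>words S (Suc m). wgt H n lA lB o1 s i \<tau>) = (\<Sum>r\<in>S. l r *
      (\<Sum>\<tau>\<in>words S m. if r \<in> H then of_bool (\<tau> = []) else wgt H n lA lB (\<not> o1) r (entry n (\<not> o1)) \<tau>))"
    by (simp add: sum_words_Suc[OF fin] sum_distrib_left l_def)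
  also have "\<dots> \<le> (\<Sum>r\<in>S. l r * 1)"
  proof (intro sum_mono mult_left_mono)
    fix r
    have "(\<Sum>\<tau>\<in>words S m. of_bool (\<tau> = [])) \<le> (1::real)"
      using finite_words[OF fin] by (simp add: of_bool_def)
    thus "(\<Sum>\<tau>\<in>words S m. if r \<in> H then of_bool (\<tau> = []) else wgt H n lA lB (\<not> o1) r (entry n (\<not> o1)) \<tau>) \<le> 1"
      using Suc.IH by (cases "r \<in> H") auto
    show "0 \<le> l r" using nn by (simp add: l_def)
  qed
  also have "\<dots> \<le> 1" using le by (cases o1) (simp_all add: l_def)
  finally show ?case .
qed

lemma pfa_run_Suc:
  assumes wf: "wf_pfa M" and s: "s \<in> states M" "s \<notin> halting M"
  shows "measure_pmf.prob (run (pfa_step M w) (s, i) (Suc t)) A =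
    (\<Sum>x\<in>succs M. pmf (pfa_trans M s (tape w i)) x *
      measure_pmf.prob (run (pfa_step M w) (fst x, shift (snd x) i) t) A)"
proof -
  have fin: "finite (succs M)" using wf by (simp add: wf_pfa_def wf_control_def succs_def)
  have sub: "set_pmf (pfa_trans M s (tape w i)) \<subseteq> succs M"
    using wf s by (fastforce simp: wf_pfa_def succs_def)
  have "measure_pmf.prob (run (pfa_step M w) (s, i) (Suc t)) A =
    measure_pmf.expectation (pfa_trans M s (tape w i))
      (\<lambda>x. measure_pmf.prob (run (pfa_step M w) (fst x, shift (snd x) i) t) A)"
    unfolding run_Suc_left using s(2)
    by (simp add: pfa_step_def bind_map_pmf prob_bind_pmf case_prod_beta)
  also have "\<dots> = (\<Sum>x\<in>succs M. pmf (pfa_trans M s (tape w i)) x *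
      measure_pmf.prob (run (pfa_step M w) (fst x, shift (snd x) i) t) A)"
    by (subst integral_measure_pmf_real[OF fin]) (use sub in \<open>auto simp: mult.commute\<close>)
  finally show ?thesis .
qed

text \<open>The bound on \<open>t\<close> guarantees that lists of length \<open>Suc m\<close>
  suffice: the first change of zone takes at least \<open>exit_dist n o1 i\<close> steps and each
  further one \<open>n + 1\<close>, so at most \<open>m\<close> changes occur.\<close>

lemma sum_hist_eq_prob:
  assumes wf: "wf_pfa M" and B: "B \<subseteq> halting M"
    and s: "s \<in> states M" and i: "i \<in> zone n o1" and t: "t < exit_dist n o1 i + m * (n + 1)"
  shows "(\<Sum>\<tau>\<in>words (states M) (Suc m). hist M n (tape w) t o1 s i \<tau> * of_bool (last \<tau> \<in> B))
     = measure_pmf.prob (run (pfa_step M w) (s, i) t) {c. fst c \<in> B}"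
  using s i t
proof (induction t arbitrary: o1 s i m)
  case 0
  have fin: "finite (words (states M) (Suc m))"
    using wf by (auto simp: wf_pfa_def wf_control_def intro: finite_words)
  have sin: "[s] \<in> words (states M) (Suc m)" using 0 by (simp add: words_def)
  have "(\<Sum>\<tau>\<in>words (states M) (Suc m). hist M n (tape w) 0 o1 s i \<tau> * of_bool (last \<tau> \<in> B))
     = (\<Sum>\<tau>\<in>words (states M) (Suc m). if \<tau> = [s] then of_bool (s \<in> B) else 0)"
    using B by (intro sum.cong) auto
  thus ?case using fin sin by (simp add: indicator_def)
next
  case (Suc t)
  have finS: "finite (states M)" using wf by (auto simp: wf_pfa_def wf_control_def)
  have fin: "finite (words (states M) (Suc m))" by (rule finite_words[OF finS])
  show ?case
  proof (cases "s \<in> halting M")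
    case True
    have sin: "[s] \<in> words (states M) (Suc m)" using Suc.prems by (simp add: words_def)
    have "(\<Sum>\<tau>\<in>words (states M) (Suc m). hist M n (tape w) (Suc t) o1 s i \<tau> * of_bool (last \<tau> \<in> B))
       = (\<Sum>\<tau>\<in>words (states M) (Suc m). if \<tau> = [s] then of_bool (s \<in> B) else 0)"
      using True by (intro sum.cong) auto
    moreover have "run (pfa_step M w) (s, i) (Suc t) = return_pmf (s, i)"
      using True by (intro run_fixed) (simp add: pfa_step_def)
    ultimately show ?thesis using fin sin by (simp add: indicator_def)
  next
    case False
    have inner: "(\<Sum>\<tau>\<in>words (states M) (Suc m).
       (if fst x \<notin> halting M \<and> shift (snd x) i \<notin> zone n o1
        then (case \<tau> of [] \<Rightarrow> 0 | r # \<tau>' \<Rightarrow> of_bool (fst x = r) * hist M n (tape w) t (\<not> o1) (fst x) (shift (snd x) i) \<tau>')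
        else hist M n (tape w) t o1 (fst x) (shift (snd x) i) \<tau>) * of_bool (last \<tau> \<in> B))
       = measure_pmf.prob (run (pfa_step M w) (fst x, shift (snd x) i) t) {c. fst c \<in> B}"
      if x: "x \<in> succs M" for x
    proof (cases "shift (snd x) i \<in> zone n o1")
      case True
      have "t < exit_dist n o1 (shift (snd x) i) + m * (n + 1)"
        using Suc.prems(3) exit_dist_shift[OF Suc.prems(2), of "snd x"] by linarith
      thus ?thesis using True Suc.IH[of "fst x" "shift (snd x) i" o1 m] x by (auto simp: succs_def)
    next
      case out: False
      show ?thesis
      proof (cases "fst x \<in> halting M")
        case True
        have sin: "[fst x] \<in> words (states M) (Suc m)" using x by (auto simp: words_def succs_def)
        have "hist M n (tape w) t o1 (fst x) (shift (snd x) i) \<tau> = of_bool (\<tau> = [fst x])" for \<tau>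
          using True by (cases t) auto
        moreover have "run (pfa_step M w) (fst x, shift (snd x) i) t = return_pmf (fst x, shift (snd x) i)"
          using True by (intro run_fixed) (simp add: pfa_step_def)
        moreover have "(\<Sum>\<tau>\<in>words (states M) (Suc m). of_bool (\<tau> = [fst x]) * of_bool (last \<tau> \<in> B))
          = (\<Sum>\<tau>\<in>words (states M) (Suc m). if \<tau> = [fst x] then of_bool (fst x \<in> B) else (0::real))"
          by (intro sum.cong) auto
        ultimately show ?thesis using True fin sin by (simp add: indicator_def)
      next
        case False
        note e = zone_exit[OF Suc.prems(2) out]
        obtain m' where m: "m = Suc m'" using Suc.prems(3) e(2) by (cases m) auto
        have t: "t < exit_dist n (\<not> o1) (shift (snd x) i) + m' * (n + 1)"
          using Suc.prems(3) e entry_zone(2)[of n "\<not> o1"] m by auto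
        have fx: "fst x \<in> states M" using x by (auto simp: succs_def)
        have "(\<Sum>\<tau>\<in>words (states M) (Suc m). (case \<tau> of [] \<Rightarrow> 0 | r # \<tau>' \<Rightarrow> of_bool (fst x = r) * hist M n (tape w) t (\<not> o1) (fst x) (shift (snd x) i) \<tau>') * of_bool (last \<tau> \<in> B))
          = (\<Sum>r\<in>states M. if fst x = r then (\<Sum>\<tau>\<in>words (states M) m. hist M n (tape w) t (\<not> o1) (fst x) (shift (snd x) i) \<tau> * of_bool (last \<tau> \<in> B)) else 0)"
        proof -
          have "hist M n (tape w) t (\<not> o1) (fst x) (shift (snd x) i) \<tau> * of_bool (last (r # \<tau>) \<in> B)
             = hist M n (tape w) t (\<not> o1) (fst x) (shift (snd x) i) \<tau> * of_bool (last \<tau> \<in> B)" for r \<tau>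
            by (cases "\<tau> = []") auto
          thus ?thesis unfolding sum_words_Suc[OF finS] by (auto intro!: sum.cong)
        qed
        also have "\<dots> = (\<Sum>\<tau>\<in>words (states M) (Suc m'). hist M n (tape w) t (\<not> o1) (fst x) (shift (snd x) i) \<tau> * of_bool (last \<tau> \<in> B))"
          using fx finS m by simp
        also have "\<dots> = measure_pmf.prob (run (pfa_step M w) (fst x, shift (snd x) i) t) {c. fst c \<in> B}"
          using Suc.IH[OF fx _ t] e(1) entry_zone(1)[of n "\<not> o1"] by simp
        finally show ?thesis using False out by simp
      qed
    qed
    have "(\<Sum>\<tau>\<in>words (states M) (Suc m). hist M n (tape w) (Suc t) o1 s i \<tau> * of_bool (last \<tau> \<in> B))
      = (\<Sum>x\<in>succs M. pmf (pfa_trans M s (tape w i)) x * (\<Sum>\<tau>\<in>words (states M) (Suc m).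
       (if fst x \<notin> halting M \<and> shift (snd x) i \<notin> zone n o1
        then (case \<tau> of [] \<Rightarrow> 0 | r # \<tau>' \<Rightarrow> of_bool (fst x = r) * hist M n (tape w) t (\<not> o1) (fst x) (shift (snd x) i) \<tau>')
        else hist M n (tape w) t o1 (fst x) (shift (snd x) i) \<tau>) * of_bool (last \<tau> \<in> B)))"
      using False by (simp add: sum_distrib_right sum_distrib_left mult.assoc) (rule sum.swap)
    also have "\<dots> = measure_pmf.prob (run (pfa_step M w) (s, i) (Suc t)) {c. fst c \<in> B}"
      unfolding pfa_run_Suc[OF wf Suc.prems(1) False] by (intro sum.cong refl arg_cong2[where f="(*)"] inner)
    finally show ?thesis .
  qed
qed

section \<open>The lower bounds\<close>

definition bits :: "nat \<Rightarrow> nat set \<Rightarrow> bool list" where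
  "bits n X = map (\<lambda>i. i \<in> X) [0..<n]"

lemma length_bits [simp]: "length (bits n X) = n"
  by (simp add: bits_def)

lemma nth_bits [simp]: "i < n \<Longrightarrow> bits n X ! i \<longleftrightarrow> i \<in> X"
  by (simp add: bits_def)

lemma length_padded [simp]: "length (padded x n y) = length x + n + length y"
  by (simp add: padded_def)

lemma nth_padded:
  assumes "length x = n" "length y = n" "j < 3 * n"
  shows "padded x n y ! j = (if j < n then Bit (x ! j) else if j < 2*n then Hash else Bit (y ! (j - 2*n)))"
  using assms by (auto simp: padded_def nth_append mult_2)

lemma tape_padded:
  assumes "length x = n" "length y = n"
  shows "tape (padded x n y) j = (if j = 0 then LeftEnd else if j \<le> n then Letter (Bit (x ! (j - 1)))
     else if j \<le> 2*n then Letter Hash else if j \<le> 3*n then Letter (Bit (y ! (j - 1 - 2*n))) else RightEnd)"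
  using assms by (cases j) (auto simp: tape_def nth_padded)

text \<open>One state means space 0, and then the product of time and space is 0 even for infinite
  time, so this case must be excluded separately. The automaton accepts every input with probability
  1 or every input with probability 0.\<close>

lemma one_state_pfa:
  assumes wf: "wf_pfa M" and c: "card (states M) < 2"
  shows "pfa_accept_prob M w = pfa_accept_prob M w'"
proof -
  have fin: "finite (states M)" and st: "start M \<in> states M" using wf by (auto simp: wf_pfa_def wf_control_def)
  have "card (states M) = 1" using c fin st by (cases "card (states M)") auto
  hence S: "states M = {start M}" using st by (auto simp: card_1_singleton_iff)
  have acc: "accepting M \<subseteq> {start M}" using wf S by (auto simp: wf_pfa_def wf_control_def)
  have "set_pmf (run (pfa_step M w) (start M, 0) t) \<subseteq> {start M} \<times> UNIV" for w t
  proof (induction t)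
    case (Suc t)
    have "set_pmf (pfa_step M w c) \<subseteq> {start M} \<times> UNIV" if "c \<in> {start M} \<times> UNIV" for c
    proof (cases "start M \<in> halting M")
      case False
      have "fst x = start M" if "x \<in> set_pmf (pfa_trans M (start M) \<sigma>)" for x \<sigma>
        using wf False S st that unfolding wf_pfa_def by fastforce
      thus ?thesis using that False by (auto simp: pfa_step_def)
    qed (use that in \<open>auto simp: pfa_step_def\<close>)
    thus ?case using Suc.IH by (fastforce simp: set_bind_pmf)
  qed auto
  hence "measure_pmf.prob (run (pfa_step M w) (start M, 0) t) {c'. fst c' \<in> accepting M} = of_bool (start M \<in> accepting M)" for w t
  proof (cases "start M \<in> accepting M")
    case True
    have "measure_pmf.prob (run (pfa_step M w) (start M, 0) t) {c'. fst c' \<in> accepting M} = 1"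
      using \<open>\<And>w t. set_pmf (run (pfa_step M w) (start M, 0) t) \<subseteq> {start M} \<times> UNIV\<close>[of w t] True
      by (intro measure_pmf.prob_eq_1[THEN iffD2]) (auto simp: AE_measure_pmf_iff)
    thus ?thesis using True by simp
  next
    case False
    hence "accepting M = {}" using acc by auto
    thus ?thesis using False by simp
  qed
  thus ?thesis by (simp add: pfa_accept_prob_def accept_prob_def)
qed

lemma card_words_le:
  assumes "finite S" "2 \<le> card S"
  shows "card (words S m) \<le> card S ^ Suc m"
proof -
  have "sum ((^) (card S)) {..m} \<le> card S ^ Suc m - 1" for m
  proof (induction m)
    case (Suc m)
    have "sum ((^) (card S)) {..Suc m} \<le> card S ^ Suc m - 1 + card S ^ Suc m" using Suc by simp
    also have "\<dots> \<le> 2 * card S ^ Suc m - 1" by simp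
    also have "\<dots> \<le> card S ^ Suc (Suc m) - 1"
      using assms(2) by (intro diff_le_mono) (auto intro: mult_right_mono)
    finally show ?case .
  qed (use assms in auto)
  from this[of m] show ?thesis unfolding words_def card_lists_length_le[OF assms(1)] by linarith
qed

text \<open>Only disjoint and uniquely intersecting pairs matter. With
  \<open>m = T div (n + 1)\<close> there are at most \<open>s ^ (m + 2)\<close> lists, whence
  \<open>n / 576 \<le> (m + 2) * ln s\<close>; since \<open>m \<ge> 1\<close>, the factor
  \<open>m + 2\<close> is at most \<open>3 * m\<close>, and 1728 is 3 * 576.\<close>

theorem pfa_TS_lower_bound:
  assumes wf: "wf_pfa M" and n: "1 \<le> n"
    and rec: "recognizes_with_error (pfa_accept_prob M) L (1/3)"
    and out: "\<And>X Y. X \<inter> Y = {} \<Longrightarrow> padded (bits n X) n (bits n Y) \<notin> L"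
    and into: "\<And>X Y i. i < n \<Longrightarrow> X \<inter> Y = {i} \<Longrightarrow> padded (bits n X) n (bits n Y) \<in> L"
  shows "ennreal (real n ^ 2 / 1728) \<le> pfa_TS M"
proof -
  have finS: "finite (states M)" and st: "start M \<in> states M" and acc: "accepting M \<subseteq> halting M"
    using wf by (auto simp: wf_pfa_def wf_control_def halting_def)
  define pd where "pd X Y = padded (bits n X) n (bits n Y)" for X Y
  have p0: "pfa_accept_prob M (pd X Y) \<le> 1/3" if "X \<inter> Y = {}" for X Y
    using rec out[OF that] by (auto simp: recognizes_with_error_def pd_def)
  have p1: "pfa_accept_prob M (pd X Y) \<ge> 2/3" if "i < n" "X \<inter> Y = {i}" for X Y i
    using rec into[OF that] by (auto simp: recognizes_with_error_def pd_def)
  define s where "s = card (states M)"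
  have s2: "2 \<le> s"
  proof (rule ccontr)
    assume "\<not> 2 \<le> s"
    hence "pfa_accept_prob M (pd {0} {0}) = pfa_accept_prob M (pd {} {})"
      unfolding s_def by (intro one_state_pfa[OF wf]) auto
    thus False using p0[of "{}" "{}"] p1[of 0 "{0}" "{0}"] n by auto
  qed
  have ln_s: "ln s \<le> log 2 s" "0 < ln s"
  proof -
    have "ln 2 \<le> (1::real)" using ln_le_minus_one[of 2] by simp
    thus "ln s \<le> log 2 s" using s2 by (simp add: log_def field_simps mult_left_le)
    show "0 < ln s" using s2 by simp
  qed
  show ?thesis
  proof (cases "pfa_time M")
    case infinity
    have "ennreal (pfa_space M) > 0" using ln_s by (simp add: pfa_space_def s_def)
    hence "pfa_TS M = \<infinity>" by (simp add: pfa_TS_def infinity ennreal_top_mult)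
    thus ?thesis by simp
  next
    case (enat T)
    have halted: "fst c \<in> halting M" if "c \<in> set_pmf (run (pfa_step M w) (start M, 0) T)" for c w
    proof (rule halted_if_steps_le[OF _ that])
      show "steps_before_halting M (pfa_step M w) (start M, 0) \<le> enat T"
        unfolding enat[symmetric] pfa_time_def by (rule SUP_upper) simp
    qed
    define m where "m = T div (n + 1)"
    define W where "W = words (states M) (Suc m)"
    have finW: "finite W" unfolding W_def by (rule finite_words[OF finS])
    \<comment> \<open>The zone of the first player contains no letter of \<open>y\<close> and that
      of the second no letter of \<open>x\<close>, so the other input may be replaced by the empty
      set.\<close>
    define lA where "lA X = leg M (tape (pd X {})) (zone n True) T" for X
    define lB where "lB Y = leg M (tape (pd {} Y)) (zone n False) T" for Y
    define a where "a \<tau> X = wgt (halting M) n (lA X) (\<lambda>_ _ _. 1) True (start M) 0 \<tau>" for \<tau> X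
    define b where "b \<tau> Y = wgt (halting M) n (\<lambda>_ _ _. 1) (lB Y) True (start M) 0 \<tau>" for \<tau> Y
    define h where "h X Y \<tau> = hist M n (tape (pd X Y)) T True (start M) 0 \<tau>" for X Y \<tau>
    have nn: "a \<tau> X \<ge> 0" "b \<tau> X \<ge> 0" for \<tau> X
      by (auto simp: a_def b_def lA_def lB_def leg_nonneg intro!: wgt_nonneg)
    have tape: "tape (pd X Y) j = tape (pd X {}) j" if "j \<in> zone n True" for j X Y
      using that by (auto simp: pd_def tape_padded zone_def)
    have tape': "tape (pd X Y) j = tape (pd {} Y) j" if "j \<in> zone n False" for j X Y
      using that by (auto simp: pd_def tape_padded zone_def)
    have hist_le: "h X Y \<tau> \<le> a \<tau> X * b \<tau> Y" for X Y \<tau>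
    proof -
      have "h X Y \<tau> \<le> wgt (halting M) n (leg M (tape (pd X Y)) (zone n True) T)
        (leg M (tape (pd X Y)) (zone n False) T) True (start M) 0 \<tau>"
        unfolding h_def by (rule hist_le_wgt) (auto simp: zone_def)
      also have "\<dots> = wgt (halting M) n (lA X) (lB Y) True (start M) 0 \<tau>"
      proof -
        have "wgt H n l l' o1 s i \<tau> = wgt H n k k' o1 s i \<tau>"
          if "i \<in> zone n o1" "\<And>s i r. i \<in> zone n True \<Longrightarrow> l s i r = k s i r" "\<And>s i r. i \<in> zone n False \<Longrightarrow> l' s i r = k' s i r"
          for H l l' k k' o1 s i
          using that(1)
        proof (induction \<tau> arbitrary: o1 s i)
          case (Cons r \<tau>)
          show ?case using that(2,3) Cons.prems Cons.IH[OF entry_zone(1)] by (cases o1) auto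
        qed simp
        thus ?thesis unfolding lA_def lB_def
          by this (auto intro!: leg_cong tape tape' simp: zone_def)
      qed
      also have "\<dots> = a \<tau> X * b \<tau> Y" unfolding a_def b_def by (rule wgt_factor)
      finally show ?thesis .
    qed
    have ab_le: "(\<Sum>\<tau>\<in>W. a \<tau> X * b \<tau> Y) \<le> 1" for X Y
      unfolding a_def b_def W_def wgt_factor[symmetric]
      by (rule sum_wgt_le_1[OF finS]) (auto simp: lA_def lB_def leg_nonneg intro: sum_leg_le_1[OF finS])
    have sum_h: "(\<Sum>\<tau>\<in>W. h X Y \<tau> * of_bool (last \<tau> \<in> B))
       = measure_pmf.prob (run (pfa_step M (pd X Y)) (start M, 0) T) {c. fst c \<in> B}"
      if "B \<subseteq> halting M" for X Y B
      unfolding W_def h_def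
    proof (rule sum_hist_eq_prob[OF wf that st])
      have "T < (n + 1) + m * (n + 1)"
        using dividend_less_div_times[of "n + 1" T] by (simp add: m_def)
      thus "T < exit_dist n True 0 + m * (n + 1)" by (simp add: exit_dist_def)
    qed (auto simp: zone_def)
    have h_one: "(\<Sum>\<tau>\<in>W. h X Y \<tau>) = 1" for X Y
    proof -
      have "1 = measure_pmf.prob (run (pfa_step M (pd X Y)) (start M, 0) T) {c. fst c \<in> halting M}"
        by (intro measure_pmf.prob_eq_1[THEN iffD2, symmetric]) (auto simp: AE_measure_pmf_iff halted)
      also have "\<dots> = (\<Sum>\<tau>\<in>W. h X Y \<tau> * of_bool (last \<tau> \<in> halting M))" by (rule sum_h[symmetric]) simp
      also have "\<dots> \<le> (\<Sum>\<tau>\<in>W. h X Y \<tau>)"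
        by (intro sum_mono) (auto simp: h_def hist_nonneg)
      finally have "1 \<le> (\<Sum>\<tau>\<in>W. h X Y \<tau>)" .
      moreover have "(\<Sum>\<tau>\<in>W. h X Y \<tau>) \<le> (\<Sum>\<tau>\<in>W. a \<tau> X * b \<tau> Y)" by (intro sum_mono hist_le)
      ultimately show ?thesis using ab_le[of X Y] by linarith
    qed
    \<comment> \<open>A termwise inequality between a sum equal to 1 and a sum at most 1 is an
      equality in every term; forgetting the clock has changed nothing.\<close>
    have h_eq: "h X Y \<tau> = a \<tau> X * b \<tau> Y" if "\<tau> \<in> W" for X Y \<tau>
    proof (rule ccontr)
      assume "h X Y \<tau> \<noteq> a \<tau> X * b \<tau> Y"
      hence "h X Y \<tau> < a \<tau> X * b \<tau> Y" using hist_le[of X Y \<tau>] by simp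
      hence "(\<Sum>\<tau>\<in>W. h X Y \<tau>) < (\<Sum>\<tau>\<in>W. a \<tau> X * b \<tau> Y)"
        using that finW hist_le by (intro sum_strict_mono_ex1) auto
      thus False using ab_le[of X Y] h_one[of X Y] by linarith
    qed
    define A where "A = {\<tau> \<in> W. last \<tau> \<in> accepting M}"
    have sum_A: "(\<Sum>\<tau>\<in>A. a \<tau> X * b \<tau> Y) = pfa_accept_prob M (pd X Y)" for X Y
    proof -
      have "(\<Sum>\<tau>\<in>A. a \<tau> X * b \<tau> Y) = (\<Sum>\<tau>\<in>W. if last \<tau> \<in> accepting M then h X Y \<tau> else 0)"
        unfolding A_def by (subst sum.inter_filter[OF finW]) (auto intro!: sum.cong simp: h_eq)
      also have "\<dots> = (\<Sum>\<tau>\<in>W. h X Y \<tau> * of_bool (last \<tau> \<in> accepting M))"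
        by (intro sum.cong) auto
      also have "\<dots> = measure_pmf.prob (run (pfa_step M (pd X Y)) (start M, 0) T) {c. fst c \<in> accepting M}"
        by (rule sum_h[OF acc])
      also have "\<dots> = pfa_accept_prob M (pd X Y)"
        unfolding pfa_accept_prob_def
        by (rule accept_prob_eq[symmetric]) (auto simp: pfa_step_def halted)
      finally show ?thesis .
    qed
    have "card {..<n} / 576 \<le> ln (card W)"
    proof (rule unique_disjointness_bound[of "{..<n}" W A a b])
      show "(\<Sum>\<tau>\<in>W. a \<tau> X * b \<tau> Y) = 1" for X Y using h_one[of X Y] h_eq by simp
      show "(\<Sum>\<tau>\<in>A. a \<tau> X * b \<tau> Y) \<le> 1/3" if "X \<inter> Y = {}" for X Y unfolding sum_A by (rule p0[OF that])
      show "2/3 \<le> (\<Sum>\<tau>\<in>A. a \<tau> X * b \<tau> Y)" if "X \<subseteq> {..<n}" "X \<inter> Y = {i}" for X Y i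
        unfolding sum_A by (rule p1) (use that in auto)
    qed (auto simp: nn finW A_def)
    also have "\<dots> \<le> ln (real (s ^ Suc (Suc m)))"
    proof -
      have "card W > 0" using finW h_one[of "{}" "{}"] by (auto simp: card_gt_0_iff)
      moreover have "card W \<le> s ^ Suc (Suc m)"
        unfolding W_def s_def by (rule card_words_le[OF finS]) (use s2 s_def in auto)
      ultimately have "0 < real (card W)" "real (card W) \<le> real (s ^ Suc (Suc m))"
        by (simp_all only: of_nat_le_iff of_nat_0_less_iff)
      thus ?thesis by (metis ln_le_cancel_iff order.strict_trans2)
    qed
    also have "\<dots> = (real m + 2) * ln s" using s2 by (simp add: ln_realpow algebra_simps ln_mult)
    finally have comm: "n / 576 \<le> (real m + 2) * ln s" by simp
    \<comment> \<open>A run that never leaves the first zone does not see \<open>y\<close>, so it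
      cannot tell \<open>{0}\<close> from the empty set there.\<close>
    have m1: "1 \<le> m"
    proof (rule ccontr)
      assume "\<not> 1 \<le> m"
      hence m0: "m = 0" by simp
      have b_empty: "b \<tau> Y = b \<tau> {}" if "\<tau> \<in> W" for \<tau> Y
      proof -
        have "\<tau> = [] \<or> (\<exists>r. \<tau> = [r])" using that m0 by (cases \<tau>) (auto simp: W_def words_def)
        thus ?thesis by (auto simp: b_def)
      qed
      have "(\<Sum>\<tau>\<in>A. a \<tau> {0} * b \<tau> {0}) = (\<Sum>\<tau>\<in>A. a \<tau> {0} * b \<tau> {})"
        by (intro sum.cong refl arg_cong2[where f="(*)"] b_empty) (simp add: A_def)
      thus False unfolding sum_A using p0[of "{0}" "{}"] p1[of 0 "{0}" "{0}"] n by auto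
    qed
    have mT: "real m * n \<le> T"
    proof -
      have "m * (n + 1) \<le> T" unfolding m_def by (rule div_times_less_eq_dividend)
      hence "m * n \<le> T" by simp
      thus ?thesis by (metis of_nat_le_iff of_nat_mult)
    qed
    have "real n * n / 576 \<le> n * ((real m + 2) * ln s)"
      using mult_left_mono[OF comm, of n] by simp
    also have "\<dots> \<le> n * ((3 * real m) * ln s)"
      using m1 ln_s by (intro mult_left_mono mult_right_mono) auto
    also have "\<dots> = 3 * ((real m * n) * ln s)" by simp
    also have "\<dots> \<le> 3 * (T * log 2 s)"
      using mT ln_s by (intro mult_left_mono mult_mono) auto
    finally have "real n ^ 2 / 1728 \<le> T * log 2 s" by (simp add: power2_eq_square)
    hence "ennreal (real n ^ 2 / 1728) \<le> ennreal (T * log 2 s)" by (rule ennreal_leI)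
    also have "\<dots> = pfa_TS M"
      using ln_s by (simp add: pfa_TS_def enat pfa_space_def s_def ennreal_mult ennreal_of_nat_eq_real_of_nat)
    finally show ?thesis .
  qed
qed

corollary TS_2PFA_lower_bound:
  assumes "1 \<le> n"
    and "\<And>X Y. X \<inter> Y = {} \<Longrightarrow> padded (bits n X) n (bits n Y) \<notin> L"
    and "\<And>X Y i. i < n \<Longrightarrow> X \<inter> Y = {i} \<Longrightarrow> padded (bits n X) n (bits n Y) \<in> L"
  shows "ennreal (real n ^ 2 / 1728) \<le> TS_2PFA L"
  unfolding TS_2PFA_def using pfa_TS_lower_bound[OF _ assms(1) _ assms(2,3)]
  by (intro INF_greatest) auto

section \<open>The two languages as instances of unique disjointness\<close>

lemma padded_inject:
  assumes "length x = n" "length y = n" "length x' = n" "length y' = n" "padded x n y = padded x' n y'"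
  shows "x = x'" "y = y'"
proof -
  have inj: "inj Bit" by (auto simp: inj_def)
  have "map Bit x = map Bit x'" "map Bit y = map Bit y'" using assms by (auto simp: padded_def)
  thus "x = x'" "y = y'" using inj by (auto simp: inj_map_eq_map)
qed

lemma padded_in_L_INTS:
  assumes "length x = n" "length y = n"
  shows "padded x n y \<in> L_INTS n \<longleftrightarrow> (\<exists>i<n. x ! i \<and> y ! i)"
  using padded_inject[OF assms] assms unfolding L_INTS_def by blast

lemma padded_in_L_RNE:
  assumes "length x = 3 ^ d" "length y = 3 ^ d"
  shows "padded x (3 ^ d) y \<in> L_RNE d \<longleftrightarrow> NE d (map2 (\<and>) x y)"
  using padded_inject[OF assms] assms unfolding L_RNE_def by blast

lemma TS_2PFA_INTS: "1 \<le> n \<Longrightarrow> ennreal (real n ^ 2 / 1728) \<le> TS_2PFA (L_INTS n)"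
proof (rule TS_2PFA_lower_bound)
  show "padded (bits n X) n (bits n Y) \<notin> L_INTS n" if "X \<inter> Y = {}" for X Y
    using that by (auto simp: padded_in_L_INTS)
  show "padded (bits n X) n (bits n Y) \<in> L_INTS n" if "i < n" "X \<inter> Y = {i}" for X Y i
  proof -
    have "i \<in> X" "i \<in> Y" using that by auto
    thus ?thesis using that(1) by (auto simp: padded_in_L_INTS)
  qed
qed

lemma map2_bits: "map2 (\<and>) (bits n X) (bits n Y) = bits n (X \<inter> Y)"
  by (rule nth_equalityI) auto

lemma take_drop_bits: "k + m \<le> n \<Longrightarrow> take m (drop k (bits n X)) = bits m {i. i + k \<in> X}"
  by (rule nth_equalityI) (auto simp: add.commute)

lemma NE_bits_Suc:
  "NE (Suc d) (bits (3 ^ Suc d) X) = NE1 (NE d (bits (3 ^ d) X)) (NE d (bits (3 ^ d) {i. i + 3 ^ d \<in> X}))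
     (NE d (bits (3 ^ d) {i. i + 2 * 3 ^ d \<in> X}))"
  using take_drop_bits[of 0 "3 ^ d" "3 ^ Suc d" X] take_drop_bits[of "3 ^ d" "3 ^ d" "3 ^ Suc d" X]
    take_drop_bits[of "2 * 3 ^ d" "3 ^ d" "3 ^ Suc d" X] by simp

lemma NE_bits_empty: "X \<inter> {..<3 ^ d} = {} \<Longrightarrow> \<not> NE d (bits (3 ^ d) X)"
proof (induction d arbitrary: X)
  case 0
  thus ?case by (auto simp: bits_def)
next
  case (Suc d)
  have "{i. i + k * 3 ^ d \<in> X} \<inter> {..<3 ^ d} = {}" if "k < 3" for k
  proof -
    have "(k + 1) * 3 ^ d \<le> 3 * (3 ^ d :: nat)" using that by (intro mult_right_mono) auto
    hence "i + k * 3 ^ d < 3 ^ Suc d" if "i < 3 ^ d" for i using that unfolding power_Suc add_mult_distrib by linarith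
    thus ?thesis using Suc.prems by (auto simp: disjoint_iff)
  qed
  from this[of 0] this[of 1] this[of 2] show ?case
    unfolding NE_bits_Suc by (simp add: Suc.IH NE1_def)
qed

text \<open>Exactly one of the three blocks contains the single one, and \<open>NE1\<close> is true
  at an input with exactly one true bit.\<close>

lemma NE_bits_single: "X \<inter> {..<3 ^ d} = {i} \<Longrightarrow> NE d (bits (3 ^ d) X)"
proof (induction d arbitrary: X i)
  case 0
  hence "0 \<in> X" by (metis Int_iff insertI1 lessThan_iff less_one power_0)
  thus ?case by (simp add: bits_def)
next
  case (Suc d)
  define Z where "Z k = {i. i + k * 3 ^ d \<in> X}" for k
  have i: "i < 3 * 3 ^ d" using Suc.prems by auto
  have e: "Z k \<inter> {..<3 ^ d} = (if k = i div 3 ^ d then {i mod 3 ^ d} else {})" if "k < 3" for k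
  proof -
    have "(k + 1) * 3 ^ d \<le> 3 * (3 ^ d :: nat)" using that by (intro mult_right_mono) auto
    hence lt: "j + k * 3 ^ d < 3 ^ Suc d" if "j < 3 ^ d" for j using that unfolding power_Suc add_mult_distrib by linarith
    have iX: "l \<in> X \<longleftrightarrow> l = i" if "l < 3 ^ Suc d" for l using Suc.prems that by blast
    have "j \<in> Z k \<inter> {..<3 ^ d} \<longleftrightarrow> j < 3 ^ d \<and> j + k * 3 ^ d = i" for j
      unfolding Z_def using iX[OF lt, of j] by auto
    moreover have "j < 3 ^ d \<and> j + k * 3 ^ d = i \<longleftrightarrow> k = i div 3 ^ d \<and> j = i mod 3 ^ d" for j
      by (auto simp: mod_div_mult_eq)
    ultimately show ?thesis by auto
  qed
  have i3: "i div 3 ^ d < 3" using i by (simp add: less_mult_imp_div_less)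
  have v: "NE d (bits (3 ^ d) (Z k)) \<longleftrightarrow> k = i div 3 ^ d" if "k < 3" for k
    using e[OF that] Suc.IH[of "Z k"] NE_bits_empty[of "Z k" d] by (auto split: if_splits)
  have "NE (Suc d) (bits (3 ^ Suc d) X) = NE1 (NE d (bits (3 ^ d) (Z 0))) (NE d (bits (3 ^ d) (Z 1))) (NE d (bits (3 ^ d) (Z 2)))"
    unfolding NE_bits_Suc by (simp add: Z_def)
  also have "\<dots>" using i3 v[of 0] v[of 1] v[of 2] unfolding NE1_def by auto
  finally show ?case .
qed

lemma TS_2PFA_RNE: "ennreal (real (3 ^ d) ^ 2 / 1728) \<le> TS_2PFA (L_RNE d)"
proof (rule TS_2PFA_lower_bound)
  show "padded (bits (3 ^ d) X) (3 ^ d) (bits (3 ^ d) Y) \<notin> L_RNE d" if "X \<inter> Y = {}" for X Y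
    using that by (simp add: padded_in_L_RNE map2_bits NE_bits_empty)
  show "padded (bits (3 ^ d) X) (3 ^ d) (bits (3 ^ d) Y) \<in> L_RNE d" if "i < 3 ^ d" "X \<inter> Y = {i}" for X Y i
    using that by (subst padded_in_L_RNE) (auto simp: map2_bits intro: NE_bits_single)
qed simp

section \<open>Real operators as complex matrices\<close>

type_synonym rvec = "nat \<Rightarrow> real"

type_synonym rop = "rvec \<Rightarrow> rvec"

definition ip :: "nat \<Rightarrow> rvec \<Rightarrow> rvec \<Rightarrow> real" where
  "ip m u v = (\<Sum>i<m. u i * v i)"

definition basis :: "nat \<Rightarrow> nat \<Rightarrow> real" where
  "basis j i = of_bool (i = j)"

definition trunc :: "nat \<Rightarrow> rop" where
  "trunc m u i = (if i < m then u i else 0)"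

text \<open>Vectors of dimension \<open>m\<close> are functions of which only the first \<open>m\<close> entries matter; operators
  ignore the other entries of their argument and set those of their value to \<open>0\<close>.\<close>

definition symmetric_op :: "nat \<Rightarrow> rop \<Rightarrow> bool" where
  "symmetric_op m T \<longleftrightarrow>
     (\<forall>a b u v. T (\<lambda>i. a * u i + b * v i) = (\<lambda>i. a * T u i + b * T v i)) \<and>
     (\<forall>u. T (trunc m u) = T u) \<and> (\<forall>u. trunc m (T u) = T u) \<and>
     (\<forall>u v. ip m (T u) v = ip m u (T v))"

text \<open>All unitary steps of the machines are real symmetric involutions, so one notion covers
  unitarity and self-adjointness; \<open>trunc m\<close> plays the role of the identity.\<close>

definition reflection :: "nat \<Rightarrow> rop \<Rightarrow> bool" where
  "reflection m T \<longleftrightarrow> symmetric_op m T \<and> (\<forall>u. T (T u) = trunc m u)"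

definition projection :: "nat \<Rightarrow> rop \<Rightarrow> bool" where
  "projection m P \<longleftrightarrow> symmetric_op m P \<and> (\<forall>u. P (P u) = P u)"

definition compl_op :: "nat \<Rightarrow> rop \<Rightarrow> rop" where
  "compl_op m P u = (\<lambda>i. trunc m u i - P u i)"

lemma trunc_trunc [simp]: "trunc m (trunc m u) = trunc m u"
  by (auto simp: trunc_def fun_eq_iff)

lemma ip_trunc [simp]: "ip m (trunc m u) v = ip m u v" "ip m u (trunc m v) = ip m u v"
  by (auto simp: ip_def trunc_def)

lemma ip_commute: "ip m u v = ip m v u"
  by (simp add: ip_def mult.commute)

lemma ip_linear [simp]:
  "ip m (\<lambda>i. u i + v i) w = ip m u w + ip m v w"
  "ip m (\<lambda>i. u i - v i) w = ip m u w - ip m v w"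
  "ip m (\<lambda>i. a * u i) w = a * ip m u w"
  "ip m w (\<lambda>i. u i + v i) = ip m w u + ip m w v"
  "ip m w (\<lambda>i. u i - v i) = ip m w u - ip m w v"
  "ip m w (\<lambda>i. a * u i) = a * ip m w u"
  by (simp_all add: ip_def algebra_simps sum.distrib sum_subtractf sum_distrib_left)

lemma ip_nonneg [simp]: "0 \<le> ip m u u"
  by (simp add: ip_def sum_nonneg)

lemma ip_eq_0_iff: "ip m u u = 0 \<longleftrightarrow> trunc m u = (\<lambda>_. 0)"
  by (auto simp: ip_def sum_nonneg_eq_0_iff trunc_def fun_eq_iff)

lemma
  assumes "symmetric_op m T"
  shows symmetric_op_comb: "T (\<lambda>i. a * u i + b * v i) = (\<lambda>i. a * T u i + b * T v i)"
    and symmetric_op_diff: "T (\<lambda>i. u i - v i) = (\<lambda>i. T u i - T v i)"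
    and symmetric_op_scale: "T (\<lambda>i. a * u i) = (\<lambda>i. a * T u i)"
    and symmetric_op_zero: "T (\<lambda>i. 0) = (\<lambda>i. 0)"
    and symmetric_op_trunc: "T (trunc m u) = T u" "trunc m (T u) = T u"
    and symmetric_op_adj: "ip m (T u) v = ip m u (T v)"
proof -
  show c: "T (\<lambda>i. a * u i + b * v i) = (\<lambda>i. a * T u i + b * T v i)" for a b u v
    using assms by (simp add: symmetric_op_def)
  show "T (\<lambda>i. u i - v i) = (\<lambda>i. T u i - T v i)" using c[of 1 u "-1" v] by simp
  show "T (\<lambda>i. a * u i) = (\<lambda>i. a * T u i)" using c[of a u 0 u] by simp
  show "T (\<lambda>i. 0) = (\<lambda>i. 0)" using c[of 0 u 0 u] by simp
  show "T (trunc m u) = T u" "trunc m (T u) = T u" "ip m (T u) v = ip m u (T v)"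
    using assms by (auto simp: symmetric_op_def)
qed

lemma symmetric_op_outside:
  assumes "symmetric_op m T" "m \<le> i"
  shows "T u i = 0"
proof -
  have "T u i = trunc m (T u) i" using symmetric_op_trunc(2)[OF assms(1)] by simp
  thus ?thesis using assms(2) by (simp add: trunc_def)
qed

lemma symmetric_op_sum:
  assumes "symmetric_op m T" "finite J"
  shows "T (\<lambda>i. \<Sum>j\<in>J. c j * f j i) = (\<lambda>i. \<Sum>j\<in>J. c j * T (f j) i)"
  using assms(2)
proof (induction J rule: finite_induct)
  case (insert x F)
  have "T (\<lambda>i. \<Sum>j\<in>insert x F. c j * f j i) = T (\<lambda>i. c x * f x i + 1 * (\<Sum>j\<in>F. c j * f j i))"
    using insert by simp
  also have "\<dots> = (\<lambda>i. c x * T (f x) i + 1 * T (\<lambda>i. \<Sum>j\<in>F. c j * f j i) i)"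
    by (rule symmetric_op_comb[OF assms(1)])
  finally show ?case using insert by simp
qed (simp add: symmetric_op_zero[OF assms(1)])

lemma trunc_expand: "trunc m u = (\<lambda>i. \<Sum>j<m. u j * basis j i)"
  by (auto simp: trunc_def basis_def fun_eq_iff)

lemma symmetric_op_expand:
  assumes "symmetric_op m T"
  shows "T u i = (\<Sum>j<m. u j * T (basis j) i)"
  using fun_cong[OF symmetric_op_sum[OF assms, of "{..<m}" u basis], of i] symmetric_op_trunc(1)[OF assms, of u]
  by (simp add: trunc_expand)

lemma ip_basis: "j < m \<Longrightarrow> ip m u (basis j) = u j"
  by (simp add: ip_def basis_def)

lemma symmetric_op_basis:
  assumes "symmetric_op m T" "i < m" "j < m"
  shows "T (basis j) i = T (basis i) j"
  using symmetric_op_adj[OF assms(1), of "basis j" "basis i"] assms(2,3)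
  by (simp add: ip_basis ip_commute[of m "basis j"])

lemma reflection_symmetric: "reflection m T \<Longrightarrow> symmetric_op m T"
  and projection_symmetric: "projection m T \<Longrightarrow> symmetric_op m T"
  by (simp_all add: reflection_def projection_def)

lemma reflection_invol: "reflection m T \<Longrightarrow> T (T u) = trunc m u"
  by (simp add: reflection_def)

lemma reflection_ip: "reflection m T \<Longrightarrow> ip m (T u) (T v) = ip m u v"
  by (simp add: symmetric_op_adj[OF reflection_symmetric] reflection_invol)

lemma projection_ip: "projection m P \<Longrightarrow> ip m (P u) (P v) = ip m u (P v)"
  by (simp add: symmetric_op_adj[OF projection_symmetric] projection_def)

lemma compl_op_projection:
  assumes "projection m P"
  shows "projection m (compl_op m P)"
proof -
  note S = projection_symmetric[OF assms]
  have PP: "P (P u) = P u" for u using assms by (simp add: projection_def)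
  have t: "trunc m (\<lambda>i. trunc m u i - P u i) = (\<lambda>i. trunc m u i - P u i)" for u
    using symmetric_op_outside[OF S] by (auto simp: trunc_def fun_eq_iff)
  have "symmetric_op m (compl_op m P)"
    unfolding symmetric_op_def compl_op_def
  proof (intro conjI allI)
    fix a b :: real and u v :: rvec
    show "(\<lambda>i. trunc m (\<lambda>i. a * u i + b * v i) i - P (\<lambda>i. a * u i + b * v i) i) =
       (\<lambda>i. a * (trunc m u i - P u i) + b * (trunc m v i - P v i))"
      unfolding symmetric_op_comb[OF S] by (auto simp: trunc_def fun_eq_iff algebra_simps)
    show "ip m (\<lambda>i. trunc m u i - P u i) v = ip m u (\<lambda>i. trunc m v i - P v i)"
      by (simp add: symmetric_op_adj[OF S])
  qed (simp_all add: symmetric_op_trunc[OF S] t)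
  moreover have "compl_op m P (compl_op m P u) = compl_op m P u" for u
    unfolding compl_op_def t symmetric_op_diff[OF S] symmetric_op_trunc[OF S] PP by simp
  ultimately show ?thesis by (simp add: projection_def)
qed

lemma compl_op_pythagoras:
  assumes "projection m P"
  shows "ip m (P u) (P u) + ip m (compl_op m P u) (compl_op m P u) = ip m u u"
  unfolding projection_ip[OF assms] projection_ip[OF compl_op_projection[OF assms]]
  by (simp add: compl_op_def)

section \<open>Complex matrices of real operators, and the Born rule\<close>

definition vec_of :: "nat \<Rightarrow> rvec \<Rightarrow> complex Matrix.vec" where
  "vec_of m u = Matrix.vec m (\<lambda>i. complex_of_real (u i))"

definition mat_of :: "nat \<Rightarrow> rop \<Rightarrow> complex mat" where
  "mat_of m T = Matrix.mat m m (\<lambda>(i, j). complex_of_real (T (basis j) i))"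

lemma mat_of_carrier [simp]: "mat_of m T \<in> carrier_mat m m"
  by (simp add: mat_of_def)

lemma mat_of_mult_vec:
  assumes "symmetric_op m T"
  shows "mat_of m T *\<^sub>v vec_of m u = vec_of m (T u)"
proof (rule eq_vecI)
  fix i assume "i < dim_vec (vec_of m (T u))"
  hence i: "i < m" by (simp add: vec_of_def)
  have "vec_index (mat_of m T *\<^sub>v vec_of m u) i = (\<Sum>j<m. complex_of_real (T (basis j) i) * complex_of_real (u j))"
    using i by (simp add: mat_of_def vec_of_def scalar_prod_def lessThan_atLeast0)
  also have "\<dots> = complex_of_real (T u i)"
    by (subst symmetric_op_expand[OF assms, of u i]) (simp add: mult.commute)
  finally show "vec_index (mat_of m T *\<^sub>v vec_of m u) i = vec_index (vec_of m (T u)) i"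
    using i by (simp add: vec_of_def)
qed (simp add: vec_of_def mat_of_def)

lemma mat_of_mult:
  assumes "symmetric_op m S"
  shows "mat_of m S * mat_of m T = mat_of m (\<lambda>u. S (T u))"
proof (rule eq_matI)
  fix i j assume "i < dim_row (mat_of m (\<lambda>u. S (T u)))" "j < dim_col (mat_of m (\<lambda>u. S (T u)))"
  hence ij: "i < m" "j < m" by (simp_all add: mat_of_def)
  have "(mat_of m S * mat_of m T) $$ (i, j) = (\<Sum>k<m. complex_of_real (S (basis k) i) * complex_of_real (T (basis j) k))"
    using ij by (simp add: mat_of_def scalar_prod_def lessThan_atLeast0)
  also have "\<dots> = complex_of_real (S (T (basis j)) i)"
    by (subst symmetric_op_expand[OF assms, of "T (basis j)" i]) (simp add: mult.commute)
  finally show "(mat_of m S * mat_of m T) $$ (i, j) = mat_of m (\<lambda>u. S (T u)) $$ (i, j)"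
    using ij by (simp add: mat_of_def)
qed (simp_all add: mat_of_def)

lemma mat_of_adjoint:
  assumes "symmetric_op m T"
  shows "mat_adjoint (mat_of m T) = mat_of m T"
proof (rule eq_matI)
  fix i j assume "i < dim_row (mat_of m T)" "j < dim_col (mat_of m T)"
  hence ij: "i < m" "j < m" by (simp_all add: mat_of_def)
  show "mat_adjoint (mat_of m T) $$ (i, j) = mat_of m T $$ (i, j)"
    using ij symmetric_op_basis[OF assms ij] by (simp add: mat_adjoint_def mat_of_rows_def mat_of_def)
qed (simp_all add: mat_of_def mat_adjoint_def)

lemma mat_of_trunc: "mat_of m (trunc m) = 1\<^sub>m m"
  by (rule eq_matI) (auto simp: mat_of_def trunc_def basis_def)

lemma mat_of_zero: "mat_of m (\<lambda>u i. 0) = 0\<^sub>m m m"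
  by (rule eq_matI) (auto simp: mat_of_def)

lemma unitary_mat_of:
  assumes "reflection m T"
  shows "unitary_mat m (mat_of m T)"
proof -
  note S = reflection_symmetric[OF assms]
  have "(\<lambda>u. T (T u)) = trunc m" by (intro ext) (simp add: reflection_invol[OF assms])
  thus ?thesis by (simp add: unitary_mat_def mat_of_adjoint[OF S] mat_of_mult[OF S] mat_of_trunc)
qed

lemma measurement_mat_of:
  assumes "projection m P"
  shows "orthogonal_measurement m [mat_of m P, mat_of m (compl_op m P)]"
proof -
  note Q = compl_op_projection[OF assms]
  note S = projection_symmetric[OF assms] and SQ = projection_symmetric[OF Q]
  have PP: "P (P u) = P u" "compl_op m P (compl_op m P u) = compl_op m P u" for u
    using assms Q by (simp_all add: projection_def)
  have PQ: "P (compl_op m P u) = (\<lambda>i. 0)" "compl_op m P (P u) = (\<lambda>i. 0)" for u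
    unfolding compl_op_def symmetric_op_diff[OF S] symmetric_op_trunc[OF S] PP by simp_all
  have sum: "mat_of m P + mat_of m (compl_op m P) = 1\<^sub>m m"
    by (rule eq_matI) (auto simp: mat_of_def compl_op_def trunc_def basis_def)
  show ?thesis unfolding orthogonal_measurement_def
    by (auto simp: mat_of_adjoint[OF S] mat_of_adjoint[OF SQ] mat_of_mult[OF S] mat_of_mult[OF SQ] PP PQ
          mat_of_zero sum less_Suc_eq nth_Cons split: nat.split)
qed

lemma norm2_vec_of: "norm2 (vec_of m u) = ip m u u"
  by (simp add: norm2_def vec_of_def ip_def power2_eq_square)

lemma norm2_smult: "norm2 (complex_of_real a \<cdot>\<^sub>v x) = a\<^sup>2 * norm2 x"
  by (simp add: norm2_def norm_mult power_mult_distrib sum_distrib_left)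

text \<open>The analysis follows unnormalized vectors, whose squared length is the probability of
  the branch; the register of the machine holds this rescaling.\<close>

definition normalized :: "nat \<Rightarrow> rvec \<Rightarrow> complex Matrix.vec" where
  "normalized m u = complex_of_real (1 / sqrt (ip m u u)) \<cdot>\<^sub>v vec_of m u"

lemma mat_of_mult_normalized:
  assumes "symmetric_op m T"
  shows "mat_of m T *\<^sub>v normalized m u = complex_of_real (1 / sqrt (ip m u u)) \<cdot>\<^sub>v vec_of m (T u)"
  unfolding normalized_def
  by (subst mult_mat_vec[OF mat_of_carrier]) (simp_all add: mat_of_mult_vec[OF assms], simp add: vec_of_def)

lemma norm2_mat_of_normalized:
  assumes "symmetric_op m T"
  shows "norm2 (mat_of m T *\<^sub>v normalized m u) = ip m (T u) (T u) / ip m u u"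
  unfolding mat_of_mult_normalized[OF assms] norm2_smult norm2_vec_of by (simp add: power_divide)

lemma renormalize:
  assumes "symmetric_op m T" "0 < ip m u u"
  shows "complex_of_real (1 / sqrt (norm2 (mat_of m T *\<^sub>v normalized m u))) \<cdot>\<^sub>v (mat_of m T *\<^sub>v normalized m u)
     = normalized m (T u)"
proof -
  have r: "1 / sqrt (b / a) * (1 / sqrt a) = 1 / sqrt b" if "0 < a" for a b :: real
    using that by (simp add: real_sqrt_divide)
  show ?thesis
    unfolding norm2_mat_of_normalized[OF assms(1)] unfolding mat_of_mult_normalized[OF assms(1)] unfolding normalized_def
    by (simp only: smult_smult_assoc of_real_mult[symmetric] r[OF assms(2)])
qed

text \<open>By Pythagoras the two outcome weights add up to 1, which is what
  \<open>embed_pmf\<close> requires.\<close>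

lemma pmf_measure_outcome:
  assumes P: "projection m P" and u: "0 < ip m u u"
  defines "N \<equiv> embed_pmf (\<lambda>j. if j < length [mat_of m P, mat_of m (compl_op m P)]
     then norm2 ([mat_of m P, mat_of m (compl_op m P)] ! j *\<^sub>v normalized m u) else 0)"
  shows "set_pmf N \<subseteq> {0, 1}"
    and "pmf N 1 = ip m (compl_op m P u) (compl_op m P u) / ip m u u"
proof -
  let ?f = "\<lambda>j. if j < length [mat_of m P, mat_of m (compl_op m P)]
     then norm2 ([mat_of m P, mat_of m (compl_op m P)] ! j *\<^sub>v normalized m u) else 0"
  note S = projection_symmetric[OF P] projection_symmetric[OF compl_op_projection[OF P]]
  have f: "?f j = (if j = 0 then ip m (P u) (P u) / ip m u u
     else if j = 1 then ip m (compl_op m P u) (compl_op m P u) / ip m u u else 0)" for j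
    by (auto simp: norm2_mat_of_normalized[OF S(1)] norm2_mat_of_normalized[OF S(2)] less_Suc_eq)
  have nn: "0 \<le> ?f j" for j unfolding f by simp
  have "(\<integral>\<^sup>+ j. ennreal (?f j) \<partial>count_space UNIV) = (\<Sum>j\<in>{0, 1}. ennreal (?f j))"
    by (rule nn_integral_count_space') (auto simp: less_Suc_eq)
  also have "\<dots> = ennreal (?f 0 + ?f 1)" using nn by (simp add: ennreal_plus del: ennreal_plus flip: ennreal_plus)
  also have "?f 0 + ?f 1 = 1"
    unfolding f using u compl_op_pythagoras[OF P, of u] by (simp add: add_divide_distrib[symmetric])
  finally have one: "(\<integral>\<^sup>+ j. ennreal (?f j) \<partial>count_space UNIV) = 1" by simp
  have N: "pmf N j = ?f j" for j unfolding N_def by (rule pmf_embed_pmf[OF nn one])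
  show "pmf N 1 = ip m (compl_op m P u) (compl_op m P u) / ip m u u" unfolding N f by simp
  show "set_pmf N \<subseteq> {0, 1}" unfolding set_pmf_eq N f by auto
qed

lemma pmf_map_single:
  assumes "f x = y" "\<And>z. z \<in> set_pmf N \<Longrightarrow> z \<noteq> x \<Longrightarrow> f z \<noteq> y"
  shows "pmf (map_pmf f N) y = pmf N x"
proof -
  have "pmf (map_pmf f N) y = measure_pmf.prob N (f -` {y} \<inter> set_pmf N)"
    by (simp add: pmf_map measure_Int_set_pmf)
  also have "f -` {y} \<inter> set_pmf N = {x} \<inter> set_pmf N" using assms by auto
  also have "measure_pmf.prob N ({x} \<inter> set_pmf N) = pmf N x"
    by (simp add: measure_Int_set_pmf measure_pmf_single)
  finally show ?thesis .
qed

section \<open>Clocked quantum automata\<close>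

text \<open>A machine whose classical state is the number of steps made so far, apart from the two halting
  states \<open>L\<close> (reject) and \<open>L + 1\<close> (accept). It rejects on reading an unexpected symbol and accepts on
  the first outcome of a measurement.\<close>

locale clocked =
  fixes L m :: nat and meas :: "nat \<Rightarrow> bool"
    and opr :: "nat \<Rightarrow> 'a cell \<Rightarrow> rop"
    and ok :: "nat \<Rightarrow> 'a cell \<Rightarrow> bool" and mv :: "nat \<Rightarrow> move"
  assumes m: "0 < m"
    and refl: "\<And>s \<sigma>. \<not> meas s \<Longrightarrow> reflection m (opr s \<sigma>)"
    and proj: "\<And>s \<sigma>. meas s \<Longrightarrow> projection m (opr s \<sigma>)"
    and legal: "\<And>s \<sigma>. ok s \<sigma> \<Longrightarrow> legal_move \<sigma> (mv s)"
begin

definition machine :: "'a qcfa" where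
  "machine = \<lparr>states = {..<L+2}, start = 0, accepting = {L+1}, rejecting = {L},
     qdim = m, qstart = 0,
     qoper = (\<lambda>s \<sigma>. if meas s then Measure [mat_of m (opr s \<sigma>), mat_of m (compl_op m (opr s \<sigma>))]
        else Unitary (mat_of m (opr s \<sigma>))),
     qtrans = (\<lambda>s \<sigma> j. if \<not> ok s \<sigma> then (L, Stay) else if meas s \<and> j = 0 then (L+1, Stay) else (s+1, mv s))\<rparr>"

lemma machine_simps [simp]:
  "states machine = {..<L+2}" "start machine = 0" "accepting machine = {L+1}" "rejecting machine = {L}"
  "qdim machine = m" "qstart machine = 0"
  "qoper machine s \<sigma> = (if meas s then Measure [mat_of m (opr s \<sigma>), mat_of m (compl_op m (opr s \<sigma>))]
        else Unitary (mat_of m (opr s \<sigma>)))"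
  "qtrans machine s \<sigma> j = (if \<not> ok s \<sigma> then (L, Stay) else if meas s \<and> j = 0 then (L+1, Stay) else (s+1, mv s))"
  by (simp_all add: machine_def)

lemma halting_machine [simp]: "halting machine = {L, L+1}"
  by (auto simp: halting_def)

lemma wf_machine: "wf_qcfa machine"
  unfolding wf_qcfa_def wf_control_def
  using m legal by (auto simp: unitary_mat_of[OF refl] measurement_mat_of[OF proj] legal_move_def)

abbreviation "step w \<equiv> qcfa_step machine w"

abbreviation "law w \<equiv> run (step w) (qcfa_init machine)"

lemma qcfa_init_machine: "qcfa_init machine = (0, 0, vec_of m (basis 0))"
  by (auto simp: qcfa_init_def vec_of_def basis_def unit_vec_def intro!: eq_vecI)

lemma step_cases:
  assumes "c' \<in> set_pmf (step w c)"
  shows "fst c' = (if fst c \<in> {L, L+1} then fst c else Suc (fst c)) \<or> fst c' \<in> {L, L+1}"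
  using assms by (cases c) (auto simp: qcfa_step_def)

lemma run_state: "c' \<in> set_pmf (law w t) \<Longrightarrow> fst c' = t \<or> fst c' \<in> {L, L+1}"
proof (induction t arbitrary: c')
  case 0
  thus ?case by (simp add: qcfa_init_machine)
next
  case (Suc t)
  then obtain c where "c \<in> set_pmf (law w t)" "c' \<in> set_pmf (step w c)" by auto
  thus ?case using Suc.IH[of c] step_cases[of c' w c] by (auto split: if_splits)
qed

lemma run_halts:
  assumes "c' \<in> set_pmf (law w t)" "L \<le> t"
  shows "fst c' \<in> halting machine"
proof -
  have "fst c' \<in> {L, L+1}" if "c' \<in> set_pmf (law w L)" for c'
    using run_state[OF that] by auto
  moreover have "step w c = return_pmf c" if "fst c \<in> {L, L+1}" for c
    using that by (cases c) (simp add: qcfa_step_def)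
  ultimately have "law w (L + (t - L)) = law w L"
    by (intro run_halted) auto
  thus ?thesis using assms \<open>\<And>c'. c' \<in> set_pmf (law w L) \<Longrightarrow> fst c' \<in> {L, L+1}\<close> by simp
qed

lemma time_machine: "qcfa_time machine \<le> enat L"
  unfolding qcfa_time_def steps_before_halting_def
proof (intro SUP_least)
  fix w t assume "t \<in> {t. \<exists>c'\<in>set_pmf (law w t). fst c' \<notin> halting machine}"
  hence "\<not> L \<le> t" using run_halts by blast
  thus "enat (Suc t) \<le> enat L" by simp
qed

lemma accept_prob_machine:
  "qcfa_accept_prob machine w = measure_pmf.prob (law w L) {c. fst c = L+1}"
proof -
  have "qcfa_accept_prob machine w = measure_pmf.prob (law w L) {c. fst c \<in> accepting machine}"
    unfolding qcfa_accept_prob_def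
    by (rule accept_prob_eq) (use run_halts in \<open>auto simp: qcfa_step_def\<close>)
  thus ?thesis by simp
qed

lemma TS_machine: "qcfa_TS machine \<le> ennreal (real L * (log 2 m + log 2 (L + 2)))"
proof -
  have "qcfa_TS machine \<le> ennreal_of_enat (enat L) * ennreal (log 2 m + log 2 (L + 2))"
    unfolding qcfa_TS_def
    by (intro mult_mono) (use time_machine in \<open>auto simp: qcfa_space_def simp del: ennreal_of_enat_enat\<close>)
  also have "\<dots> = ennreal (real L * (log 2 m + log 2 (L + 2)))"
    using m by (simp add: ennreal_mult ennreal_of_nat_eq_real_of_nat)
  finally show ?thesis .
qed

text \<open>The moves depend neither on the input nor on outcomes, so while the machine runs the
  position of the head is a function of time.\<close>

primrec head :: "nat \<Rightarrow> nat" where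
  "head 0 = 0"
| "head (Suc t) = shift (mv t) (head t)"

text \<open>Only a measurement can accept. If the first wrong symbol is met before any measurement,
  rejection is certain, as an exact machine requires.\<close>

lemma reject_early:
  assumes bad: "t0 < L" "\<not> ok t0 (tape w (head t0))" and nomeas: "\<And>t. t \<le> t0 \<Longrightarrow> \<not> meas t"
  shows "qcfa_accept_prob machine w = 0"
proof -
  have inv: "(fst c = t \<and> fst (snd c) = head t \<and> t \<le> t0) \<or> fst c = L"
    if "c \<in> set_pmf (law w t)" for c t
    using that
  proof (induction t arbitrary: c)
    case 0
    thus ?case by (simp add: qcfa_init_machine)
  next
    case (Suc t)
    then obtain c1 where c1: "c1 \<in> set_pmf (law w t)" "c \<in> set_pmf (step w c1)" by auto
    from Suc.IH[OF c1(1)] show ?case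
    proof
      assume a: "fst c1 = t \<and> fst (snd c1) = head t \<and> t \<le> t0"
      hence "t < L" "\<not> meas t" using bad nomeas by auto
      thus ?thesis using c1(2) a bad(2) by (cases c1; cases "t = t0") (auto simp: qcfa_step_def split: if_splits)
    next
      assume "fst c1 = L"
      thus ?thesis using c1(2) by (cases c1) (auto simp: qcfa_step_def)
    qed
  qed
  have "c \<notin> {c. fst c = L+1}" if "c \<in> set_pmf (law w L)" for c
    using inv[OF that] bad(1) by auto
  hence "measure_pmf.prob (law w L) {c. fst c = L+1} = 0"
    by (intro measure_pmf_zero_iff[THEN iffD2]) auto
  thus ?thesis by (simp add: accept_prob_machine)
qed

primrec amp :: "'a list \<Rightarrow> nat \<Rightarrow> nat \<Rightarrow> real" where
  "amp w 0 = basis 0"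
| "amp w (Suc t) = (if meas t then compl_op m (opr t (tape w (head t))) (amp w t)
     else opr t (tape w (head t)) (amp w t))"

text \<open>At each time the law is carried by a single running branch, in which no measurement has
  accepted, and by accepting configurations. The branch has probability \<open>W t\<close>, and at
  time \<open>L\<close> its clock value is the rejecting state itself.\<close>

theorem accept_prob_amp:
  assumes good: "\<And>t. t < L \<Longrightarrow> ok t (tape w (head t))"
  shows "qcfa_accept_prob machine w = 1 - ip m (amp w L) (amp w L)"
proof -
  define W where "W t = ip m (amp w t) (amp w t)" for t
  define c where "c t = (t, head t, normalized m (amp w t))" for t
  define p where "p t = law w t" for t
  have inv: "set_pmf (p t) \<subseteq> insert (c t) {c. fst c = L+1} \<and> pmf (p t) (c t) = W t" if "t \<le> L" for t
    using that
  proof (induction t)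
    case 0
    have "ip m (basis 0) (basis 0) = 1" using ip_basis[OF m, of "basis 0"] by (simp add: basis_def)
    thus ?case by (simp add: p_def c_def W_def qcfa_init_machine normalized_def)
  next
    case (Suc t)
    hence t: "t < L" by simp
    note IH = Suc.IH[OF less_imp_le[OF t]]
    let ?T = "opr t (tape w (head t))"
    have okt: "ok t (tape w (head t))" by (rule good[OF t])
    have fixed: "step w x = return_pmf x" if "fst x = L+1" for x
      using that by (cases x) (simp add: qcfa_step_def)
    have step: "set_pmf (step w (c t)) \<subseteq> insert (c (Suc t)) {c. fst c = L+1} \<and>
       pmf (step w (c t)) (c (Suc t)) * W t = W (Suc t)" if W: "W t > 0"
    proof (cases "meas t")
      case False
      note S = reflection_symmetric[OF refl[OF False]]
      have e: "ip m (?T (amp w t)) (?T (amp w t)) = W t"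
        by (simp add: W_def reflection_ip[OF refl[OF False]])
      hence "mat_of m ?T *\<^sub>v normalized m (amp w t) = normalized m (amp w (Suc t))"
        using False unfolding mat_of_mult_normalized[OF S] by (simp add: W_def normalized_def)
      hence "step w (c t) = return_pmf (c (Suc t))"
        using t False okt by (simp add: qcfa_step_def c_def)
      thus ?thesis using e False by (simp add: W_def)
    next
      case True
      note P = proj[OF True]
      have u: "0 < ip m (amp w t) (amp w t)" using W by (simp add: W_def)
      let ?Ps = "[mat_of m ?T, mat_of m (compl_op m ?T)]"
      define N where "N = embed_pmf (\<lambda>j. if j < length ?Ps then norm2 (?Ps ! j *\<^sub>v normalized m (amp w t)) else 0)"
      note N = pmf_measure_outcome[OF P u, of "tape w (head t)", folded N_def]
      define f where "f j = (let (s', d) = qtrans machine t (tape w (head t)) j in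
         (s', shift d (head t), complex_of_real (1 / sqrt (norm2 (?Ps ! j *\<^sub>v normalized m (amp w t)))) \<cdot>\<^sub>v (?Ps ! j *\<^sub>v normalized m (amp w t))))" for j
      have "step w (c t) = map_pmf (\<lambda>(j, \<psi>). let (s', d) = qtrans machine t (tape w (head t)) j in (s', shift d (head t), \<psi>))
         (apply_qop (Measure ?Ps) (normalized m (amp w t)))"
        using t True by (simp add: qcfa_step_def c_def)
      also have "\<dots> = map_pmf f N"
        unfolding apply_qop.simps N_def[symmetric] pmf.map_comp
        by (rule arg_cong[where f="\<lambda>g. map_pmf g N"], rule ext, simp only: o_apply prod.case f_def)
      finally have step_eq: "step w (c t) = map_pmf f N" .
      have f1: "f 1 = c (Suc t)"
        using True okt renormalize[OF projection_symmetric[OF compl_op_projection[OF P]] u]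
        by (simp add: f_def c_def)
      have f0: "fst (f 0) = L + 1" using True okt by (simp add: f_def)
      have "set_pmf (map_pmf f N) \<subseteq> insert (c (Suc t)) {c. fst c = L+1}"
        using N(1) f0 f1 by auto
      moreover have "pmf (map_pmf f N) (c (Suc t)) = pmf N 1"
        by (rule pmf_map_single[where f=f, OF f1]) (use N(1) f0 t in \<open>auto simp: c_def\<close>)
      ultimately show ?thesis unfolding step_eq N(2) using True W by (simp add: W_def)
    qed
    have "W (Suc t) \<le> W t"
    proof (cases "meas t")
      case True
      show ?thesis
        using True compl_op_pythagoras[OF proj[OF True], of "tape w (head t)" "amp w t"]
          ip_nonneg[of m "?T (amp w t)"]
        unfolding W_def amp.simps if_P[OF True] by linarith
    next
      case False
      thus ?thesis by (simp add: W_def reflection_ip[OF refl[OF False]])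
    qed
    have W0: "W t \<ge> 0" "W (Suc t) \<ge> 0" by (simp_all add: W_def)
    \<comment> \<open>The normalized vector of a branch of weight 0 is meaningless, but such a
      branch is not in the support.\<close>
    have notin: "c t \<notin> set_pmf (p t)" if "W t = 0" using IH that by (simp add: pmf_eq_0_set_pmf)
    have sub: "set_pmf (p (Suc t)) \<subseteq> insert (c (Suc t)) {c. fst c = L+1}"
    proof
      fix y assume "y \<in> set_pmf (p (Suc t))"
      then obtain x where x: "x \<in> set_pmf (p t)" "y \<in> set_pmf (step w x)" by (auto simp: p_def)
      show "y \<in> insert (c (Suc t)) {c. fst c = L+1}"
      proof (cases "x = c t")
        case True
        hence "W t > 0" using notin x(1) W0 by (cases "W t = 0") auto
        thus ?thesis using step x(2) True by auto
      next
        case False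
        hence "fst x = L+1" using IH x(1) by auto
        thus ?thesis using x(2) fixed by auto
      qed
    qed
    have "pmf (p (Suc t)) (c (Suc t)) = measure_pmf.expectation (p t) (\<lambda>x. pmf (step w x) (c (Suc t)))"
      by (simp add: p_def pmf_bind)
    also have "\<dots> = (\<Sum>x\<in>{c t}. pmf (step w x) (c (Suc t)) * pmf (p t) x)"
    proof (rule integral_measure_pmf_real)
      fix x assume x: "x \<in> set_pmf (p t)" "pmf (step w x) (c (Suc t)) \<noteq> 0"
      show "x \<in> {c t}"
      proof (rule ccontr)
        assume "x \<notin> {c t}"
        hence "fst x = L+1" using IH x(1) by auto
        thus False using x(2) fixed[of x] t by (auto simp: c_def indicator_def split: if_splits)
      qed
    qed simp
    also have "\<dots> = pmf (step w (c t)) (c (Suc t)) * W t" using IH by simp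
    also have "\<dots> = W (Suc t)"
      using step W0 \<open>W (Suc t) \<le> W t\<close> by (cases "W t = 0") auto
    finally show ?case using sub by simp
  qed
  have i: "set_pmf (p L) \<subseteq> insert (c L) {c. fst c = L+1}" "pmf (p L) (c L) = W L"
    using inv[of L] by auto
  have "measure_pmf.prob (p L) {c. fst c = L+1} = measure_pmf.prob (p L) ({c. fst c = L+1} \<inter> set_pmf (p L))"
    by (rule measure_Int_set_pmf[symmetric])
  also have "{c. fst c = L+1} \<inter> set_pmf (p L) = (- {c L}) \<inter> set_pmf (p L)"
    using i(1) by (auto simp: c_def)
  also have "measure_pmf.prob (p L) \<dots> = measure_pmf.prob (p L) (- {c L})" by (rule measure_Int_set_pmf)
  also have "\<dots> = 1 - pmf (p L) (c L)"
    using measure_pmf.prob_compl[of "{c L}" "p L"] by (simp add: Compl_eq_Diff_UNIV measure_pmf_single)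
  finally show ?thesis unfolding accept_prob_machine i(2) by (simp add: p_def W_def)
qed

end

section \<open>Queries by sweeps of the head\<close>

text \<open>A register of dimension \<open>D\<close> with one ancilla qubit: \<open>a\<close> are
  the amplitudes with the ancilla clear, \<open>b\<close> those with the ancilla set.\<close>

definition emb :: "nat \<Rightarrow> rvec \<Rightarrow> rop" where
  "emb D a b i = (if i < D then a i else if i < 2*D then b (i - D) else 0)"

definition upper :: "nat \<Rightarrow> rop" where
  "upper D u i = u (D + i)"

lemma ip_zero [simp]: "ip m (\<lambda>_. 0) u = 0" "ip m u (\<lambda>_. 0) = 0"
  by (simp_all add: ip_def)

lemma emb_cong: "(\<And>l. l < D \<Longrightarrow> a l = a' l) \<Longrightarrow> (\<And>l. l < D \<Longrightarrow> b l = b' l) \<Longrightarrow> emb D a b = emb D a' b'"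
  by (auto simp: emb_def fun_eq_iff)

lemma trunc_emb [simp]: "trunc (2*D) (emb D a b) = emb D a b"
  by (auto simp: emb_def trunc_def fun_eq_iff)

lemma emb_parts: "emb D u (upper D u) = trunc (2*D) u"
  by (auto simp: emb_def trunc_def upper_def fun_eq_iff)

lemma parts_emb: "trunc D (emb D a b) = trunc D a" "trunc D (upper D (emb D a b)) = trunc D b"
  by (auto simp: emb_def trunc_def upper_def fun_eq_iff)

lemma ip_split: "ip (2*D) u v = ip D u v + ip D (upper D u) (upper D v)"
proof -
  have "ip (2*D) u v = (\<Sum>i<D+D. u i * v i)" by (simp add: ip_def mult_2)
  also have "\<dots> = (\<Sum>i<D. u i * v i) + (\<Sum>i=D..<D+D. u i * v i)"
    by (subst sum.union_disjoint[symmetric]) (auto intro: sum.cong)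
  also have "(\<Sum>i=D..<D+D. u i * v i) = (\<Sum>i<D. u (D+i) * v (D+i))"
    using sum.shift_bounds_nat_ivl[of "\<lambda>i. u i * v i" 0 D D] by (simp add: lessThan_atLeast0 add.commute)
  finally show ?thesis by (simp add: ip_def upper_def)
qed

lemma ip_emb: "ip (2*D) (emb D a b) (emb D a' b') = ip D a a' + ip D b b'"
  unfolding ip_split
  by (intro arg_cong2[where f="(+)"]) (auto simp: ip_def emb_def upper_def)

text \<open>Reduces symmetry on the doubled register to identities between the halves, so the
  operators below need only their action on \<open>emb D a b\<close>.\<close>

lemma symmetric_op_embI:
  assumes T: "\<And>a b. T (emb D a b) = emb D (A a b) (B a b)"
    and cong: "\<And>u. T (trunc (2*D) u) = T u"
    and lin: "\<And>c d a b a' b' l. l < D \<Longrightarrow> A (\<lambda>i. c * a i + d * a' i) (\<lambda>i. c * b i + d * b' i) l = c * A a b l + d * A a' b' l"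
      "\<And>c d a b a' b' l. l < D \<Longrightarrow> B (\<lambda>i. c * a i + d * a' i) (\<lambda>i. c * b i + d * b' i) l = c * B a b l + d * B a' b' l"
    and adj: "\<And>a b a' b'. ip D (A a b) a' + ip D (B a b) b' = ip D a (A a' b') + ip D b (B a' b')"
  shows "symmetric_op (2*D) T"
proof -
  have T': "T u = emb D (A u (upper D u)) (B u (upper D u))" for u
    using T[of u "upper D u"] cong[of u] by (simp add: emb_parts)
  have up: "upper D (\<lambda>i. c * u i + d * v i) = (\<lambda>i. c * upper D u i + d * upper D v i)" for c d u v
    by (auto simp: upper_def)
  show ?thesis unfolding symmetric_op_def
  proof (intro conjI allI)
    fix c d u v
    show "T (\<lambda>i. c * u i + d * v i) = (\<lambda>i. c * T u i + d * T v i)"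
      unfolding T' up by (auto simp: emb_def fun_eq_iff lin)
    show "T (trunc (2*D) u) = T u" by (rule cong)
    show "trunc (2*D) (T u) = T u" unfolding T' by simp
    have "ip (2*D) (T u) v = ip (2*D) (T u) (trunc (2*D) v)" by simp
    also have "\<dots> = ip D (A u (upper D u)) v + ip D (B u (upper D u)) (upper D v)"
      unfolding T' emb_parts[symmetric] ip_emb ..
    also have "\<dots> = ip D u (A v (upper D v)) + ip D (upper D u) (B v (upper D v))" by (rule adj)
    also have "\<dots> = ip (2*D) (trunc (2*D) u) (T v)"
      unfolding T' emb_parts[symmetric] ip_emb ..
    finally show "ip (2*D) (T u) v = ip (2*D) u (T v)" by simp
  qed
qed

lemma reflection_embI:
  assumes "symmetric_op (2*D) T" and T: "\<And>a b. T (emb D a b) = emb D (A a b) (B a b)"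
    and inv: "\<And>a b l. l < D \<Longrightarrow> A (A a b) (B a b) l = a l" "\<And>a b l. l < D \<Longrightarrow> B (A a b) (B a b) l = b l"
  shows "reflection (2*D) T"
  unfolding reflection_def
proof (intro conjI allI)
  fix u
  have "T (T u) = T (T (emb D u (upper D u)))"
    unfolding emb_parts symmetric_op_trunc(1)[OF assms(1)] ..
  also have "\<dots> = emb D u (upper D u)" unfolding T by (rule emb_cong) (simp_all add: inv)
  finally show "T (T u) = trunc (2*D) u" by (simp add: emb_parts)
qed (rule assms(1))

definition lift_op :: "nat \<Rightarrow> rop \<Rightarrow> rop" where
  "lift_op D V u = emb D (V u) (upper D u)"

definition lift_proj :: "nat \<Rightarrow> rop \<Rightarrow> rop" where
  "lift_proj D P u = emb D (P u) (\<lambda>_. 0)"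

definition swap_op :: "nat \<Rightarrow> (nat \<Rightarrow> bool) \<Rightarrow> rop" where
  "swap_op D Q u = emb D (\<lambda>l. if Q l then upper D u l else u l) (\<lambda>l. if Q l then u l else upper D u l)"

definition phase_op :: "nat \<Rightarrow> (nat \<Rightarrow> bool) \<Rightarrow> rop" where
  "phase_op D Q u = emb D u (\<lambda>l. if Q l then - upper D u l else upper D u l)"

lemma symmetric_op_apply_emb: "symmetric_op D V \<Longrightarrow> V (emb D a b) = V a"
  by (metis parts_emb(1) symmetric_op_trunc(1))

lemma upper_emb: "l < D \<Longrightarrow> upper D (emb D a b) l = b l" "l < D \<Longrightarrow> emb D a b l = a l"
  by (simp_all add: emb_def upper_def)

lemma upper_trunc: "l < D \<Longrightarrow> upper D (trunc (2*D) u) l = upper D u l" "l < D \<Longrightarrow> trunc (2*D) u l = u l"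
  by (simp_all add: trunc_def upper_def)

lemma emb_actions:
  "symmetric_op D V \<Longrightarrow> lift_op D V (emb D a b) = emb D (V a) b"
  "symmetric_op D P \<Longrightarrow> lift_proj D P (emb D a b) = emb D (P a) (\<lambda>_. 0)"
  "swap_op D Q (emb D a b) = emb D (\<lambda>l. if Q l then b l else a l) (\<lambda>l. if Q l then a l else b l)"
  "phase_op D Q (emb D a b) = emb D a (\<lambda>l. if Q l then - b l else b l)"
  unfolding lift_op_def lift_proj_def swap_op_def phase_op_def
  by (auto intro!: emb_cong simp: symmetric_op_apply_emb upper_emb)

lemma symmetric_op_apply_trunc: "symmetric_op D V \<Longrightarrow> V (trunc (2*D) u) = V u"
proof -
  assume V: "symmetric_op D V"
  have "trunc D (trunc (2*D) u) = trunc D u" by (auto simp: trunc_def fun_eq_iff)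
  thus ?thesis by (metis V symmetric_op_trunc(1))
qed

lemma reflection_lift_op:
  assumes "reflection D V"
  shows "reflection (2*D) (lift_op D V)"
proof -
  note S = reflection_symmetric[OF assms]
  have sym: "symmetric_op (2*D) (lift_op D V)"
  proof (rule symmetric_op_embI[where A="\<lambda>a b. V a" and B="\<lambda>a b. b"])
    show "lift_op D V (trunc (2*D) u) = lift_op D V u" for u
      unfolding lift_op_def by (rule emb_cong) (simp_all add: symmetric_op_apply_trunc[OF S] upper_trunc)
  qed (simp_all add: emb_actions(1)[OF S] symmetric_op_comb[OF S] symmetric_op_adj[OF S])
  show ?thesis
    by (rule reflection_embI[where A="\<lambda>a b. V a" and B="\<lambda>a b. b", OF sym])
       (simp_all add: emb_actions(1)[OF S] reflection_invol[OF assms] trunc_def)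
qed

lemma projection_lift_proj:
  assumes "projection D P"
  shows "projection (2*D) (lift_proj D P)"
proof -
  note S = projection_symmetric[OF assms]
  have PP: "P (P u) = P u" for u using assms by (simp add: projection_def)
  have sym: "symmetric_op (2*D) (lift_proj D P)"
  proof (rule symmetric_op_embI[where A="\<lambda>a b. P a" and B="\<lambda>a b _. 0"])
    show "lift_proj D P (trunc (2*D) u) = lift_proj D P u" for u
      unfolding lift_proj_def by (rule emb_cong) (simp_all add: symmetric_op_apply_trunc[OF S])
    show "ip D (P a) a' + ip D (\<lambda>_. 0) b' = ip D a (P a') + ip D b (\<lambda>_. 0)" for a b a' b'
      by (simp add: symmetric_op_adj[OF S])
  qed (simp_all add: emb_actions(2)[OF S] symmetric_op_comb[OF S])
  have "lift_proj D P (lift_proj D P u) = lift_proj D P u" for u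
    unfolding lift_proj_def[of D P u] by (simp add: emb_actions(2)[OF S] PP)
  thus ?thesis using sym by (simp add: projection_def)
qed

lemma reflection_swap_op: "reflection (2*D) (swap_op D Q)"
proof -
  let ?A = "\<lambda>a b l. if Q l then b l else a l" and ?B = "\<lambda>a b l. if Q l then a l else b l :: real"
  have sym: "symmetric_op (2*D) (swap_op D Q)"
  proof (rule symmetric_op_embI[where A="?A" and B="?B"])
    show "swap_op D Q (trunc (2*D) u) = swap_op D Q u" for u
      unfolding swap_op_def by (rule emb_cong) (simp_all add: upper_trunc)
    show "ip D (?A a b) a' + ip D (?B a b) b' = ip D a (?A a' b') + ip D b (?B a' b')" for a b a' b'
      unfolding ip_def sum.distrib[symmetric] by (intro sum.cong) auto
  qed (simp_all add: emb_actions)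
  show ?thesis
    by (rule reflection_embI[where A="?A" and B="?B", OF sym]) (simp_all add: emb_actions)
qed

lemma reflection_phase_op: "reflection (2*D) (phase_op D Q)"
proof -
  let ?A = "\<lambda>a (b::nat \<Rightarrow> real). a :: nat \<Rightarrow> real" and ?B = "\<lambda>a b l. if Q l then - b l else b l :: real"
  have sym: "symmetric_op (2*D) (phase_op D Q)"
  proof (rule symmetric_op_embI[where A="?A" and B="?B"])
    show "phase_op D Q (trunc (2*D) u) = phase_op D Q u" for u
      unfolding phase_op_def by (rule emb_cong) (simp_all add: upper_trunc)
    show "ip D (?A a b) a' + ip D (?B a b) b' = ip D a (?A a' b') + ip D b (?B a' b')" for a b a' b'
      unfolding ip_def sum.distrib[symmetric] by (intro sum.cong) auto
  qed (simp_all add: emb_actions)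
  show ?thesis
    by (rule reflection_embI[where A="?A" and B="?B", OF sym]) (simp_all add: emb_actions)
qed

lemma reflection_trunc: "reflection m (trunc m)"
  by (auto simp: reflection_def symmetric_op_def) (auto simp: trunc_def fun_eq_iff)

lemma compl_lift_proj:
  assumes "symmetric_op D P"
  shows "compl_op (2*D) (lift_proj D P) (emb D a (\<lambda>_. 0)) = emb D (compl_op D P a) (\<lambda>_. 0)"
  unfolding compl_op_def emb_actions(2)[OF assms] trunc_emb by (auto simp: emb_def fun_eq_iff trunc_def)

section \<open>The format check and one query as a round trip\<close>

fun is_bit :: "letter cell \<Rightarrow> bool" where
  "is_bit (Letter (Bit b)) = True"
| "is_bit _ = False"

definition expected :: "nat \<Rightarrow> nat \<Rightarrow> letter cell \<Rightarrow> bool" where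
  "expected n j \<sigma> \<longleftrightarrow> (if j = 0 then \<sigma> = LeftEnd
     else if j \<le> n then is_bit \<sigma> else if j \<le> 2*n then \<sigma> = Letter Hash
     else if j \<le> 3*n then is_bit \<sigma> else \<sigma> = RightEnd)"

lemma expected_padded:
  assumes "length x = n" "length y = n"
  shows "expected n j (tape (padded x n y) j)"
  using assms by (simp add: expected_def tape_padded)

lemma padded_if_expected:
  assumes n: "1 \<le> n" and e: "\<And>j. j \<le> 3*n+1 \<Longrightarrow> expected n j (tape w j)"
  shows "\<exists>x y. length x = n \<and> length y = n \<and> w = padded x n y"
proof -
  \<comment> \<open>The end marker at \<open>3*n+1\<close> and the letter at \<open>3*n\<close> fix
    the length of \<open>w\<close>; the other cells fix its form.\<close>
  have "\<not> 3*n+1 \<le> length w" using e[of "3*n+1"] by (auto simp: expected_def tape_def)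
  moreover have "3*n \<le> length w" using e[of "3*n"] n by (auto simp: expected_def tape_def split: if_splits)
  ultimately have len: "length w = 3*n" by simp
  have ex: "expected n (Suc j) (Letter (w ! j))" if "j < 3*n" for j
    using e[of "Suc j"] that len by (simp add: tape_def)
  have bit: "w ! j = Bit (w ! j = Bit True)" if "is_bit (Letter (w ! j))" for j
    using that by (cases "w ! j") auto
  define x where "x = map (\<lambda>j. w ! j = Bit True) [0..<n]"
  define y where "y = map (\<lambda>j. w ! (j + 2*n) = Bit True) [0..<n]"
  have xy: "length x = n" "length y = n" by (simp_all add: x_def y_def)
  have "w = padded x n y"
  proof (rule nth_equalityI)
    fix j assume "j < length w"
    hence j: "j < 3*n" using len by simp
    show "w ! j = padded x n y ! j"
      unfolding nth_padded[OF xy j] using ex[OF j] bit[of j] j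
      by (auto simp: expected_def x_def y_def split: if_splits)
  qed (simp add: len xy)
  thus ?thesis using xy by blast
qed

definition sign_flip :: "(nat \<Rightarrow> bool) \<Rightarrow> rop" where
  "sign_flip z \<phi> l = (if z l then - \<phi> l else \<phi> l)"

text \<open>The unnormalized state after \<open>k\<close> phase queries, in the branch where no
  measurement has accepted.\<close>

primrec query_state :: "nat \<Rightarrow> (nat \<Rightarrow> rop) \<Rightarrow> (nat \<Rightarrow> rop) \<Rightarrow>
    (nat \<Rightarrow> bool) \<Rightarrow> nat \<Rightarrow> nat \<Rightarrow> real" where
  "query_state D V P z 0 = basis 0"
| "query_state D V P z (Suc k) = compl_op D (P k) (sign_flip z (V k (query_state D V P z k)))"

text \<open>One query is one round trip of the head, in \<open>6 * n + 3\<close> steps. On the way to the right the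
  bits of \<open>x\<close> are copied to an ancilla (the index \<open>D + l\<close> carries the amplitude of \<open>l\<close> with the ancilla set)
  and the bits of \<open>y\<close> flip signs there; on the way back the bits of \<open>x\<close> are uncomputed. The operator
  \<open>V k\<close> acts at the start and the measurement \<open>P k\<close> at the end of round \<open>k\<close>, both on the left end
  marker.\<close>

definition pos :: "nat \<Rightarrow> nat \<Rightarrow> nat" where
  "pos n r = (if r \<le> 3*n+1 then r else 6*n+2 - r)"

definition sweep_mv :: "nat \<Rightarrow> nat \<Rightarrow> move" where
  "sweep_mv n r = (if r \<le> 3*n then MoveR else if r \<le> 6*n+1 then MoveL else Stay)"

definition sweep_op :: "nat \<Rightarrow> nat \<Rightarrow> (nat \<Rightarrow> nat) \<Rightarrow> nat \<Rightarrow> letter cell \<Rightarrow> rop" where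
  "sweep_op n D loc r \<sigma> = (let j = pos n r in
     if \<sigma> = Letter (Bit True) \<and> 1 \<le> j \<and> j \<le> n then swap_op D (\<lambda>l. loc l + 1 = j)
     else if \<sigma> = Letter (Bit True) \<and> 2*n < j \<and> r \<le> 3*n then phase_op D (\<lambda>l. loc l + 2*n + 1 = j)
     else trunc (2*D))"

lemma reflection_sweep_op: "reflection (2*D) (sweep_op n D loc r \<sigma>)"
  by (simp add: sweep_op_def Let_def reflection_swap_op reflection_phase_op reflection_trunc)

text \<open>\<open>S r l\<close> says that before step \<open>r\<close> the ancilla of
  \<open>l\<close> is set: the head has passed the bit of \<open>x\<close> on the way out but not
  yet on the way back. \<open>F r l\<close> says that the sign has been flipped. The phases are
  restricted to \<open>r \<le> 3*n\<close>, since a second flip on the way back would cancel the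
  first.\<close>

lemma sweep_step:
  fixes D n r :: nat and loc :: "nat \<Rightarrow> nat" and \<phi> :: rvec and x y :: "bool list"
  assumes n: "1 \<le> n" and len: "length x = n" "length y = n" and r: "1 \<le> r" "r \<le> 6*n+1"
  defines "S \<equiv> \<lambda>r l. loc l < n \<and> x ! loc l \<and> loc l + 1 < r \<and> r + loc l + 1 \<le> 6*n+2"
    and "F \<equiv> \<lambda>r l. loc l < n \<and> x ! loc l \<and> y ! loc l \<and> 2*n + 1 + loc l < r"
  defines "v \<equiv> \<lambda>r. emb D (\<lambda>l. if S r l then 0 else sign_flip (F r) \<phi> l) (\<lambda>l. if S r l then sign_flip (F r) \<phi> l else 0)"
  shows "sweep_op n D loc r (tape (padded x n y) (pos n r)) (v r) = v (Suc r)"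
proof -
  let ?j = "pos n r"
  have tape: "tape (padded x n y) ?j = (if ?j = 0 then LeftEnd else if ?j \<le> n then Letter (Bit (x ! (?j - 1)))
     else if ?j \<le> 2*n then Letter Hash else if ?j \<le> 3*n then Letter (Bit (y ! (?j - 1 - 2*n))) else RightEnd)"
    by (rule tape_padded[OF len])
  have j1: "1 \<le> ?j" using r by (auto simp: pos_def)
  consider (x1) "?j \<le> n" "x ! (?j - 1)" | (y1) "2*n < ?j" "r \<le> 3*n" "y ! (?j - 1 - 2*n)"
    | (none) "\<not> (?j \<le> n \<and> x ! (?j - 1))" "\<not> (2*n < ?j \<and> r \<le> 3*n \<and> y ! (?j - 1 - 2*n))"
    by blast
  thus ?thesis
  proof cases
    case x1
    have S: "S (Suc r) l \<longleftrightarrow> (if loc l + 1 = ?j then \<not> S r l else S r l)" for l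
    proof (cases "loc l + 1 = ?j")
      case True
      hence "loc l < n" "x ! loc l" using x1 by (auto simp: True[symmetric])
      thus ?thesis using True r n by (auto simp: S_def pos_def split: if_splits)
    next
      case False
      thus ?thesis using r x1(1) n unfolding S_def pos_def by (auto split: if_splits)
    qed
    have F: "F (Suc r) l = F r l" for l
      using r x1(1) n unfolding F_def pos_def by (auto split: if_splits)
    have op: "sweep_op n D loc r (tape (padded x n y) ?j) = swap_op D (\<lambda>l. loc l + 1 = ?j)"
      using x1 j1 unfolding tape sweep_op_def by (simp add: Let_def)
    show ?thesis unfolding op v_def emb_actions
      by (rule emb_cong) (auto simp: S F sign_flip_def)
  next
    case y1
    have jr: "?j = r" using y1 by (simp add: pos_def)
    have S: "S (Suc r) l = S r l" for l
      using y1 n unfolding jr S_def by auto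
    have F: "F (Suc r) l \<longleftrightarrow> F r l \<or> (loc l + 2*n + 1 = ?j \<and> S r l)" for l
    proof (cases "loc l + 2*n + 1 = ?j")
      case True
      have "y ! loc l" "loc l < n" using y1 True jr by (auto simp: True[symmetric])
      thus ?thesis using True y1 n jr by (auto simp: F_def S_def)
    next
      case False
      thus ?thesis unfolding jr F_def by auto
    qed
    have nF: "loc l + 2*n + 1 = ?j \<Longrightarrow> \<not> F r l" for l using jr by (auto simp: F_def)
    have op: "sweep_op n D loc r (tape (padded x n y) ?j) = phase_op D (\<lambda>l. loc l + 2*n + 1 = ?j)"
      using y1 jr unfolding tape sweep_op_def by (simp add: Let_def)
    show ?thesis unfolding op v_def emb_actions
      by (rule emb_cong) (use nF in \<open>auto simp: S F sign_flip_def\<close>)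
  next
    case none
    have S: "S (Suc r) l = S r l" for l
    proof -
      have "\<not> (loc l + 1 = ?j \<and> loc l < n \<and> x ! loc l)"
      proof
        assume a: "loc l + 1 = ?j \<and> loc l < n \<and> x ! loc l"
        hence "loc l + 1 = ?j" by blast
        hence "?j - 1 = loc l" by linarith
        thus False using a none(1) by auto
      qed
      thus ?thesis using r unfolding S_def pos_def by (auto split: if_splits)
    qed
    have F: "F (Suc r) l = F r l" for l
    proof -
      have "\<not> (loc l + 2*n + 1 = r \<and> loc l < n \<and> y ! loc l)" using none(2) by (auto simp: pos_def)
      thus ?thesis unfolding F_def by auto
    qed
    have op: "sweep_op n D loc r (tape (padded x n y) ?j) = trunc (2*D)"
      using none j1 unfolding tape sweep_op_def by (auto simp: Let_def pos_def split: if_splits)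
    show ?thesis unfolding op v_def trunc_emb by (rule emb_cong) (simp_all add: S F sign_flip_def)
  qed
qed

theorem query_machine:
  assumes n: "1 \<le> n" and D: "1 \<le> D" and K: "1 \<le> K"
    and V: "\<And>k. reflection D (V k)" and P: "\<And>k. projection D (P k)"
  obtains M :: "letter qcfa" where "wf_qcfa M"
    and "qcfa_TS M \<le> ennreal (real (K * (6*n+3)) * (log 2 (2*D) + log 2 (K * (6*n+3) + 2)))"
    and "\<And>w. (\<nexists>x y. length x = n \<and> length y = n \<and> w = padded x n y) \<Longrightarrow> qcfa_accept_prob M w = 0"
    and "\<And>x y. length x = n \<Longrightarrow> length y = n \<Longrightarrow>
       qcfa_accept_prob M (padded x n y) = 1 - (let \<psi> = query_state D V P (\<lambda>l. loc l < n \<and> x ! loc l \<and> y ! loc l) K in ip D \<psi> \<psi>)"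
proof -
  \<comment> \<open>A round makes \<open>3*n+1\<close> moves in each direction and one stationary
    step, at \<open>6*n+2\<close>, for the measurement.\<close>
  define p where "p = 6*n+3"
  have p: "0 < p" by (simp add: p_def)
  define meas where "meas s \<longleftrightarrow> s mod p = 6*n+2" for s
  define opr where "opr s \<sigma> = (if s mod p = 0 then lift_op D (V (s div p))
     else if meas s then lift_proj D (P (s div p)) else sweep_op n D loc (s mod p) \<sigma>)" for s \<sigma>
  define ok where "ok s = expected n (pos n (s mod p))" for s
  define mv where "mv s = sweep_mv n (s mod p)" for s
  interpret clocked "K * p" "2*D" meas opr ok mv
  proof
    show "reflection (2*D) (opr s \<sigma>)" if "\<not> meas s" for s \<sigma>
      using that by (simp add: opr_def reflection_lift_op V reflection_sweep_op)
    show "projection (2*D) (opr s \<sigma>)" if "meas s" for s \<sigma>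
      using that by (auto simp: opr_def meas_def projection_lift_proj P)
    show "legal_move \<sigma> (mv s)" if "ok s \<sigma>" for s \<sigma>
      using that n by (auto simp: ok_def mv_def legal_move_def sweep_mv_def expected_def pos_def split: if_splits)
  qed (use D in simp)
  have head: "head t = pos n (t mod p)" for t
  proof (induction t)
    case 0
    show ?case by (simp add: pos_def)
  next
    case (Suc t)
    have "t mod p < p" using p by simp
    hence "t mod p \<le> 6*n+2" unfolding p_def by linarith
    moreover have "Suc t mod p = (if t mod p = 6*n+2 then 0 else Suc (t mod p))"
      by (simp add: mod_Suc p_def)
    ultimately show ?case unfolding head.simps(2) Suc.IH by (auto simp: mv_def sweep_mv_def pos_def split: if_splits)
  qed
  show ?thesis
  proof (rule that[of machine])
    show "wf_qcfa machine" by (rule wf_machine)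
    show "qcfa_TS machine \<le> ennreal (real (K * (6*n+3)) * (log 2 (2*D) + log 2 (K * (6*n+3) + 2)))"
      using TS_machine by (simp add: p_def)
  next
    fix w :: "letter list" assume "\<nexists>x y. length x = n \<and> length y = n \<and> w = padded x n y"
    then obtain j where j: "j \<le> 3*n+1" "\<not> expected n j (tape w j)" using padded_if_expected[OF n] by blast
    \<comment> \<open>The first pass to the right inspects all cells up to \<open>3*n+1\<close>,
      before the first measurement at step \<open>6*n+2\<close>.\<close>
    show "qcfa_accept_prob machine w = 0"
    proof (rule reject_early)
      have "p \<le> K * p" using K by simp
      thus "j < K * p" using j(1) unfolding p_def by linarith
      show "\<not> ok j (tape w (head j))" using j by (simp add: ok_def head p_def pos_def)
      show "\<not> meas t" if "t \<le> j" for t using that j(1) n by (simp add: meas_def p_def)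
    qed
  next
    fix x y :: "bool list" assume len: "length x = n" "length y = n"
    let ?w = "padded x n y"
    define z where "z l \<longleftrightarrow> loc l < n \<and> x ! loc l \<and> y ! loc l" for l
    define \<psi> where "\<psi> = query_state D V P z"
    have "amp ?w (k * p) = emb D (\<psi> k) (\<lambda>_. 0)" if "k \<le> K" for k
    proof (induction k)
      case 0
      show ?case using D by (auto simp: \<psi>_def emb_def basis_def fun_eq_iff)
    next
      case (Suc k)
      define \<phi> where "\<phi> = V k (\<psi> k)"
      define S where "S r l \<longleftrightarrow> loc l < n \<and> x ! loc l \<and> loc l + 1 < r \<and> r + loc l + 1 \<le> 6*n+2" for r l
      define F where "F r l \<longleftrightarrow> loc l < n \<and> x ! loc l \<and> y ! loc l \<and> 2*n + 1 + loc l < r" for r l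
      define v where "v r = emb D (\<lambda>l. if S r l then 0 else sign_flip (F r) \<phi> l) (\<lambda>l. if S r l then sign_flip (F r) \<phi> l else 0)" for r
      have dm: "(k * p + r) mod p = r" "(k * p + r) div p = k" if "r < p" for r using that by simp_all
      have round: "amp ?w (k * p + r) = v r" if "1 \<le> r" "r \<le> 6*n+2" for r
        using that
      proof (induction r rule: dec_induct)
        case base
        have "\<not> meas (k * p)" using dm[of 0] p by (simp add: meas_def)
        moreover have "opr (k * p) \<sigma> = lift_op D (V k)" for \<sigma> using dm[of 0] p by (simp add: opr_def)
        ultimately have "amp ?w (k * p + 1) = lift_op D (V k) (emb D (\<psi> k) (\<lambda>_. 0))" using Suc.IH by simp
        also have "\<dots> = emb D \<phi> (\<lambda>_. 0)" by (simp add: emb_actions(1)[OF reflection_symmetric[OF V]] \<phi>_def)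
        also have "\<dots> = v 1" unfolding v_def by (rule emb_cong) (auto simp: S_def F_def sign_flip_def)
        finally show ?case .
      next
        case (step r)
        have r: "1 \<le> r" "r \<le> 6*n+1" "r < p" using step by (auto simp: p_def)
        have "\<not> meas (k * p + r)" using r(2) unfolding meas_def dm(1)[OF r(3)] by simp
        moreover from this have "opr (k * p + r) \<sigma> = sweep_op n D loc r \<sigma>" for \<sigma>
          using r unfolding opr_def dm[OF r(3)] by simp
        moreover have "head (k * p + r) = pos n r" unfolding head dm[OF r(3)] ..
        ultimately have "amp ?w (k * p + Suc r) = sweep_op n D loc r (tape ?w (pos n r)) (v r)"
          using step by simp
        also have "\<dots> = v (Suc r)"
          unfolding v_def S_def F_def by (rule sweep_step[OF n len r(1,2)])
        finally show ?case .
      qed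
      have "v (6*n+2) = emb D (sign_flip z \<phi>) (\<lambda>_. 0)"
        unfolding v_def by (rule emb_cong) (auto simp: S_def F_def sign_flip_def z_def)
      moreover have "6*n+2 < p" by (simp add: p_def)
      hence "meas (k * p + (6*n+2))" "opr (k * p + (6*n+2)) \<sigma> = lift_proj D (P k)" for \<sigma>
        unfolding meas_def opr_def using dm[of "6*n+2"] by (simp_all add: p_def)
      ultimately have "amp ?w (Suc (k * p + (6*n+2))) = compl_op (2*D) (lift_proj D (P k)) (emb D (sign_flip z \<phi>) (\<lambda>_. 0))"
        using round[of "6*n+2"] by simp
      also have "\<dots> = emb D (\<psi> (Suc k)) (\<lambda>_. 0)"
        unfolding compl_lift_proj[OF projection_symmetric[OF P]] by (simp add: \<psi>_def \<phi>_def)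
      also have "Suc (k * p + (6*n+2)) = Suc k * p" by (simp add: p_def)
      finally show ?case .
    qed
    from this[of K] have "ip (2*D) (amp ?w (K * p)) (amp ?w (K * p)) = ip D (\<psi> K) (\<psi> K)"
      by (simp add: ip_emb)
    moreover have "qcfa_accept_prob machine ?w = 1 - ip (2*D) (amp ?w (K * p)) (amp ?w (K * p))"
      by (rule accept_prob_amp) (simp add: ok_def head expected_padded[OF len])
    ultimately show "qcfa_accept_prob machine (padded x n y) = 1 - (let \<psi> = query_state D V P (\<lambda>l. loc l < n \<and> x ! loc l \<and> y ! loc l) K in ip D \<psi> \<psi>)"
      by (simp add: \<psi>_def z_def[abs_def] Let_def)
  qed
qed

section \<open>Amplitude amplification and intersection\<close>

definition proj_on :: "nat \<Rightarrow> rvec \<Rightarrow> rop" where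
  "proj_on m s u = (\<lambda>i. ip m s u * trunc m s i)"

definition refl_about :: "nat \<Rightarrow> rvec \<Rightarrow> rop" where
  "refl_about m s u = (\<lambda>i. 2 * proj_on m s u i - trunc m u i)"

lemma trunc_comb: "trunc m (\<lambda>i. a * u i + b * v i) = (\<lambda>i. a * trunc m u i + b * trunc m v i)"
  by (auto simp: trunc_def fun_eq_iff)

lemma trunc_scale [simp]: "trunc m (\<lambda>i. a * u i) = (\<lambda>i. a * trunc m u i)"
  by (auto simp: trunc_def fun_eq_iff)

lemma trunc_diff: "trunc m (\<lambda>i. u i - v i) = (\<lambda>i. trunc m u i - trunc m v i)"
  by (auto simp: trunc_def fun_eq_iff)

lemma trunc_zero [simp]: "trunc m (\<lambda>_. 0) = (\<lambda>_. 0)"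
  by (auto simp: trunc_def fun_eq_iff)

lemma symmetric_proj_on: "symmetric_op m (proj_on m s)"
  unfolding symmetric_op_def proj_on_def
  by (auto simp: fun_eq_iff algebra_simps ip_commute[of m s])

lemma projection_proj_on: "ip m s s = 1 \<Longrightarrow> projection m (proj_on m s)"
  by (simp add: projection_def symmetric_proj_on) (simp add: proj_on_def)

lemma reflection_of_projection:
  assumes "projection m P"
  shows "reflection m (\<lambda>u i. 2 * P u i - trunc m u i)"
proof -
  note S = projection_symmetric[OF assms]
  have PP: "P (P u) = P u" for u using assms by (simp add: projection_def)
  have "symmetric_op m (\<lambda>u i. 2 * P u i - trunc m u i)"
    unfolding symmetric_op_def
    by (auto simp: symmetric_op_comb[OF S] symmetric_op_trunc[OF S] trunc_comb trunc_diff
        symmetric_op_adj[OF S] fun_eq_iff algebra_simps)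
  moreover have "(\<lambda>i. 2 * P (\<lambda>i. 2 * P u i - trunc m u i) i - trunc m (\<lambda>i. 2 * P u i - trunc m u i) i) = trunc m u" for u
    by (simp add: symmetric_op_diff[OF S] symmetric_op_scale[OF S] symmetric_op_trunc[OF S] PP trunc_diff)
  ultimately show ?thesis by (simp add: reflection_def)
qed

lemma reflection_refl_about: "ip m s s = 1 \<Longrightarrow> reflection m (refl_about m s)"
  using reflection_of_projection[OF projection_proj_on] by (simp add: refl_about_def[abs_def])

lemma refl_about_self: "ip m s s = 1 \<Longrightarrow> refl_about m s s = trunc m s"
  by (auto simp: refl_about_def proj_on_def)

text \<open>Householder reflection: the reflection along \<open>basis 0 - s\<close> exchanges \<open>basis 0\<close> and \<open>s\<close>.\<close>

lemma ex_preparation: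
  assumes m: "1 \<le> m" and s: "ip m s s = 1"
  shows "\<exists>H. reflection m H \<and> H (basis 0) = trunc m s"
proof -
  have bb: "ip m (basis 0) (basis 0) = 1" using m ip_basis[of 0 m "basis 0"] by (simp add: basis_def)
  show ?thesis
  proof (cases "ip m s (basis 0) = 1")
    case True
    have "ip m (\<lambda>i. basis 0 i - s i) (\<lambda>i. basis 0 i - s i) = 0"
      using True s bb by (simp add: ip_commute[of m "basis 0" s])
    hence "trunc m (\<lambda>i. basis 0 i - s i) = (\<lambda>_. 0)" unfolding ip_eq_0_iff .
    hence "trunc m (basis 0) = trunc m s" by (auto simp: trunc_diff fun_eq_iff)
    thus ?thesis using reflection_trunc by blast
  next
    case False
    define w where "w = (\<lambda>i. basis 0 i - s i)"
    define c where "c = ip m s (basis 0)"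
    have ww: "ip m w w = 2 * (1 - c)" "ip m w (basis 0) = 1 - c"
      using s bb by (simp_all add: w_def c_def ip_commute[of m "basis 0" s])
    have c: "c \<noteq> 1" using False by (simp add: c_def)
    have pos: "ip m w w > 0" using c ww(1) ip_nonneg[of m w] by (cases "ip m w w = 0") auto
    define t where "t = (\<lambda>i. w i / sqrt (ip m w w))"
    have t: "t = (\<lambda>i. (1 / sqrt (ip m w w)) * w i)" by (simp add: t_def)
    have sq: "1 / sqrt x * u * (1 / sqrt x * v) = u * v / x" if "0 < x" for x u v :: real
      using that by (simp add: field_simps)
    have tt: "ip m t t = 1" unfolding t ip_linear using sq[OF pos, of 1 "ip m w w"] pos by simp
    \<comment> \<open>The reflection along \<open>t\<close> is the negative of the reflection about
      \<open>t\<close>.\<close>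
    define H where "H = (\<lambda>u. refl_about m t (\<lambda>i. (-1) * u i))"
    have R: "reflection m (refl_about m t)" by (rule reflection_refl_about[OF tt])
    note S = reflection_symmetric[OF R]
    have H: "H u = (\<lambda>i. (-1) * refl_about m t u i)" for u unfolding H_def by (rule symmetric_op_scale[OF S])
    have "symmetric_op m H" unfolding symmetric_op_def H
    proof (intro conjI allI)
      fix a b u v
      show "(\<lambda>i. (-1) * refl_about m t (\<lambda>i. a * u i + b * v i) i) =
         (\<lambda>i. a * ((-1) * refl_about m t u i) + b * ((-1) * refl_about m t v i))"
        unfolding symmetric_op_comb[OF S] by (simp add: algebra_simps)
      show "(\<lambda>i. (-1) * refl_about m t (trunc m u) i) = (\<lambda>i. (-1) * refl_about m t u i)"
        unfolding symmetric_op_trunc(1)[OF S] ..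
      show "trunc m (\<lambda>i. (-1) * refl_about m t u i) = (\<lambda>i. (-1) * refl_about m t u i)"
        unfolding trunc_scale symmetric_op_trunc(2)[OF S] ..
      show "ip m (\<lambda>i. (-1) * refl_about m t u i) v = ip m u (\<lambda>i. (-1) * refl_about m t v i)"
        unfolding ip_linear symmetric_op_adj[OF S] ..
    qed
    moreover have "H (H u) = trunc m u" for u
      unfolding H symmetric_op_scale[OF S] reflection_invol[OF R] by simp
    ultimately have "reflection m H" by (simp add: reflection_def)
    moreover have "H (basis 0) = trunc m s"
    proof
      fix i
      have "ip m t (basis 0) * t i = ip m w (basis 0) * w i / ip m w w"
        unfolding t ip_linear by (rule sq[OF pos])
      also have "\<dots> = w i / 2" unfolding ww using c by (simp add: field_simps)
      finally show "H (basis 0) i = trunc m s i"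
        unfolding H refl_about_def proj_on_def by (auto simp: trunc_def w_def)
    qed
    ultimately show ?thesis by blast
  qed
qed

lemma symmetric_sign_flip: "symmetric_op m (\<lambda>u. trunc m (sign_flip z u))"
proof -
  have "ip m (sign_flip z u) v = ip m u (sign_flip z v)" for u v
    unfolding ip_def by (intro sum.cong) (auto simp: sign_flip_def)
  thus ?thesis unfolding symmetric_op_def by (auto simp: fun_eq_iff trunc_def sign_flip_def)
qed

lemma reflection_sign_flip: "reflection m (\<lambda>u. trunc m (sign_flip z u))"
  unfolding reflection_def using symmetric_sign_flip by (auto simp: fun_eq_iff trunc_def sign_flip_def)

text \<open>A measurement whose first projector is 0 never accepts and leaves the state alone; it
  fills the rounds that need no measurement.\<close>

lemma projection_zero: "projection m (\<lambda>u i. 0)"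
  by (auto simp: projection_def symmetric_op_def ip_def trunc_def)

lemma compl_zero: "compl_op m (\<lambda>u i. 0) u = trunc m u"
  by (simp add: compl_op_def)

lemma compl_compl_proj_on: "compl_op m (compl_op m (proj_on m s)) u = proj_on m s u"
  unfolding compl_op_def trunc_diff by (simp add: symmetric_op_trunc(2)[OF symmetric_proj_on])

text \<open>The amplitude \<open>p r\<close> of the initial state \<open>s\<close> after \<open>2 ^ r\<close> Grover iterations \<open>B\<close> satisfies the
  doubling formula of the cosine.\<close>

context
  fixes m :: nat and s :: rvec and S R B
  assumes s: "ip m s s = 1" "trunc m s = s" and S: "reflection m S"
  defines "R \<equiv> refl_about m s" and "B \<equiv> \<lambda>u. S (R u)"
begin

text \<open>Half of the iterations are moved to the left side of the inner product, where they run
  in reverse. As R fixes \<open>s\<close>, they produce \<open>R ((B ^^ k) s)\<close>, and R is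
  twice the projection on \<open>s\<close> minus the identity.\<close>

lemma Grover_doubling: "ip m s ((B ^^ (2 * k)) s) = 2 * (ip m s ((B ^^ k) s))\<^sup>2 - 1"
proof -
  have R: "reflection m R" unfolding R_def by (rule reflection_refl_about[OF s(1)])
  note SS = reflection_symmetric[OF S] and RS = reflection_symmetric[OF R]
  have adj: "ip m u ((B ^^ k) v) = ip m (((\<lambda>u. R (S u)) ^^ k) u) v" for u v k
  proof (induction k arbitrary: u)
    case (Suc k)
    have "ip m u ((B ^^ Suc k) v) = ip m (R (S u)) ((B ^^ k) v)"
      by (simp add: B_def symmetric_op_adj[OF SS] symmetric_op_adj[OF RS])
    also have "\<dots> = ip m (((\<lambda>u. R (S u)) ^^ k) (R (S u))) v" by (rule Suc.IH)
    also have "((\<lambda>u. R (S u)) ^^ k) (R (S u)) = ((\<lambda>u. R (S u)) ^^ Suc k) u"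
      using funpow_swap1[of "\<lambda>u. R (S u)" k u] by simp
    finally show ?case .
  qed simp
  have tB: "trunc m ((B ^^ k) s) = (B ^^ k) s" for k
    by (cases k) (simp_all add: s B_def symmetric_op_trunc[OF SS])
  have rev: "((\<lambda>u. R (S u)) ^^ k) s = R ((B ^^ k) s)"
  proof (induction k)
    case 0
    show ?case by (simp add: R_def refl_about_self s)
  qed (simp add: B_def)
  have unit: "ip m ((B ^^ k) s) ((B ^^ k) s) = 1"
    by (induction k) (simp_all add: s B_def reflection_ip[OF S] reflection_ip[OF R])
  have "ip m s ((B ^^ (2 * k)) s) = ip m s ((B ^^ k) ((B ^^ k) s))"
    by (simp add: mult_2 funpow_add)
  also have "\<dots> = ip m (R ((B ^^ k) s)) ((B ^^ k) s)" unfolding adj rev ..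
  also have "\<dots> = 2 * (ip m s ((B ^^ k) s))\<^sup>2 - 1"
    using unit by (simp add: R_def refl_about_def proj_on_def power2_eq_square)
  finally show ?thesis .
qed

lemma Grover_survival:
  defines "p \<equiv> \<lambda>r. ip m s ((B ^^ (2 ^ r)) s)"
  shows "(\<Prod>r<k. p r)\<^sup>2 * 4 ^ k * (1 - (p 0)\<^sup>2) \<le> 1"
proof -
  \<comment> \<open>With \<open>p r = cos (2^r * t)\<close> this is the square of the identity
    \<open>2^k * sin t * (cos t * cos (2*t) * ...) = sin (2^k * t)\<close>.\<close>
  have "(\<Prod>r<k. p r)\<^sup>2 * 4 ^ k * (1 - (p 0)\<^sup>2) = 1 - (p k)\<^sup>2"
  proof (induction k)
    case (Suc k)
    have "p (Suc k) = 2 * (p k)\<^sup>2 - 1" unfolding p_def using Grover_doubling[of "2 ^ k"] by simp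
    hence "1 - (p (Suc k))\<^sup>2 = 1 - (2 * (p k)\<^sup>2 - 1)\<^sup>2" by simp
    also have "\<dots> = 4 * (p k)\<^sup>2 * (1 - (p k)\<^sup>2)" by (simp add: power2_eq_square algebra_simps)
    finally have "1 - (p (Suc k))\<^sup>2 = 4 * (p k)\<^sup>2 * (1 - (p k)\<^sup>2)" .
    also have "\<dots> = 4 * (p k)\<^sup>2 * ((\<Prod>r<k. p r)\<^sup>2 * 4 ^ k * (1 - (p 0)\<^sup>2))" using Suc by simp
    also have "\<dots> = (\<Prod>r<Suc k. p r)\<^sup>2 * 4 ^ Suc k * (1 - (p 0)\<^sup>2)" by (simp add: power_mult_distrib)
    finally show ?case by simp
  qed simp
  thus ?thesis by simp
qed

end

text \<open>Stage \<open>r\<close> consists of \<open>2 ^ r\<close> rounds, and ends by a measurement that accepts unless the register is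
  back in the initial state \<open>s\<close>. In the latter case stage \<open>r + 1\<close> starts from \<open>s\<close> again.\<close>

definition Grover_V :: "rop \<Rightarrow> nat \<Rightarrow> rvec \<Rightarrow> nat \<Rightarrow> rop" where
  "Grover_V H m s k = (if k = 0 then H else refl_about m s)"

text \<open>Stage \<open>r\<close> occupies the rounds from \<open>2^r - 1\<close> to
  \<open>2^(r+1) - 2\<close>, so the test singles out the last round of a stage. Acceptance is the
  first outcome, hence the complement of the projection on \<open>s\<close>.\<close>

definition Grover_P :: "nat \<Rightarrow> rvec \<Rightarrow> nat \<Rightarrow> rop" where
  "Grover_P m s k = (if \<exists>r. k + 2 = 2 ^ Suc r then compl_op m (proj_on m s) else (\<lambda>u i. 0))"

lemma Grover_state:
  fixes s :: rvec and m :: nat and H and z :: "nat \<Rightarrow> bool"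
  assumes s: "ip m s s = 1" "trunc m s = s" and H: "H (basis 0) = s"
  defines "B \<equiv> \<lambda>u. trunc m (sign_flip z (refl_about m s u))"
  defines "p \<equiv> \<lambda>r. ip m s ((B ^^ (2 ^ r)) s)"
  defines "\<psi> \<equiv> query_state m (Grover_V H m s) (Grover_P m s) z"
  shows "Grover_V H m s (2 ^ r - 1) (\<psi> (2 ^ r - 1)) = (\<lambda>i. (\<Prod>r'<r. p r') * s i)" (is "?A r")
    and "\<psi> (2 ^ Suc r - 1) = (\<lambda>i. (\<Prod>r'<Suc r. p r') * s i)"
proof -
  let ?R = "refl_about m s"
  note RS = reflection_symmetric[OF reflection_refl_about[OF s(1)]]
  have Rs: "?R s = s" using refl_about_self[OF s(1)] s by simp
  have V: "trunc m (Grover_V H m s k u) = Grover_V H m s k u" if "k \<noteq> 0" for k u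
    using that symmetric_op_trunc(2)[OF RS] by (simp add: Grover_V_def)
  have sf: "trunc m (sign_flip z (\<lambda>i. c * u i)) = (\<lambda>i. c * trunc m (sign_flip z u) i)" for c u
    by (auto simp: trunc_def sign_flip_def fun_eq_iff)
  have B: "symmetric_op m (\<lambda>u. trunc m (sign_flip z u))" by (rule symmetric_sign_flip)
  have step: "\<psi> (2 ^ Suc r - 1) = (\<lambda>i. (\<Prod>r'<Suc r. p r') * s i)"
    if A: "?A r" for r
  proof -
    let ?c = "\<Prod>r'<r. p r'"
    \<comment> \<open>\<open>E = 2^r - 1\<close> is both the first round of the stage and the number
      of rounds that follow it in the stage.\<close>
    obtain E where E: "(2::nat) ^ r = Suc E"
      by (metis not0_implies_Suc power_eq_0_iff zero_neq_numeral)
    \<comment> \<open>The first reflection of a stage acts trivially because it fixes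
      \<open>s\<close>; in round 0 the preparation \<open>H\<close> stands in its place.\<close>
    have inside: "Grover_V H m s (E + j) (\<psi> (E + j)) = (\<lambda>i. ?c * ?R ((B ^^ j) s) i)" if "j \<le> E" for j
      using that
    proof (induction j)
      case 0
      show ?case using A Rs E by simp
    next
      case (Suc j)
      have "\<not> (\<exists>r'. E + j + 2 = 2 ^ Suc r')"
      proof
        assume "\<exists>r'. E + j + 2 = (2::nat) ^ Suc r'"
        then obtain r' where e: "E + j + 2 = (2::nat) ^ Suc r'" by blast
        have "(2::nat) ^ r < 2 ^ Suc r'" using e E by linarith
        moreover have "(2::nat) ^ Suc r' < 2 ^ Suc r"
          unfolding e[symmetric] power_Suc[of 2 r] E using Suc.prems by simp
        ultimately have "r < Suc r'" "Suc r' < Suc r"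
          by (metis one_less_numeral_iff power_strict_increasing_iff semiring_norm(76))+
        thus False by simp
      qed
      hence P: "Grover_P m s (E + j) = (\<lambda>u i. 0)" by (simp add: Grover_P_def)
      have "\<psi> (E + Suc j) = trunc m (sign_flip z (Grover_V H m s (E + j) (\<psi> (E + j))))"
        unfolding \<psi>_def by (simp add: P compl_zero)
      also have "\<dots> = (\<lambda>i. ?c * (B ^^ Suc j) s i)" using Suc by (simp add: sf B_def)
      finally show ?case by (simp add: Grover_V_def symmetric_op_scale[OF RS])
    qed
    have K: "Suc (E + E) = 2 ^ Suc r - 1" by (simp add: E)
    have "E + E + 2 = 2 ^ Suc r" by (simp add: E)
    hence P: "Grover_P m s (E + E) = compl_op m (proj_on m s)" unfolding Grover_P_def by (metis (full_types))
    have proj: "proj_on m s u = proj_on m s (trunc m u)" for u by (simp add: proj_on_def)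
    have BS: "(B ^^ (2 ^ r)) s = trunc m (sign_flip z (?R ((B ^^ E) s)))" unfolding E by (simp add: B_def)
    have "\<psi> (Suc (E + E)) = proj_on m s (sign_flip z (Grover_V H m s (E + E) (\<psi> (E + E))))"
      unfolding \<psi>_def by (simp add: P compl_compl_proj_on)
    also have "\<dots> = proj_on m s (trunc m (sign_flip z (\<lambda>i. ?c * ?R ((B ^^ E) s) i)))"
      unfolding inside[OF order.refl] by (rule proj)
    also have "\<dots> = proj_on m s (\<lambda>i. ?c * (B ^^ (2 ^ r)) s i)" unfolding sf BS ..
    also have "\<dots> = (\<lambda>i. (\<Prod>r'<Suc r. p r') * s i)"
      unfolding proj_on_def ip_linear by (simp add: s p_def mult_ac)
    finally show ?thesis unfolding K .
  qed
  have A: "?A r" for r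
  proof (induction r)
    case 0
    show ?case by (simp add: \<psi>_def Grover_V_def H)
  next
    case (Suc r)
    have "(2::nat) ^ Suc r - 1 \<noteq> 0" by (cases "(2::nat) ^ r") auto
    thus ?case unfolding step[OF Suc] by (simp add: Grover_V_def symmetric_op_scale[OF RS] Rs)
  qed
  show "?A r" by (rule A)
  show "\<psi> (2 ^ Suc r - 1) = (\<lambda>i. (\<Prod>r'<Suc r. p r') * s i)" by (rule step[OF A])
qed

section \<open>Exact computation of the iterated NE\<close>

text \<open>Queries alternate with the operators of the list, beginning and ending with a query; a
  list of length \<open>k - 1\<close> makes \<open>k\<close> queries.\<close>

primrec algo :: "nat \<Rightarrow> (nat \<Rightarrow> bool) \<Rightarrow> rop list \<Rightarrow> rop" where
  "algo m z [] = (\<lambda>u. trunc m (sign_flip z u))"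
| "algo m z (V # Vs) = (\<lambda>u. algo m z Vs (V (trunc m (sign_flip z u))))"

lemma algo_append: "algo m z (Vs @ V # Ws) u = algo m z Ws (V (algo m z Vs u))"
  by (induction Vs arbitrary: u) simp_all

lemma algo_trunc:
  assumes "\<forall>V\<in>set Vs. symmetric_op m V"
  shows "algo m z Vs (trunc m u) = algo m z Vs u"
proof -
  have "trunc m (sign_flip z (trunc m u)) = trunc m (sign_flip z u)"
    by (auto simp: trunc_def sign_flip_def fun_eq_iff)
  thus ?thesis by (cases Vs) simp_all
qed

text \<open>A palindrome of involutions is an involution. This lets an algorithm serve as its own
  inverse at the next level.\<close>

lemma reflection_conj:
  assumes A: "reflection m A" and R: "reflection m R"
  shows "reflection m (\<lambda>u. A (R (A u)))"
proof -
  note AS = reflection_symmetric[OF A] and RS = reflection_symmetric[OF R]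
  have "symmetric_op m (\<lambda>u. A (R (A u)))" unfolding symmetric_op_def
    by (auto simp: symmetric_op_comb[OF AS] symmetric_op_comb[OF RS] symmetric_op_trunc[OF AS] symmetric_op_adj[OF AS] symmetric_op_adj[OF RS])
  moreover have "A (R (A (A (R (A u))))) = trunc m u" for u
    by (simp add: reflection_invol[OF A] reflection_invol[OF R] symmetric_op_trunc[OF AS] symmetric_op_trunc[OF RS])
  ultimately show ?thesis by (simp add: reflection_def)
qed

section \<open>Three copies of an algorithm side by side\<close>

definition block :: "nat \<Rightarrow> nat \<Rightarrow> rop" where
  "block D b u i = u (b * D + i)"

definition glue :: "nat \<Rightarrow> (nat \<Rightarrow> nat \<Rightarrow> real) \<Rightarrow> real \<Rightarrow> nat \<Rightarrow> real" where
  "glue D f e l = (if l < 3 * D then f (l div D) (l mod D) else if l = 3 * D then e else 0)"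

lemma block_index: "b < 3 \<Longrightarrow> i < D \<Longrightarrow> b * D + i < 3 * (D::nat)"
proof -
  assume "b < 3" "i < D"
  hence "(b + 1) * D \<le> 3 * D" by (intro mult_right_mono) auto
  thus ?thesis using \<open>i < D\<close> unfolding add_mult_distrib by linarith
qed

lemma block_glue: "b < 3 \<Longrightarrow> i < D \<Longrightarrow> block D b (glue D f e) i = f b i"
  using block_index[of b i D] by (simp add: block_def glue_def)

lemma trunc_block_glue: "b < 3 \<Longrightarrow> trunc D (block D b (glue D f e)) = trunc D (f b)"
  by (auto simp: trunc_def block_glue fun_eq_iff)

lemma glue_last [simp]: "glue D f e (3 * D) = e"
  by (simp add: glue_def)

lemma glue_cong:
  assumes "\<And>b i. b < 3 \<Longrightarrow> i < D \<Longrightarrow> f b i = g b i" "e = e'"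
  shows "glue D f e = glue D g e'"
proof
  fix l
  show "glue D f e l = glue D g e' l"
  proof (cases "l < 3 * D")
    case True
    hence "l div D < 3" "l mod D < D" by (auto simp: less_mult_imp_div_less intro: mod_less_divisor)
    thus ?thesis using assms by (simp add: glue_def)
  qed (simp add: glue_def assms)
qed

lemma glue_blocks: "glue D (\<lambda>b. block D b u) (u (3 * D)) = trunc (3 * D + 1) u"
  by (auto simp: glue_def block_def trunc_def fun_eq_iff less_Suc_eq)

lemma trunc_glue [simp]: "trunc (Suc (3 * D)) (glue D f e) = glue D f e"
  by (auto simp: glue_def trunc_def fun_eq_iff)

lemma trunc_block_trunc: "b < 3 \<Longrightarrow> trunc D (block D b (trunc (Suc (3 * D)) u)) = trunc D (block D b u)"
  using block_index[of b _ D] by (auto simp: trunc_def block_def fun_eq_iff less_Suc_eq)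

lemma ip_blocks:
  "ip (Suc (3 * D)) u v = ip D (block D 0 u) (block D 0 v) + ip D (block D 1 u) (block D 1 v)
     + ip D (block D 2 u) (block D 2 v) + u (3 * D) * v (3 * D)"
proof -
  have "(\<Sum>l<3 * D. u l * v l) = (\<Sum>b<3. \<Sum>l = b * D..<b * D + D. u l * v l)"
    by (rule sum.nat_group[symmetric])
  also have "\<dots> = (\<Sum>b<3. \<Sum>i<D. u (b * D + i) * v (b * D + i))"
  proof (rule sum.cong)
    fix b
    show "(\<Sum>l = b * D..<b * D + D. u l * v l) = (\<Sum>i<D. u (b * D + i) * v (b * D + i))"
      using sum.shift_bounds_nat_ivl[of "\<lambda>i. u i * v i" 0 "b * D" D] by (simp add: lessThan_atLeast0 add.commute)
  qed simp
  finally show ?thesis by (simp add: ip_def block_def numeral_3_eq_3 lessThan_Suc mult_2)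
qed

lemma ip_eq_if_trunc_eq: "trunc m u = trunc m u' \<Longrightarrow> ip m u v = ip m u' v"
  "trunc m u = trunc m u' \<Longrightarrow> ip m v u = ip m v u'"
  by (metis ip_trunc(1)) (metis ip_trunc(2))

lemma ip_block_glue: "b < 3 \<Longrightarrow> ip D (block D b (glue D f e)) v = ip D (f b) v"
  "b < 3 \<Longrightarrow> ip D v (block D b (glue D f e)) = ip D v (f b)"
  by (auto intro: ip_eq_if_trunc_eq trunc_block_glue)

lemma block_comb: "block D b (\<lambda>i. c * u i + d * v i) = (\<lambda>i. c * block D b u i + d * block D b v i)"
  by (auto simp: block_def)

lemma reflection_glueI:
  fixes G :: "nat \<Rightarrow> rop"
  assumes T: "\<And>u. T u = glue D (\<lambda>b. G b u) (u (3 * D))"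
    and tr: "\<And>b u i. b < 3 \<Longrightarrow> i < D \<Longrightarrow> G b (trunc (Suc (3 * D)) u) i = G b u i"
    and lin: "\<And>b c d u v i. b < 3 \<Longrightarrow> i < D \<Longrightarrow> G b (\<lambda>i. c * u i + d * v i) i = c * G b u i + d * G b v i"
    and adj: "\<And>u v. ip D (G 0 u) (block D 0 v) + ip D (G 1 u) (block D 1 v) + ip D (G 2 u) (block D 2 v)
       = ip D (block D 0 u) (G 0 v) + ip D (block D 1 u) (G 1 v) + ip D (block D 2 u) (G 2 v)"
    and inv: "\<And>b u i. b < 3 \<Longrightarrow> i < D \<Longrightarrow> G b (T u) i = block D b u i"
  shows "reflection (Suc (3 * D)) T"
  unfolding reflection_def symmetric_op_def
proof (intro conjI allI)
  fix c d u v
  have gl: "glue D (\<lambda>b i. c * f b i + d * g b i) (c * e + d * e') = (\<lambda>i. c * glue D f e i + d * glue D g e' i)" for f g e e'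
    by (auto simp: glue_def fun_eq_iff)
  have "T (\<lambda>i. c * u i + d * v i) = glue D (\<lambda>b i. c * G b u i + d * G b v i) (c * u (3 * D) + d * v (3 * D))"
    unfolding T by (rule glue_cong) (simp_all add: lin)
  thus "T (\<lambda>i. c * u i + d * v i) = (\<lambda>i. c * T u i + d * T v i)" unfolding T gl .
  show "T (trunc (Suc (3 * D)) u) = T u" unfolding T by (rule glue_cong) (simp_all add: tr, simp add: trunc_def)
  show "trunc (Suc (3 * D)) (T u) = T u" unfolding T by simp
  show "ip (Suc (3 * D)) (T u) v = ip (Suc (3 * D)) u (T v)"
    unfolding T ip_blocks using adj[of u v] by (simp add: ip_block_glue)
  have "T (T u) = glue D (\<lambda>b. G b (T u)) (T u (3 * D))" by (rule T)
  also have "\<dots> = glue D (\<lambda>b. block D b u) (u (3 * D))"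
    by (rule glue_cong) (simp_all add: inv, simp add: T)
  finally show "T (T u) = trunc (Suc (3 * D)) u" unfolding glue_blocks by simp
qed

definition lift3 :: "nat \<Rightarrow> (nat \<Rightarrow> rop) \<Rightarrow> rop" where
  "lift3 D A u = glue D (\<lambda>b. A b (block D b u)) (u (3 * D))"

lemma symmetric_op_eq_if_trunc_eq: "symmetric_op m T \<Longrightarrow> trunc m u = trunc m v \<Longrightarrow> T u = T v"
  by (metis symmetric_op_trunc(1))

lemma reflection_lift3:
  assumes A: "\<And>b. b < 3 \<Longrightarrow> reflection D (A b)"
  shows "reflection (Suc (3 * D)) (lift3 D A)"
proof (rule reflection_glueI[where G="\<lambda>b u. A b (block D b u)"])
  note S = reflection_symmetric[OF A]
  show "A b (block D b (trunc (Suc (3 * D)) u)) i = A b (block D b u) i" if "b < 3" for b u i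
    using symmetric_op_eq_if_trunc_eq[OF S[OF that] trunc_block_trunc[OF that]] by simp
  show "A b (block D b (\<lambda>i. c * u i + d * v i)) i = c * A b (block D b u) i + d * A b (block D b v) i" if "b < 3" for b c d u v i
    unfolding block_comb symmetric_op_comb[OF S[OF that]] ..
  show "A b (block D b (lift3 D A u)) i = block D b u i" if "b < 3" "i < D" for b u i
  proof -
    have "A b (block D b (lift3 D A u)) = A b (A b (block D b u))"
      unfolding lift3_def using that(1) by (intro symmetric_op_eq_if_trunc_eq[OF S[OF that(1)]] trunc_block_glue)
    thus ?thesis using that by (simp add: reflection_invol[OF A] trunc_def)
  qed
qed (simp_all add: lift3_def symmetric_op_adj[OF reflection_symmetric[OF A]])

text \<open>A query of the large register acts on each block as a query to the third of the input
  belonging to that block. Three subproblems in superposition thus cost no more queries than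
  one.\<close>

lemma algo_lift3:
  assumes V: "\<forall>V\<in>set Vs. symmetric_op D V"
    and z: "\<And>b i. b < 3 \<Longrightarrow> i < D \<Longrightarrow> z (b * D + i) = y b i" "\<not> z (3 * D)"
  shows "algo (Suc (3 * D)) z (map (\<lambda>V. lift3 D (\<lambda>_. V)) Vs) u = lift3 D (\<lambda>b. algo D (y b) Vs) u"
  using V
proof (induction Vs arbitrary: u)
  have sf: "trunc (Suc (3 * D)) (sign_flip z u) = glue D (\<lambda>b. trunc D (sign_flip (y b) (block D b u))) (u (3 * D))" for u
    unfolding Suc_eq_plus1 glue_blocks[symmetric]
    by (rule glue_cong) (simp_all add: sign_flip_def trunc_def block_def z)
  {
    case Nil
    show ?case by (simp add: sf lift3_def)
  next
    case (Cons V Vs)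
    have VS: "symmetric_op D V" "\<forall>V\<in>set Vs. symmetric_op D V" using Cons.prems by auto
    have "algo (Suc (3 * D)) z (map (\<lambda>V. lift3 D (\<lambda>_. V)) (V # Vs)) u
       = lift3 D (\<lambda>b. algo D (y b) Vs) (lift3 D (\<lambda>_. V) (trunc (Suc (3 * D)) (sign_flip z u)))"
      by (simp add: Cons.IH[OF VS(2)])
    also have "\<dots> = lift3 D (\<lambda>b. algo D (y b) (V # Vs)) u"
      unfolding lift3_def[of D "\<lambda>b. algo D (y b) Vs"] lift3_def[of D "\<lambda>b. algo D (y b) (V # Vs)"]
    proof (rule glue_cong)
      fix b i :: nat assume b: "b < 3"
      let ?v = "trunc D (sign_flip (y b) (block D b u))"
      have "trunc D (block D b (lift3 D (\<lambda>_. V) (trunc (Suc (3 * D)) (sign_flip z u))))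
          = trunc D (V (block D b (trunc (Suc (3 * D)) (sign_flip z u))))"
        unfolding lift3_def by (rule trunc_block_glue[OF b])
      also have "V (block D b (trunc (Suc (3 * D)) (sign_flip z u))) = V ?v"
        unfolding sf by (rule symmetric_op_eq_if_trunc_eq[OF VS(1) trunc_block_glue[OF b]])
      finally have "algo D (y b) Vs (block D b (lift3 D (\<lambda>_. V) (trunc (Suc (3 * D)) (sign_flip z u)))) = algo D (y b) Vs (V ?v)"
        by (metis algo_trunc[OF VS(2)])
      thus "algo D (y b) Vs (block D b (lift3 D (\<lambda>_. V) (trunc (Suc (3 * D)) (sign_flip z u)))) i = algo D (y b) (V # Vs) (block D b u) i"
        by simp
    qed (simp add: lift3_def trunc_def sign_flip_def z)
    finally show ?case .
  }
qed

text \<open>On the span of the three copies of \<open>s\<close>: the reflection about the vector with equal coordinates.\<close>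

definition mix :: "nat \<Rightarrow> rvec \<Rightarrow> rvec \<Rightarrow> real" where
  "mix D s u = (ip D (block D 0 u) s + ip D (block D 1 u) s + ip D (block D 2 u) s) / 3"

definition mix_op :: "nat \<Rightarrow> rvec \<Rightarrow> rop" where
  "mix_op D s u = glue D (\<lambda>b i. block D b u i - 2 * (ip D (block D b u) s - mix D s u) * s i) (u (3 * D))"

lemma reflection_mix_op:
  assumes s: "ip D s s = 1"
  shows "reflection (Suc (3 * D)) (mix_op D s)"
proof (rule reflection_glueI[where G="\<lambda>b u i. block D b u i - 2 * (ip D (block D b u) s - mix D s u) * s i"])
  have ipt: "ip D (block D b (trunc (Suc (3 * D)) u)) s = ip D (block D b u) s" if "b < 3" for b u
    by (rule ip_eq_if_trunc_eq(1)[OF trunc_block_trunc[OF that]])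
  have mixt: "mix D s (trunc (Suc (3 * D)) u) = mix D s u" for u
    by (simp add: mix_def ipt)
  show "block D b (trunc (Suc (3 * D)) u) i - 2 * (ip D (block D b (trunc (Suc (3 * D)) u)) s - mix D s (trunc (Suc (3 * D)) u)) * s i
     = block D b u i - 2 * (ip D (block D b u) s - mix D s u) * s i" if "b < 3" "i < D" for b u i
    using that block_index[OF that] by (simp add: ipt mixt) (simp add: block_def trunc_def)
  have mixl: "mix D s (\<lambda>i. c * u i + d * v i) = c * mix D s u + d * mix D s v" for c d u v
    by (simp add: mix_def block_comb field_simps)
  show "block D b (\<lambda>i. c * u i + d * v i) i - 2 * (ip D (block D b (\<lambda>i. c * u i + d * v i)) s - mix D s (\<lambda>i. c * u i + d * v i)) * s i
     = c * (block D b u i - 2 * (ip D (block D b u) s - mix D s u) * s i) + d * (block D b v i - 2 * (ip D (block D b v) s - mix D s v) * s i)" for b c d u v i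
    by (simp add: mixl block_comb algebra_simps)
  have G1: "ip D (\<lambda>i. block D b u i - 2 * (ip D (block D b u) s - mix D s u) * s i) v
     = ip D (block D b u) v - 2 * (ip D (block D b u) s - mix D s u) * ip D v s" for b u v
    by (simp add: ip_commute[of D s v])
  have G2: "ip D v (\<lambda>i. block D b u i - 2 * (ip D (block D b u) s - mix D s u) * s i)
     = ip D v (block D b u) - 2 * (ip D (block D b u) s - mix D s u) * ip D v s" for b u v
    by simp
  show "ip D (\<lambda>i. block D 0 u i - 2 * (ip D (block D 0 u) s - mix D s u) * s i) (block D 0 v)
      + ip D (\<lambda>i. block D 1 u i - 2 * (ip D (block D 1 u) s - mix D s u) * s i) (block D 1 v)
      + ip D (\<lambda>i. block D 2 u i - 2 * (ip D (block D 2 u) s - mix D s u) * s i) (block D 2 v)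
     = ip D (block D 0 u) (\<lambda>i. block D 0 v i - 2 * (ip D (block D 0 v) s - mix D s v) * s i)
      + ip D (block D 1 u) (\<lambda>i. block D 1 v i - 2 * (ip D (block D 1 v) s - mix D s v) * s i)
      + ip D (block D 2 u) (\<lambda>i. block D 2 v i - 2 * (ip D (block D 2 v) s - mix D s v) * s i)" for u v
    unfolding G1 G2 by (simp add: mix_def field_simps)
  have c: "ip D (block D b (mix_op D s u)) s = 2 * mix D s u - ip D (block D b u) s" if "b < 3" for b u
    unfolding mix_op_def ip_block_glue(1)[OF that] ip_linear s by simp
  have m: "mix D s (mix_op D s u) = mix D s u" for u
    unfolding mix_def[of D s "mix_op D s u"] by (simp add: c) (simp add: mix_def add_divide_distrib)
  show "block D b (mix_op D s u) i - 2 * (ip D (block D b (mix_op D s u)) s - mix D s (mix_op D s u)) * s i = block D b u i"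
    if "b < 3" "i < D" for b u i
    unfolding c[OF that(1)] m unfolding mix_op_def by (simp add: block_glue[OF that] algebra_simps)
qed (simp add: mix_op_def)

text \<open>\<open>mix_op\<close> negates the part of \<open>(c0, c1, c2)\<close> orthogonal to the
  diagonal, so the inner product drops by twice the squared length of that part.\<close>

lemma ip_mix_op:
  "ip (Suc (3 * D)) w (mix_op D s w) = ip (Suc (3 * D)) w w
     - 2 * (let c0 = ip D (block D 0 w) s; c1 = ip D (block D 1 w) s; c2 = ip D (block D 2 w) s
            in c0\<^sup>2 + c1\<^sup>2 + c2\<^sup>2 - (c0 + c1 + c2)\<^sup>2 / 3)"
  unfolding ip_blocks mix_op_def
  by (simp add: ip_block_glue Let_def) (simp add: mix_def power2_eq_square field_simps)

section \<open>The recursion over the levels of NE\<close>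

primrec rne_dim :: "nat \<Rightarrow> nat" where
  "rne_dim 0 = 1"
| "rne_dim (Suc d) = Suc (3 * rne_dim d)"

text \<open>Values \<open>\<ge> 3 ^ d\<close> mean that the basis state makes no query.\<close>

primrec query_index :: "nat \<Rightarrow> nat \<Rightarrow> nat" where
  "query_index 0 l = l"
| "query_index (Suc d) l = (if l < 3 * rne_dim d \<and> query_index d (l mod rne_dim d) < 3 ^ d
     then query_index d (l mod rne_dim d) + (l div rne_dim d) * 3 ^ d else 3 ^ Suc d)"

definition queried :: "nat \<Rightarrow> nat set \<Rightarrow> nat \<Rightarrow> bool" where
  "queried d X l \<longleftrightarrow> query_index d l < 3 ^ d \<and> query_index d l \<in> X"

lemma queried_Suc:
  assumes "b < 3" "i < rne_dim d"
  shows "queried (Suc d) X (b * rne_dim d + i) \<longleftrightarrow> queried d {i. i + b * 3 ^ d \<in> X} i"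
proof -
  have "j + b * 3 ^ d < 3 ^ Suc d" if "j < 3 ^ d" for j
    using block_index[OF assms(1) that] by simp
  thus ?thesis using assms block_index[OF assms] by (auto simp: queried_def)
qed

lemma not_queried_Suc: "\<not> queried (Suc d) X (3 * rne_dim d)"
  by (simp add: queried_def)

text \<open>\<open>k\<close> is the number of queries; only they depend on \<open>X\<close>.
  Requiring the exact value \<open>p\<close>, rather than a bound, is what makes an error of 0
  possible. That the whole algorithm is a reflection is part of the induction, since the next level
  runs it twice.\<close>

definition computes :: "nat \<Rightarrow> nat \<Rightarrow> real \<Rightarrow> bool" where
  "computes d k p \<longleftrightarrow> (\<exists>Vs s. (\<forall>V\<in>set Vs. reflection (rne_dim d) V) \<and> Suc (length Vs) = k \<and>
     ip (rne_dim d) s s = 1 \<and> trunc (rne_dim d) s = s \<and>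
     (\<forall>X. reflection (rne_dim d) (algo (rne_dim d) (queried d X) Vs) \<and>
        (if NE d (bits (3 ^ d) X) then ip (rne_dim d) s (algo (rne_dim d) (queried d X) Vs s) = p
         else algo (rne_dim d) (queried d X) Vs s = s)))"

lemma computes_0: "computes 0 1 (-1)"
proof -
  have i: "ip 1 (basis 0) (basis 0) = 1" using ip_basis[of 0 1 "basis 0"] by (simp add: basis_def)
  have t: "trunc 1 (basis 0) = basis 0" by (auto simp: trunc_def basis_def fun_eq_iff)
  have "0 \<in> X \<Longrightarrow> trunc 1 (sign_flip (queried 0 X) (basis 0)) = (\<lambda>i. (-1) * basis 0 i)"
    "0 \<notin> X \<Longrightarrow> trunc 1 (sign_flip (queried 0 X) (basis 0)) = basis 0" for X
    by (auto simp: fun_eq_iff trunc_def sign_flip_def queried_def basis_def)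
  moreover have "NE 0 (bits (3 ^ 0) X) \<longleftrightarrow> 0 \<in> X" for X by (simp add: bits_def)
  moreover have "ip 1 (basis 0) (\<lambda>i. (-1) * basis 0 i) = -1" using i by (simp only: ip_linear)
  ultimately show ?thesis unfolding computes_def using i t
    by (intro exI[of _ "[]"] exI[of _ "basis 0"]) (auto simp: reflection_sign_flip)
qed

text \<open>For A R A with R the reflection about \<open>s\<close>, symmetry of A turns the new
  inner product into that of \<open>A s\<close> with \<open>R (A s)\<close>, which is the doubling
  formula again.\<close>

lemma computes_amplify:
  assumes "computes d k p"
  shows "computes d (2 * k) (2 * p\<^sup>2 - 1)"
proof -
  let ?D = "rne_dim d"
  obtain Vs s where Vs: "\<forall>V\<in>set Vs. reflection ?D V" "Suc (length Vs) = k"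
    and s: "ip ?D s s = 1" "trunc ?D s = s"
    and A: "\<And>X. reflection ?D (algo ?D (queried d X) Vs)"
      "\<And>X. if NE d (bits (3 ^ d) X) then ip ?D s (algo ?D (queried d X) Vs s) = p else algo ?D (queried d X) Vs s = s"
    using assms unfolding computes_def by blast
  let ?R = "refl_about ?D s"
  have R: "reflection ?D ?R" by (rule reflection_refl_about[OF s(1)])
  have "reflection ?D (algo ?D (queried d X) (Vs @ ?R # Vs))" for X
    using reflection_conj[OF A(1) R, of X] by (simp add: algo_append[abs_def])
  moreover have "if NE d (bits (3 ^ d) X) then ip ?D s (algo ?D (queried d X) (Vs @ ?R # Vs) s) = 2 * p\<^sup>2 - 1
     else algo ?D (queried d X) (Vs @ ?R # Vs) s = s" for X
  proof -
    define T where "T = algo ?D (queried d X) Vs"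
    have T: "reflection ?D T" unfolding T_def by (rule A(1))
    have e: "algo ?D (queried d X) (Vs @ ?R # Vs) s = T (?R (T s))" by (simp add: algo_append T_def)
    show ?thesis
    proof (cases "NE d (bits (3 ^ d) X)")
      case True
      hence p: "ip ?D s (T s) = p" using A(2)[of X] by (simp add: T_def)
      have "ip ?D s (T (?R (T s))) = ip ?D (T s) (?R (T s))"
        by (rule symmetric_op_adj[OF reflection_symmetric[OF T], symmetric])
      also have "\<dots> = 2 * p * ip ?D (T s) s - ip ?D (T s) (T s)"
        by (simp add: refl_about_def proj_on_def p)
      also have "\<dots> = 2 * p\<^sup>2 - 1" using p by (simp add: ip_commute[of ?D "T s" s] reflection_ip[OF T] s power2_eq_square)
      finally show ?thesis using True e by simp
    next
      case False
      hence "T s = s" using A(2)[of X] by (simp add: T_def)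
      thus ?thesis using False e by (simp add: refl_about_self s)
    qed
  qed
  ultimately show ?thesis unfolding computes_def
    using Vs s R by (intro exI[of _ "Vs @ ?R # Vs"] exI[of _ s]) auto
qed

text \<open>The coordinate \<open>3 * rne_dim d\<close> is an inert part of the new start vector; its weight \<open>e\<^sup>2 = 1 - a\<^sup>2\<close>
  tunes \<open>q\<close>.\<close>

lemma computes_level:
  assumes "computes d k p" and p: "p < 1" and q: "1 - 4 * (1 - p)\<^sup>2 / 9 \<le> q" "q \<le> 1"
  shows "computes (Suc d) (2 * k) q"
proof -
  let ?D = "rne_dim d" and ?D' = "Suc (3 * rne_dim d)"
  obtain Vs s where Vs: "\<forall>V\<in>set Vs. reflection ?D V" "Suc (length Vs) = k"
    and s: "ip ?D s s = 1" "trunc ?D s = s"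
    and A: "\<And>X. reflection ?D (algo ?D (queried d X) Vs)"
      "\<And>X. if NE d (bits (3 ^ d) X) then ip ?D s (algo ?D (queried d X) Vs s) = p else algo ?D (queried d X) Vs s = s"
    using assms(1) unfolding computes_def by blast
  \<comment> \<open>Solved from \<open>1 - q = 4/9 * a2 * (1 - p)^2\<close>; the hypotheses on
    \<open>q\<close> say that \<open>a2\<close> lies between 0 and 1. It is the total weight of the
    three blocks, hence \<open>a * a = a2 / 3\<close>.\<close>
  define a2 where "a2 = 9 * (1 - q) / (4 * (1 - p)\<^sup>2)"
  have a2: "0 \<le> a2" "a2 \<le> 1" "4 / 9 * a2 * (1 - p)\<^sup>2 = 1 - q"
    using p q by (auto simp: a2_def field_simps)
  define a where "a = sqrt (a2 / 3)"
  define e where "e = sqrt (1 - a2)"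
  have aa: "a * a = a2 / 3" "e * e = 1 - a2" using a2 by (simp_all add: a_def e_def)
  define s' where "s' = glue ?D (\<lambda>_ i. a * s i) e"
  define W where "W = mix_op ?D s"
  define Us where "Us = map (\<lambda>V. lift3 ?D (\<lambda>_. V)) Vs"
  have W: "reflection ?D' W" unfolding W_def by (rule reflection_mix_op[OF s(1)])
  have Us: "\<forall>U\<in>set Us. reflection ?D' U" using Vs(1) by (auto simp: Us_def intro: reflection_lift3)
  have s': "ip ?D' s' s' = 1" "trunc ?D' s' = s'"
    unfolding ip_blocks s'_def using aa s by (simp_all add: ip_block_glue)
  define Xb where "Xb X b = {i. i + b * 3 ^ d \<in> X}" for X :: "nat set" and b :: nat
  define T where "T X b = algo ?D (queried d (Xb X b)) Vs" for X b
  define Lf where "Lf X = lift3 ?D (T X)" for X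
  have TT: "reflection ?D (T X b)" for X b unfolding T_def by (rule A(1))
  have L: "reflection ?D' (Lf X)" for X unfolding Lf_def by (rule reflection_lift3) (rule TT)
  have algoL: "algo ?D' (queried (Suc d) X) Us u = Lf X u" for X u
    unfolding Us_def Lf_def T_def
    by (rule algo_lift3) (use Vs(1) queried_Suc not_queried_Suc in \<open>auto simp: Xb_def reflection_symmetric\<close>)
  have algo: "algo ?D' (queried (Suc d) X) (Us @ W # Us) = (\<lambda>u. Lf X (W (Lf X u)))" for X
    by (simp add: algo_append algoL fun_eq_iff)
  have main: "if NE (Suc d) (bits (3 ^ Suc d) X) then ip ?D' s' (Lf X (W (Lf X s'))) = q else Lf X (W (Lf X s')) = s'" for X
  proof -
    define N where "N b = NE d (bits (3 ^ d) (Xb X b))" for b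
    define g where "g b = (if N b then p else 1)" for b
    have NE: "NE (Suc d) (bits (3 ^ Suc d) X) \<longleftrightarrow> NE1 (N 0) (N 1) (N 2)"
      unfolding NE_bits_Suc by (simp add: N_def Xb_def)
    define w where "w = Lf X s'"
    have w: "w = glue ?D (\<lambda>b i. a * T X b s i) e"
    proof -
      have "T X b (block ?D b s') = (\<lambda>i. a * T X b s i)" if "b < 3" for b
      proof -
        have "T X b (block ?D b s') = T X b (\<lambda>i. a * s i)"
          unfolding s'_def by (rule symmetric_op_eq_if_trunc_eq[OF reflection_symmetric[OF TT] trunc_block_glue[OF that]])
        thus ?thesis by (simp add: symmetric_op_scale[OF reflection_symmetric[OF TT]])
      qed
      thus ?thesis unfolding w_def Lf_def lift3_def by (intro glue_cong) (auto simp: s'_def)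
    qed
    have g: "ip ?D (T X b s) s = g b" for b
    proof -
      have "ip ?D (T X b s) s = ip ?D s (T X b s)" by (rule ip_commute)
      also have "\<dots> = g b" using A(2)[of "Xb X b"] s by (cases "N b") (simp_all add: T_def g_def N_def)
      finally show ?thesis .
    qed
    have c: "ip ?D (block ?D b w) s = a * g b" if "b < 3" for b
      unfolding w using that by (simp add: ip_block_glue g)
    have ww: "ip ?D' w w = 1" unfolding w_def by (simp add: reflection_ip[OF L] s')
    show ?thesis
    proof (cases "NE1 (N 0) (N 1) (N 2)")
      case True
      have "ip ?D' s' (Lf X (W (Lf X s'))) = ip ?D' w (W w)"
        unfolding w_def by (rule symmetric_op_adj[OF reflection_symmetric[OF L], symmetric])
      also have "\<dots> = 1 - 2 * ((a * g 0)\<^sup>2 + (a * g 1)\<^sup>2 + (a * g 2)\<^sup>2 - (a * g 0 + a * g 1 + a * g 2)\<^sup>2 / 3)"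
        unfolding W_def ip_mix_op ww by (simp add: c Let_def)
      also have "\<dots> = 1 - 2 * (a * a) * ((g 0)\<^sup>2 + (g 1)\<^sup>2 + (g 2)\<^sup>2 - (g 0 + g 1 + g 2)\<^sup>2 / 3)"
        by (simp add: power2_eq_square algebra_simps add_divide_distrib)
      \<comment> \<open>Two of the three values agree and the third differs from them by
        \<open>1 - p\<close>; this is the squared distance of such a point from the
        diagonal.\<close>
      also have "(g 0)\<^sup>2 + (g 1)\<^sup>2 + (g 2)\<^sup>2 - (g 0 + g 1 + g 2)\<^sup>2 / 3 = 2 / 3 * (1 - p)\<^sup>2"
        using True by (auto simp: g_def NE1_def power2_eq_square field_simps)
      also have "1 - 2 * (a * a) * (2 / 3 * (1 - p)\<^sup>2) = 1 - 4 / 9 * a2 * (1 - p)\<^sup>2" unfolding aa by simp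
      also have "\<dots> = q" unfolding a2(3) by simp
      finally show ?thesis using True NE by simp
    next
      case False
      hence g12: "g 1 = g 0" "g 2 = g 0" by (auto simp: g_def NE1_def)
      have eq: "g b = g 0" if "b < 3" for b
      proof -
        from that consider "b = 0" | "b = 1" | "b = 2" by linarith
        thus ?thesis using g12 by cases simp_all
      qed
      \<comment> \<open>The three values agree, so \<open>w\<close> has no part that
        \<open>W\<close> negates, and the second run of the involution undoes the first.\<close>
      have "mix ?D s w = a * g 0" using g12 by (simp add: mix_def c)
      hence cm: "ip ?D (block ?D b w) s = mix ?D s w" if "b < 3" for b
        using c[OF that] eq[OF that] by simp
      have "W w = glue ?D (\<lambda>b. block ?D b w) (w (3 * ?D))"
        unfolding W_def mix_op_def by (intro glue_cong) (simp_all add: cm)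
      also have "\<dots> = w" unfolding glue_blocks by (simp add: w)
      finally have "Lf X (W (Lf X s')) = Lf X (Lf X s')" by (simp add: w_def)
      thus ?thesis using False NE s' by (simp add: reflection_invol[OF L])
    qed
  qed
  show ?thesis unfolding computes_def
  proof (intro exI[of _ "Us @ W # Us"] exI[of _ s'] conjI allI)
    show "\<forall>V\<in>set (Us @ W # Us). reflection (rne_dim (Suc d)) V" using Us W by auto
    show "Suc (length (Us @ W # Us)) = 2 * k" using Vs(2) by (simp add: Us_def)
    show "ip (rne_dim (Suc d)) s' s' = 1" "trunc (rne_dim (Suc d)) s' = s'" using s' by simp_all
  next
    fix X
    show "reflection (rne_dim (Suc d)) (algo (rne_dim (Suc d)) (queried (Suc d) X) (Us @ W # Us))"
      unfolding rne_dim.simps algo by (rule reflection_conj[OF L W])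
    show "if NE (Suc d) (bits (3 ^ Suc d) X)
       then ip (rne_dim (Suc d)) s' (algo (rne_dim (Suc d)) (queried (Suc d) X) (Us @ W # Us) s') = q
       else algo (rne_dim (Suc d)) (queried (Suc d) X) (Us @ W # Us) s' = s'"
      unfolding rne_dim.simps algo by (rule main)
  qed
qed

text \<open>In terms of \<open>1 - p\<close>, the levels and amplifications (marked \<open>A\<close>) take
  \<open>2, 16/9, 1.4, 0.87, A 1.9662, 1.71, 1.29, 0.73, A 1.8542, 1.52, 1, A 2\<close>.\<close>

lemma computes_eight_levels:
  assumes "computes d k (-1)"
  shows "computes (d + 8) (2048 * k) (-1)"
proof -
  have level: "computes d k (1 - r) \<Longrightarrow> 0 < r \<Longrightarrow> r' \<le> 4 * r\<^sup>2 / 9 \<Longrightarrow> 0 \<le> r' \<Longrightarrow> computes (Suc d) (2 * k) (1 - r')" for d k r r'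
    by (rule computes_level) auto
  have amp: "computes d (2 * k) (1 - r')" if "computes d k (1 - r)" "r' = 4 * r - 2 * r\<^sup>2" for d k r r'
  proof -
    have e: "2 * (1 - r)\<^sup>2 - 1 = 1 - r'" using that(2) by (simp add: power2_eq_square algebra_simps)
    show ?thesis using computes_amplify[OF that(1)] unfolding e .
  qed
  have "computes d k (1 - 2)" using assms by simp
  from level[OF this, of "16/9"] have "computes (Suc d) (2 * k) (1 - 16/9)" by (simp add: power2_eq_square)
  \<comment> \<open>From here on a level may round its value down, as the inert coordinate permits.
    The last level must give exactly 1, because only from there does amplification lead back to
    exactly 2.\<close>
  from level[OF this, of "14/10"] have "computes (Suc (Suc d)) (4 * k) (1 - 14/10)" by (simp add: power2_eq_square)
  from level[OF this, of "87/100"] have "computes (3 + d) (8 * k) (1 - 87/100)" by (simp add: power2_eq_square numeral_3_eq_3)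
  from amp[OF this, of "19662/10000"] have "computes (3 + d) (16 * k) (1 - 19662/10000)" by (simp add: power2_eq_square)
  from level[OF this, of "171/100"] have "computes (4 + d) (32 * k) (1 - 171/100)" by (simp add: power2_eq_square)
  from level[OF this, of "129/100"] have "computes (5 + d) (64 * k) (1 - 129/100)" by (simp add: power2_eq_square)
  from level[OF this, of "73/100"] have "computes (6 + d) (128 * k) (1 - 73/100)" by (simp add: power2_eq_square)
  from amp[OF this, of "18542/10000"] have "computes (6 + d) (256 * k) (1 - 18542/10000)" by (simp add: power2_eq_square)
  from level[OF this, of "152/100"] have "computes (7 + d) (512 * k) (1 - 152/100)" by (simp add: power2_eq_square)
  from level[OF this, of "1"] have "computes (8 + d) (1024 * k) (1 - 1)" by (simp add: power2_eq_square)
  from amp[OF this, of 2] show ?thesis by (simp add: add.commute)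
qed

text \<open>The second step handles the levels left over modulo 8, at a factor 4 each. The first one
  ends the recursion: at \<open>p = 0\<close> the two possible final states are orthogonal, so one
  measurement separates them with certainty.\<close>

lemma computes_one_level:
  assumes "computes d k (-1)"
  shows "computes (Suc d) (2 * k) 0" "computes (Suc d) (4 * k) (-1)"
proof -
  show "computes (Suc d) (2 * k) 0" by (rule computes_level[OF assms]) auto
  from computes_amplify[OF this] show "computes (Suc d) (4 * k) (-1)" by simp
qed

lemma computes_phase: "computes (8 * j + r) (2048 ^ j * 4 ^ r) (-1)"
proof (induction r)
  case 0
  show ?case
  proof (induction j)
    case (Suc j)
    from computes_eight_levels[OF this] show ?case by (simp add: algebra_simps)
  qed (use computes_0 in simp)
next
  case (Suc r)
  from computes_one_level(2)[OF this] show ?case by (simp add: algebra_simps)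
qed

lemma computes_exact: "\<exists>k \<le> 2 * 4 ^ 7 * 2048 ^ (d div 8). computes (Suc d) k 0"
proof (intro exI conjI)
  have d: "8 * (d div 8) + d mod 8 = d" by simp
  show "computes (Suc d) (2 * (2048 ^ (d div 8) * 4 ^ (d mod 8))) 0"
    using computes_one_level(1)[OF computes_phase[of "d div 8" "d mod 8"]] unfolding d .
  have "d mod 8 \<le> 7" using mod_less_divisor[of 8 d] by linarith
  hence "(4::nat) ^ (d mod 8) \<le> 4 ^ 7" by (intro power_increasing) auto
  hence "2 * (2048 ^ (d div 8) * 4 ^ (d mod 8)) \<le> 2 * (2048 ^ (d div 8) * (4::nat) ^ 7)"
    by (intro mult_le_mono) auto
  thus "2 * (2048 ^ (d div 8) * 4 ^ (d mod 8)) \<le> 2 * 4 ^ 7 * (2048::nat) ^ (d div 8)"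
    by (simp only: mult_ac)
qed

section \<open>The upper bounds\<close>

text \<open>Half of the \<open>2 * n\<close> basis states query nothing. Without them, flipping all
  signs would give \<open>p 0 = -1\<close>, which the measurements do not notice; with them
  \<open>p 0\<close> is \<open>1 - card Z / n\<close>, so \<open>1 - (p 0)^2\<close> is at least
  \<open>1 / n\<close> on members. Then the probability of not accepting is at most
  \<open>n / 4^m\<close>, hence at most 1/3.\<close>

lemma INTS_machine:
  assumes n: "1 \<le> n" and m: "3 * n \<le> 4 ^ m" "1 \<le> m"
  shows "TS_2QCFA (L_INTS n) \<le> ennreal (real ((2 ^ m - 1) * (6*n+3)) * (log 2 (2*(2*n)) + log 2 ((2 ^ m - 1) * (6*n+3) + 2)))"
proof -
  let ?D = "2 * n" and ?K = "(2::nat) ^ m - 1"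
  define s where "s = trunc ?D (\<lambda>_. 1 / sqrt (real ?D))"
  have ss: "ip ?D s s = 1" "trunc ?D s = s"
    unfolding s_def ip_trunc using n by (simp_all add: ip_def)
  obtain H where H: "reflection ?D H" "H (basis 0) = s"
    using ex_preparation[OF _ ss(1)] ss(2) n by auto
  have V: "reflection ?D (Grover_V H ?D s k)" for k
    by (simp add: Grover_V_def H reflection_refl_about ss)
  have P: "projection ?D (Grover_P ?D s k)" for k
    by (simp add: Grover_P_def compl_op_projection projection_proj_on ss projection_zero)
  obtain m' where m': "m = Suc m'" using m(2) by (cases m) auto
  have D1: "1 \<le> ?D" using n by simp
  have K: "1 \<le> ?K" unfolding m' by (cases "(2::nat) ^ m'") auto
  obtain M :: "letter qcfa" where M: "wf_qcfa M"
    "qcfa_TS M \<le> ennreal (real (?K * (6*n+3)) * (log 2 (2*?D) + log 2 (?K * (6*n+3) + 2)))"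
    "\<And>w. (\<nexists>x y. length x = n \<and> length y = n \<and> w = padded x n y) \<Longrightarrow> qcfa_accept_prob M w = 0"
    "\<And>x y. length x = n \<Longrightarrow> length y = n \<Longrightarrow>
       qcfa_accept_prob M (padded x n y) = 1 - (let \<psi> = query_state ?D (Grover_V H ?D s) (Grover_P ?D s) (\<lambda>l. l < n \<and> x ! l \<and> y ! l) ?K in ip ?D \<psi> \<psi>)"
    by (rule query_machine[where V="Grover_V H ?D s" and P="Grover_P ?D s" and loc="\<lambda>l. l", OF n D1 K V P]) blast
  have acc: "(padded x n y \<in> L_INTS n \<longrightarrow> 2/3 \<le> qcfa_accept_prob M (padded x n y)) \<and>
     (padded x n y \<notin> L_INTS n \<longrightarrow> qcfa_accept_prob M (padded x n y) = 0)"
    if len: "length x = n" "length y = n" for x y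
  proof -
    define z where "z l \<longleftrightarrow> l < n \<and> x ! l \<and> y ! l" for l
    define S where "S = (\<lambda>u. trunc ?D (sign_flip z u))"
    define B where "B u = S (refl_about ?D s u)" for u
    define p where "p r = ip ?D s ((B ^^ (2 ^ r)) s)" for r :: nat
    define c where "c = (\<Prod>r<m. p r)"
    have S: "reflection ?D S" unfolding S_def by (rule reflection_sign_flip)
    have "query_state ?D (Grover_V H ?D s) (Grover_P ?D s) z ?K = (\<lambda>i. c * s i)"
      using Grover_state(2)[where m="?D" and s=s and H=H and z=z and r=m', OF ss H(2)] unfolding m'[symmetric]
      by (simp add: c_def p_def B_def[abs_def] S_def)
    hence pr: "qcfa_accept_prob M (padded x n y) = 1 - c\<^sup>2"
      using M(4)[OF len] ss by (simp add: z_def[abs_def] power2_eq_square)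
    show ?thesis
    proof (intro conjI impI)
      assume "padded x n y \<in> L_INTS n"
      then obtain i where i: "z i" by (auto simp: padded_in_L_INTS[OF len] z_def)
      define Z where "Z = {l. l < n \<and> z l}"
      have Z: "finite Z" "i \<in> Z" "card Z \<le> n"
        using i card_mono[of "{..<n}" Z] by (auto simp: Z_def z_def)
      have cZ: "1 \<le> card Z" using Z by (auto simp: Suc_le_eq card_gt_0_iff)
      have "B s = S s" unfolding B_def by (simp add: refl_about_self ss)
      hence "p 0 = ip ?D s (sign_flip z s)" by (simp add: p_def S_def)
      also have "\<dots> = (\<Sum>l<?D. (1 - 2 * of_bool (l \<in> Z)) * (1 / ?D))"
        unfolding ip_def s_def using n
        by (intro sum.cong) (auto simp: trunc_def sign_flip_def Z_def z_def)
      also have "\<dots> = (\<Sum>l<?D. 1 - 2 * of_bool (l \<in> Z)) * (1 / ?D)" by (rule sum_distrib_right[symmetric])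
      also have "(\<Sum>l<?D. 1 - 2 * of_bool (l \<in> Z)) = real ?D - 2 * card Z"
      proof -
        have "{..<?D} \<inter> Z = Z" by (auto simp: Z_def)
        thus ?thesis by (simp add: sum_subtractf sum_distrib_left[symmetric] of_bool_def sum.If_cases)
      qed
      also have "\<dots> * (1 / ?D) = 1 - card Z / n" using n by (simp add: field_simps)
      finally have p0: "p 0 = 1 - card Z / n" .
      have t: "1 / n \<le> card Z / n" "card Z / n \<le> 1" using Z(3) cZ n by (simp_all add: field_simps)
      have "1 / n \<le> (card Z / n) * (2 - card Z / n)"
      proof -
        have "1 / n * 1 \<le> (card Z / n) * (2 - card Z / n)" using t by (intro mult_mono) auto
        thus ?thesis by simp
      qed
      also have "\<dots> = 1 - (p 0)\<^sup>2" unfolding p0 by (simp add: power2_eq_square algebra_simps)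
      finally have "c\<^sup>2 * 4 ^ m * (1 / n) \<le> c\<^sup>2 * 4 ^ m * (1 - (p 0)\<^sup>2)" by (intro mult_left_mono) auto
      also have "\<dots> \<le> 1"
        using Grover_survival[OF ss S, of m] unfolding c_def p_def B_def[abs_def] by simp
      finally have "c\<^sup>2 * 4 ^ m \<le> n" using n by (simp add: field_simps)
      moreover have "c\<^sup>2 * (3 * n) \<le> c\<^sup>2 * 4 ^ m"
        using m(1) by (intro mult_left_mono) (simp_all flip: of_nat_le_iff[where 'a=real])
      ultimately have "(3 * c\<^sup>2) * real n \<le> 1 * real n" by (simp add: mult_ac)
      hence "c\<^sup>2 \<le> 1/3" using n by (subst (asm) mult_le_cancel_right) auto
      thus "2/3 \<le> qcfa_accept_prob M (padded x n y)" unfolding pr by simp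
    next
      assume "padded x n y \<notin> L_INTS n"
      hence "\<not> z l" for l by (auto simp: padded_in_L_INTS[OF len] z_def)
      hence "sign_flip z u = u" for u by (auto simp: sign_flip_def fun_eq_iff)
      hence "B s = s" by (simp add: B_def S_def refl_about_self ss)
      hence "(B ^^ k) s = s" for k by (induction k) simp_all
      hence "p r = 1" for r by (simp add: p_def ss)
      thus "qcfa_accept_prob M (padded x n y) = 0" unfolding pr by (simp add: c_def)
    qed
  qed
  have "recognizes_with_error (qcfa_accept_prob M) (L_INTS n) (1/3)"
    unfolding recognizes_with_error_def
  proof (intro allI conjI impI)
    fix w assume "w \<in> L_INTS n"
    moreover from this obtain x y where "length x = n" "length y = n" "w = padded x n y" by (auto simp: L_INTS_def)
    ultimately show "1 - 1/3 \<le> qcfa_accept_prob M w" using acc[of x y] by simp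
  next
    fix w assume w: "w \<notin> L_INTS n"
    show "qcfa_accept_prob M w \<le> 1/3"
    proof (cases "\<exists>x y. length x = n \<and> length y = n \<and> w = padded x n y")
      case True
      thus ?thesis using acc w by auto
    qed (simp add: M(3))
  qed
  hence "TS_2QCFA (L_INTS n) \<le> qcfa_TS M"
    unfolding TS_2QCFA_def using M(1) by (intro INF_lower) simp
  thus ?thesis using M(2) by simp
qed

lemma ex_power_4_bounds: "1 \<le> n \<Longrightarrow> \<exists>m\<ge>1. 3 * n \<le> 4 ^ m \<and> 4 ^ m \<le> 12 * (n::nat)"
proof (induction n rule: nat_induct_at_least)
  case base
  show ?case by (rule exI[of _ 1]) simp
next
  case (Suc n)
  then obtain m where m: "1 \<le> m" "3 * n \<le> 4 ^ m" "4 ^ m \<le> 12 * n" by blast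
  show ?case
  proof (cases "3 * Suc n \<le> 4 ^ m")
    case True
    thus ?thesis using m by (intro exI[of _ m]) auto
  next
    case False
    thus ?thesis using m Suc.hyps by (intro exI[of _ "Suc m"]) auto
  qed
qed

text \<open>From \<open>4^m \<le> 12 * n\<close> there are at most \<open>4 * sqrt n\<close> rounds,
  each of at most \<open>9 * n\<close> steps. The two logarithms contribute 3 and 8 times
  \<open>log 2 n\<close>, and 396 is 36 * 11.\<close>

lemma TS_2QCFA_INTS:
  assumes n: "2 \<le> n"
  shows "TS_2QCFA (L_INTS n) \<le> ennreal (396 * (real n powr (3/2) * log 2 (real n)))"
proof -
  obtain m where m: "1 \<le> m" "3 * n \<le> 4 ^ m" "4 ^ m \<le> 12 * n" using ex_power_4_bounds[of n] n by auto
  define L where "L = (2 ^ m - 1) * (6*n+3)"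
  have lg: "1 \<le> log 2 n" using n by (simp add: le_log_iff)
  have m2: "(2 ^ m)\<^sup>2 \<le> real (12 * n)"
  proof -
    have "((2::nat) ^ m)\<^sup>2 = 4 ^ m" by (simp add: power2_eq_square flip: power_mult_distrib)
    hence "((2::nat) ^ m)\<^sup>2 \<le> 12 * n" using m(3) by simp
    hence "real (((2::nat) ^ m)\<^sup>2) \<le> real (12 * n)" by (simp only: of_nat_le_iff)
    thus ?thesis by simp
  qed
  have sq: "2 ^ m \<le> 4 * sqrt n"
  proof -
    have "(2 ^ m)\<^sup>2 \<le> (4 * sqrt n)\<^sup>2" using m2 by (simp add: power_mult_distrib)
    thus ?thesis by (rule power2_le_imp_le) simp
  qed
  have pw: "sqrt n * n = real n powr (3/2)"
  proof -
    have "sqrt n * n = real n powr (1/2) * real n powr 1" using n by (simp add: powr_half_sqrt)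
    also have "\<dots> = real n powr (3/2)" by (simp only: powr_add[symmetric]) simp
    finally show ?thesis .
  qed
  have "(2::nat) ^ m * (6*n+3) \<le> 2 ^ m * (9*n)" using n by (intro mult_left_mono) auto
  hence "L \<le> 2 ^ m * (9*n)" unfolding L_def by (meson diff_le_self le_trans mult_le_mono1)
  hence "real L \<le> real (2 ^ m * (9 * n))" by (simp only: of_nat_le_iff)
  hence L9: "real L \<le> 2 ^ m * (9 * real n)" by simp
  also have "\<dots> \<le> 4 * sqrt n * (9 * real n)" using sq by (intro mult_right_mono) auto
  finally have L: "real L \<le> 36 * real n powr (3/2)" unfolding pw[symmetric] by simp
  have "real L \<le> 4 * real n * (9 * real n)"
  proof -
    have "sqrt n * 1 \<le> sqrt n * sqrt n" using n by (intro mult_left_mono) auto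
    hence "sqrt n \<le> n" by simp
    hence "2 ^ m * (9 * real n) \<le> 4 * real n * (9 * real n)" using sq by (intro mult_right_mono) auto
    thus ?thesis using L9 by linarith
  qed
  moreover have "2 * 2 \<le> real n * n" using n by (intro mult_mono) auto
  ultimately have "real L + 2 \<le> 64 * (real n * n)" by simp
  hence "log 2 (real L + 2) \<le> log 2 (64 * (real n * n))" by (subst log_le_cancel_iff) (use n in auto)
  also have "\<dots> = 6 + 2 * log 2 n"
  proof -
    have "log 2 (64::real) = 6" using log_pow_cancel[of 2 6] by simp
    thus ?thesis using n by (simp add: log_mult)
  qed
  finally have l2: "log 2 (real L + 2) \<le> 8 * log 2 n" using lg by linarith
  have "log 2 (4 * real n) = 2 + log 2 n"
  proof -
    have "log 2 (4::real) = 2" using log_pow_cancel[of 2 2] by simp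
    thus ?thesis using n by (simp add: log_mult)
  qed
  hence l1: "log 2 (4 * real n) \<le> 3 * log 2 n" using lg by linarith
  have "TS_2QCFA (L_INTS n) \<le> ennreal (real L * (log 2 (real (2 * (2 * n))) + log 2 (real (L + 2))))"
    unfolding L_def by (rule INTS_machine) (use m n in auto)
  also have "\<dots> = ennreal (real L * (log 2 (4 * real n) + log 2 (real L + 2)))" by (simp add: add.commute)
  also have "\<dots> \<le> ennreal (36 * real n powr (3/2) * (11 * log 2 n))"
    using l1 l2 L lg n by (intro ennreal_leI mult_mono) (auto intro!: add_nonneg_nonneg)
  finally show ?thesis by (simp add: mult_ac)
qed

section \<open>The exact machine for the iterated NE\<close>

lemma algo_query_state:
  assumes H: "H (basis 0) = s" and Vs: "\<forall>V\<in>set Vs. symmetric_op m V" and j: "j \<le> length Vs"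
    and V: "V 0 = H" "\<And>k. k < length Vs \<Longrightarrow> V (Suc k) = Vs ! k"
    and P: "\<And>k. k < length Vs \<Longrightarrow> P k = (\<lambda>u i. 0)"
  shows "trunc m (sign_flip z (V j (query_state m V P z j))) = algo m z (take j Vs) s"
  using j
proof (induction j)
  case 0
  show ?case by (simp add: V H)
next
  case (Suc j)
  hence j: "j < length Vs" by simp
  have "query_state m V P z (Suc j) = algo m z (take j Vs) s"
    using Suc j by (simp add: P compl_zero)
  thus ?case using j by (simp add: V(2) take_Suc_conv_app_nth algo_append)
qed

lemma rne_dim_bounds: "1 \<le> rne_dim d" "rne_dim d \<le> 2 * 3 ^ d - 1"
  by (induction d) auto

text \<open>The final state is \<open>s\<close> on value 0 and orthogonal to \<open>s\<close> on
  value 1, so the only effective measurement, in the last round, accepts on the complement of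
  \<open>s\<close>.\<close>

lemma RNE_machine:
  assumes "computes d k 0"
  shows "TS_2QCFA_exact (L_RNE d) \<le> ennreal (real (k * (6*3^d+3)) * (log 2 (2 * rne_dim d) + log 2 (k * (6*3^d+3) + 2)))"
proof -
  let ?D = "rne_dim d" and ?n = "(3::nat) ^ d"
  obtain Vs s where Vs: "\<forall>V\<in>set Vs. reflection ?D V" "Suc (length Vs) = k"
    and s: "ip ?D s s = 1" "trunc ?D s = s"
    and A: "\<And>X. reflection ?D (algo ?D (queried d X) Vs)"
      "\<And>X. if NE d (bits (3 ^ d) X) then ip ?D s (algo ?D (queried d X) Vs s) = 0 else algo ?D (queried d X) Vs s = s"
    using assms unfolding computes_def by blast
  obtain H where H: "reflection ?D H" "H (basis 0) = s"
    using ex_preparation[OF rne_dim_bounds(1) s(1)] s(2) by auto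
  \<comment> \<open>\<open>query_machine\<close> wants a reflection for every index; beyond the last
    round \<open>H\<close> is a mere default.\<close>
  define V where "V j = (if j = 0 then H else if j \<le> length Vs then Vs ! (j - 1) else H)" for j
  define P where "P j = (if j = length Vs then compl_op ?D (proj_on ?D s) else (\<lambda>u i. 0))" for j
  have V: "reflection ?D (V j)" for j using Vs H by (auto simp: V_def)
  have P: "projection ?D (P j)" for j
    by (simp add: P_def compl_op_projection projection_proj_on s projection_zero)
  have n: "1 \<le> ?n" and k: "1 \<le> k" using Vs(2) by auto
  obtain M :: "letter qcfa" where M: "wf_qcfa M"
    "qcfa_TS M \<le> ennreal (real (k * (6*?n+3)) * (log 2 (2*?D) + log 2 (k * (6*?n+3) + 2)))"
    "\<And>w. (\<nexists>x y. length x = ?n \<and> length y = ?n \<and> w = padded x ?n y) \<Longrightarrow> qcfa_accept_prob M w = 0"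
    "\<And>x y. length x = ?n \<Longrightarrow> length y = ?n \<Longrightarrow>
       qcfa_accept_prob M (padded x ?n y) = 1 - (let \<psi> = query_state ?D V P (\<lambda>l. query_index d l < ?n \<and> x ! query_index d l \<and> y ! query_index d l) k in ip ?D \<psi> \<psi>)"
    by (rule query_machine[where V=V and P=P and loc="query_index d", OF n rne_dim_bounds(1) k V P]) blast
  have acc: "qcfa_accept_prob M (padded x ?n y) = of_bool (padded x ?n y \<in> L_RNE d)"
    if len: "length x = ?n" "length y = ?n" for x y
  proof -
    define X where "X = {i. i < ?n \<and> x ! i \<and> y ! i}"
    have bits: "map2 (\<and>) x y = bits ?n X"
      by (rule nth_equalityI) (auto simp: len X_def)
    have z: "(\<lambda>l. query_index d l < ?n \<and> x ! query_index d l \<and> y ! query_index d l) = queried d X"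
      by (auto simp: queried_def X_def fun_eq_iff)
    define T where "T = algo ?D (queried d X) Vs"
    have "trunc ?D (sign_flip (queried d X) (V (length Vs) (query_state ?D V P (queried d X) (length Vs)))) = T s"
      unfolding T_def
      by (subst algo_query_state[where Vs=Vs and H=H and s=s])
         (use Vs H in \<open>auto simp: V_def P_def reflection_symmetric\<close>)
    hence "proj_on ?D s (T s) = proj_on ?D s (sign_flip (queried d X) (V (length Vs) (query_state ?D V P (queried d X) (length Vs))))"
      by (simp add: proj_on_def flip: \<open>trunc ?D _ = T s\<close>)
    hence "query_state ?D V P (queried d X) k = proj_on ?D s (T s)"
      unfolding Vs(2)[symmetric] by (simp add: P_def compl_compl_proj_on)
    hence pr: "qcfa_accept_prob M (padded x ?n y) = 1 - (ip ?D s (T s))\<^sup>2"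
      using M(4)[OF len] s unfolding z by (simp add: proj_on_def power2_eq_square)
    have "padded x ?n y \<in> L_RNE d \<longleftrightarrow> NE d (bits ?n X)" using padded_in_L_RNE[OF len] by (simp add: bits)
    thus ?thesis using A(2)[of X] s unfolding pr T_def[symmetric] by (auto split: if_splits)
  qed
  have "recognizes_with_error (qcfa_accept_prob M) (L_RNE d) 0"
    unfolding recognizes_with_error_def
  proof (intro allI conjI impI)
    fix w assume "w \<in> L_RNE d"
    moreover from this obtain x y where "length x = ?n" "length y = ?n" "w = padded x ?n y" by (auto simp: L_RNE_def)
    ultimately show "1 - 0 \<le> qcfa_accept_prob M w" using acc[of x y] by simp
  next
    fix w assume w: "w \<notin> L_RNE d"
    show "qcfa_accept_prob M w \<le> 0"
    proof (cases "\<exists>x y. length x = ?n \<and> length y = ?n \<and> w = padded x ?n y")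
      case True
      thus ?thesis using acc w by auto
    qed (simp add: M(3))
  qed
  hence "TS_2QCFA_exact (L_RNE d) \<le> qcfa_TS M"
    unfolding TS_2QCFA_exact_def using M(1) by (intro INF_lower) simp
  thus ?thesis using M(2) by simp
qed

text \<open>The exponent \<open>1.87\<close>: eight levels cost eleven doublings, and \<open>2 ^ 275 \<le> 3 ^ 174\<close>, where
  \<open>275 = 11 * 25\<close> and \<open>174 = 0.87 * 8 * 25\<close>.\<close>

lemma power_2048_le: "2048 ^ (d div 8) \<le> real (3 ^ d) powr 0.87"
proof -
  have "(2048::real) ^ 25 \<le> 3 ^ 174" by simp
  hence "(2048::real) powr 25 \<le> 3 powr 174" by (simp flip: powr_realpow)
  hence "((2048::real) powr 25) powr (1/25) \<le> (3 powr 174) powr (1/25)" by (intro powr_mono2) auto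
  moreover have "((2048::real) powr 25) powr (1/25) = 2048" by (simp only: powr_powr) simp
  moreover have "((3::real) powr 174) powr (1/25) = 3 powr 6.96" by (simp only: powr_powr) simp
  ultimately have b: "(2048::real) \<le> 3 powr 6.96" by (simp only:)
  have "(2048::real) ^ (d div 8) \<le> (3 powr 6.96) ^ (d div 8)" by (rule power_mono[OF b]) simp
  also have "\<dots> = 3 powr (6.96 * real (d div 8))" by (simp add: powr_powr flip: powr_realpow)
  also have "\<dots> \<le> 3 powr (0.87 * real d)"
  proof (rule powr_mono)
    have "8 * (d div 8) \<le> d" by simp
    hence "8 * real (d div 8) \<le> real d" by (metis of_nat_le_iff of_nat_mult of_nat_numeral)
    thus "6.96 * real (d div 8) \<le> 0.87 * real d" by simp
  qed simp
  also have "\<dots> = real (3 ^ d) powr 0.87" by (simp add: powr_powr mult.commute flip: powr_realpow)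
  finally show ?thesis .
qed

lemma TS_2QCFA_exact_RNE:
  assumes d: "1 \<le> d"
  shows "TS_2QCFA_exact (L_RNE d) \<le> ennreal (8000000 * (real (3 ^ d) powr 1.87 * log 2 (real (3 ^ d))))"
proof -
  obtain e where e: "d = Suc e" using d by (cases d) auto
  define N where "N = real (3 ^ d)"
  obtain k where k: "k \<le> 2 * 4 ^ 7 * 2048 ^ (e div 8)" "computes d k 0" using computes_exact[of e] e by auto
  have N3: "3 \<le> N" unfolding N_def e by simp
  have lg: "1 \<le> log 2 N" using N3 by (simp add: le_log_iff)
  have "real k \<le> real (2 * 4 ^ 7 * 2048 ^ (e div 8))" using k(1) by (simp only: of_nat_le_iff)
  also have "\<dots> = 32768 * 2048 ^ (e div 8)" by simp
  also have "\<dots> \<le> 32768 * real (3 ^ e) powr 0.87" by (intro mult_left_mono power_2048_le) simp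
  also have "\<dots> \<le> 32768 * N powr 0.87" unfolding N_def e by (intro mult_left_mono powr_mono2) auto
  finally have kN: "real k \<le> 32768 * N powr 0.87" .
  define L where "L = k * (6*3^d+3)"
  have "real L = real k * (6 * N + 3)" by (simp add: L_def N_def)
  also have "\<dots> \<le> (32768 * N powr 0.87) * (9 * N)" using kN N3 by (intro mult_mono) auto
  also have "\<dots> = 294912 * (N powr 0.87 * N powr 1)" using N3 by simp
  also have "\<dots> = 294912 * N powr 1.87" by (simp only: powr_add[symmetric]) simp
  finally have L: "real L \<le> 294912 * N powr 1.87" .
  have "N powr 1.87 \<le> N powr 2" using N3 by (intro powr_mono) auto
  hence "real L \<le> 294912 * (N * N)" using L N3 by (simp add: power2_eq_square)
  moreover have "1 * 1 \<le> N * N" using N3 by (intro mult_mono) auto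
  ultimately have "real L + 2 \<le> 524288 * (N * N)" by simp
  hence "log 2 (real L + 2) \<le> log 2 (524288 * (N * N))" by (subst log_le_cancel_iff) (use N3 in auto)
  also have "\<dots> = 19 + 2 * log 2 N"
  proof -
    have "log 2 (524288::real) = 19" using log_pow_cancel[of 2 19] by simp
    thus ?thesis using N3 by (simp add: log_mult)
  qed
  finally have l2: "log 2 (real L + 2) \<le> 21 * log 2 N" using lg by linarith
  have "real (2 * rne_dim d) \<le> 4 * N"
  proof -
    have "2 * rne_dim d \<le> 4 * 3 ^ d" using rne_dim_bounds(2)[of d] by linarith
    hence "real (2 * rne_dim d) \<le> real (4 * 3 ^ d)" by (simp only: of_nat_le_iff)
    thus ?thesis by (simp add: N_def)
  qed
  moreover have d0: "0 < real (2 * rne_dim d)" using rne_dim_bounds(1)[of d] by simp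
  ultimately have "log 2 (real (2 * rne_dim d)) \<le> log 2 (4 * N)" by (subst log_le_cancel_iff) (use N3 in auto)
  also have "\<dots> = 2 + log 2 N"
  proof -
    have "log 2 (4::real) = 2" using log_pow_cancel[of 2 2] by simp
    thus ?thesis using N3 by (simp add: log_mult)
  qed
  finally have l1: "log 2 (real (2 * rne_dim d)) \<le> 3 * log 2 N" using lg by linarith
  have l0: "0 \<le> log 2 (real (2 * rne_dim d))" using rne_dim_bounds(1)[of d] by simp
  have "TS_2QCFA_exact (L_RNE d) \<le> ennreal (real L * (log 2 (real (2 * rne_dim d)) + log 2 (real (L + 2))))"
    unfolding L_def by (rule RNE_machine[OF k(2)])
  also have "\<dots> = ennreal (real L * (log 2 (real (2 * rne_dim d)) + log 2 (real L + 2)))" by (simp add: add.commute)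
  \<comment> \<open>Here 294912 is \<open>2 * 4^7 * 9\<close>: the constant of
    \<open>computes_exact\<close> times at most \<open>9 * N\<close> steps per query. The 24
    collects the factors 3 and 21 of the two logarithms.\<close>
  also have "\<dots> \<le> ennreal (294912 * N powr 1.87 * (24 * log 2 N))"
    using l1 l2 l0 L lg by (intro ennreal_leI mult_mono) (auto intro!: add_nonneg_nonneg)
  also have "\<dots> \<le> ennreal (8000000 * (N powr 1.87 * log 2 N))"
  proof (rule ennreal_leI)
    have "0 \<le> N powr 1.87 * log 2 N" using lg by simp
    thus "294912 * N powr 1.87 * (24 * log 2 N) \<le> 8000000 * (N powr 1.87 * log 2 N)" by (simp add: mult_ac)
  qed
  finally show ?thesis by (simp add: N_def)
qed

theorem theorem6:
  shows "bigomega_ennreal (\<lambda>n. TS_2PFA (L_INTS n)) (\<lambda>n. real n ^ 2) \<and>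
         bigo_ennreal (\<lambda>n. TS_2QCFA (L_INTS n)) (\<lambda>n. real n powr (3/2) * log 2 (real n)) \<and>
         bigomega_ennreal (\<lambda>d. TS_2PFA (L_RNE d)) (\<lambda>d. real (3 ^ d) ^ 2) \<and>
         bigo_ennreal (\<lambda>d. TS_2QCFA_exact (L_RNE d))
           (\<lambda>d. real (3 ^ d) powr 1.87 * log 2 (real (3 ^ d)))"
proof (intro conjI)
  show "bigomega_ennreal (\<lambda>n. TS_2PFA (L_INTS n)) (\<lambda>n. real n ^ 2)"
    unfolding bigomega_ennreal_def
    by (intro exI[of _ "1/1728"] conjI eventually_sequentiallyI[of 1]) (use TS_2PFA_INTS in auto)
  show "bigo_ennreal (\<lambda>n. TS_2QCFA (L_INTS n)) (\<lambda>n. real n powr (3/2) * log 2 (real n))"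
    unfolding bigo_ennreal_def
    by (intro exI[of _ 396] conjI eventually_sequentiallyI[of 2] TS_2QCFA_INTS) auto
  show "bigomega_ennreal (\<lambda>d. TS_2PFA (L_RNE d)) (\<lambda>d. real (3 ^ d) ^ 2)"
    unfolding bigomega_ennreal_def
    by (intro exI[of _ "1/1728"] conjI always_eventually allI) (use TS_2PFA_RNE in auto)
  show "bigo_ennreal (\<lambda>d. TS_2QCFA_exact (L_RNE d)) (\<lambda>d. real (3 ^ d) powr 1.87 * log 2 (real (3 ^ d)))"
    unfolding bigo_ennreal_def
    by (intro exI[of _ 8000000] conjI eventually_sequentiallyI[of 1] TS_2QCFA_exact_RNE) auto
qed

end
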